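(* Suppose that $\delta>0$ is sufficiently small in the sense that the Zarantonello mapping is a contraction with constant $0<q_{\rm sym}<1$ (see context), and that the error estimator satisfies (A1)--(A3). Choose $\lambda_{\rm alg}^\star>0$ depending only on $q_{\rm alg}$ and $q_{\rm sym}$ such that $$0<\overline q_{\rm sym}:=\frac{q_{\rm sym}+2\,\frac{q_{\rm alg}}{1-q_{\rm alg}}\,\lambda_{\rm alg}^\star}{1-2\,\frac{q_{\rm alg}}{1-q_{\rm alg}}\,\lambda_{\rm alg}^\star}<1 .$$ Then, for arbitrary $0<\theta\le 1$ and $0<\lambda_{\rm sym}\le 1$, there exists $0<\lambda_{\rm alg}'\le\lambda_{\rm alg}^\star$ such that, for all $0<\lambda_{\rm alg}\le\lambda_{\rm alg}'$, the AISFEM algorithm guarantees full linear convergence: There exist constants $C_{\rm lin}>0$ and $0<q_{\rm lin}<1$ as well as an index $\ell_0\in\mathbb N_0$ with $\ell_0\le\underline\ell$ such that the quasi-error $$\Delta_\ell^{k,j}:=\|u^\star-u_\ell^{k,j}\|_a+\|u_\ell^{k,\star}-u_\ell^{k,j}\|_a+\eta_\ell(u_\ell^{k,j})\qquad\text{for all }(\ell,k,j)\in\mathcal Q$$ satisfies, for all $(\ell,k,j),(\ell',k',j')\in\mathcal Q$ with $|\ell,k,j|>|\ell',k',j'|$ and $\ell'\ge\ell_0$, $$\Delta_\ell^{k,j}\le C_{\rm lin}\,q_{\rm lin}^{|\ell,k,j|-|\ell',k',j'|}\,\Delta_{\ell'}^{k',j'} .$$ The constants $C_{\rm lin}$ and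 $q_{\rm lin}$ as well as the index $\ell_0$ depend only on $C_{\rm stab}$, $C_{\rm rel}$, $q_{\rm red}$, $q_{\rm sym}$, $q_{\rm alg}$, $\theta$, $\lambda_{\rm sym}$, $\lambda_{\rm alg}$, and $C_{\text{Céa}}=L/\alpha$.
   Context: **Model problem.** $\Omega\subset\mathbb R^d$, $d\ge1$, is a polyhedral Lipschitz domain; $\boldsymbol A\in[L^\infty(\Omega)]^{d\times d}$ is symmetric, $\boldsymbol b\in[L^\infty(\Omega)]^d$, $c\in L^\infty(\Omega)$, $f\in L^2(\Omega)$, $\boldsymbol f\in[L^2(\Omega)]^d$. Let $\mathcal X:=H_0^1(\Omega)$ with dual $\mathcal X'$, $\langle\cdot,\cdot\rangle_\Omega$ the $L^2(\Omega)$ scalar product, $a(u,v):=\langle\boldsymbol A\nabla u,\nabla v\rangle_\Omega$, $\langle\mathcal Ku,v\rangle:=\langle\boldsymbol b\cdot\nabla u+cu,v\rangle_\Omega$ (a compact operator $\mathcal K:\mathcal X\to\mathcal X'$), $b(u,v):=a(u,v)+\langle\mathcal Ku,v\rangle$, $F(v):=\langle f,v\rangle_\Omega+\langle\boldsymbol f,\nabla v\rangle_\Omega$. Standing assumption: $b(\cdot,\cdot)$ is continuous and elliptic on $\mathcal X$. Then $a(\cdot,\cdot)$ is a scalar product on $\mathcal X$ whose energy norm $\|v\|_a:=a(v,v)^{1/2}$ is equivalent to the $H^1_0$ norm, and there are constants $0<\alpha\le L<\infty$ with $\alpha\|u\|_a^2\le b(u,u)$ and $|b(u,v)|\le L\|u\|_a\|v\|_a$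 for all $u,v\in\mathcal X$. The exact solution $u^\star\in\mathcal X$ satisfies $b(u^\star,v)=F(v)$ for all $v\in\mathcal X$. **Meshes and discrete spaces.** $\mathcal T_0$ is a conforming simplicial triangulation of $\Omega$ (admissible in the sense of Stevenson 2008 if $d\ge3$). Refinement uses newest vertex bisection (NVB): $\mathtt{refine}(\mathcal T_H,\mathcal M_H)$ is the coarsest conforming NVB refinement of $\mathcal T_H$ in which all elements of $\mathcal M_H\subseteq\mathcal T_H$ are refined. $\mathbb T(\mathcal T_H)$ is the set of all triangulations obtained from $\mathcal T_H$ by finitely many refinement steps; $\mathbb T:=\mathbb T(\mathcal T_0)$. For a fixed polynomial degree $m\in\mathbb N$ and $\mathcal T_H\in\mathbb T$, $\mathcal X_H:=\{v\in H_0^1(\Omega): v|_T\text{ is a polynomial of degree}\le m\ \forall T\in\mathcal T_H\}$, and $u_H^\star\in\mathcal X_H$ is the Galerkin solution: $b(u_H^\star,v_H)=F(v_H)$ for all $v_H\in\mathcal X_H$. Objects related to $\mathcal T_\ell$ carry the index $\ell$. **Error estimator.** For $\mathcal T_H\in\mathbb T$ and $T\in\mathcal T_H$, $\eta_H(T;\cdot):\mathcal X_H\to\mathbb R_{\ge0}$ are the local contributions of a computable estimator; $\eta_H(\mathcal U_H;v_H):=(\sum_{T\in\mathcal U_H}\eta_H(T;v_H)^2)^{1/2}$ for $\mathcal U_H\subseteq\mathcal T_H$, $\eta_H(v_H):=\eta_H(\mathcal T_H;v_H)$. Axioms, with constants $C_{\rm stab},C_{\rm rel}>0$, $0<q_{\rm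 red}<1$ depending only on $d$, $m$, and shape regularity of $\mathcal T_0$, for all $\mathcal T_H\in\mathbb T$ and $\mathcal T_h\in\mathbb T(\mathcal T_H)$: (A1) stability: $|\eta_h(\mathcal U_H;v_h)-\eta_H(\mathcal U_H;v_H)|\le C_{\rm stab}\|v_h-v_H\|_a$ for all $v_h\in\mathcal X_h$, $v_H\in\mathcal X_H$, $\mathcal U_H\subseteq\mathcal T_H\cap\mathcal T_h$. (A2) reduction: $\eta_h(\mathcal T_h\setminus\mathcal T_H;v_H)\le q_{\rm red}\,\eta_H(\mathcal T_H\setminus\mathcal T_h;v_H)$ for all $v_H\in\mathcal X_H$. (A3) reliability: $\|u^\star-u_H^\star\|_a\le C_{\rm rel}\,\eta_H(u_H^\star)$. **Zarantonello mapping.** For $\delta>0$, $\Phi_H(\delta;\cdot):\mathcal X_H\to\mathcal X_H$ is defined by $a(\Phi_H(\delta;u_H),v_H)=a(u_H,v_H)+\delta[F(v_H)-b(u_H,v_H)]$ for all $v_H\in\mathcal X_H$. For $0<\delta<2\alpha/L^2$ it is a contraction: there is $0<q_{\rm sym}<1$, independent of $\mathcal T_H$, with $\|\Phi_H(\delta;u_H)-\Phi_H(\delta;w_H)\|_a\le q_{\rm sym}\|u_H-w_H\|_a$ for all $u_H,w_H\in\mathcal X_H$. "$\delta$ sufficiently small" means that this holds; in particular $\|u_\ell^\star-u_\ell^{k,\star}\|_a\le q_{\rm sym}\|u_\ell^\star-u_\ell^{k-1,\underline j}\|_a$ for the iterates below. **Algebraic solver.** For each $\mathcal T_H\in\mathbb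 T$ there is an iteration map $\Psi_H:\mathcal X'\times\mathcal X_H\to\mathcal X_H$ and a constant $0<q_{\rm alg}<1$ independent of $G$ and $\mathcal X_H$ such that, for $G\in\mathcal X'$ and $w_H^\star\in\mathcal X_H$ with $a(w_H^\star,v_H)=G(v_H)$ for all $v_H\in\mathcal X_H$, $\|w_H^\star-\Psi_H(G;w_H)\|_a\le q_{\rm alg}\|w_H^\star-w_H\|_a$ for all $w_H\in\mathcal X_H$. **AISFEM algorithm.** Input: $\mathcal T_0$, $u_0^{0,0}:=u_0^{0,\underline j}:=u_0^{0,\star}:=0$, $0<\theta\le1$, $C_{\rm mark}\ge1$, $\lambda_{\rm sym},\lambda_{\rm alg}>0$, $\delta>0$. For $\ell=0,1,2,\dots$ repeat (i)--(iv): (i) For $k=1,2,3,\dots$ repeat (a)--(d): (a) $u_\ell^{k,0}:=u_\ell^{k-1,\underline j}$ and (for theoretical reasons only) $u_\ell^{k,\star}:=\Phi_\ell(\delta;u_\ell^{k-1,\underline j})$. (b) For $j=1,2,3,\dots$: (I) compute $u_\ell^{k,j}:=\Psi_\ell(G_\ell^k;u_\ell^{k,j-1})$ with $G_\ell^k(v):=a(u_\ell^{k-1,\underline j},v)+\delta[F(v)-b(u_\ell^{k-1,\underline j},v)]$, and $\eta_\ell(T;u_\ell^{k,j})$ for all $T\in\mathcal T_\ell$; (II) terminate the $j$-loop if $\|u_\ell^{k,j}-u_\ell^{k,j-1}\|_a\le\lambda_{\rm alg}[\lambda_{\rm sym}\eta_\ell(u_\ell^{k,j})+\|u_\ell^{k,j}-u_\ell^{k-1,\underline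 j}\|_a]$. (c) Set $\underline j[\ell,k]:=j$. (d) Terminate the $k$-loop if $\|u_\ell^{k,\underline j}-u_\ell^{k-1,\underline j}\|_a\le\lambda_{\rm sym}\eta_\ell(u_\ell^{k,\underline j})$. (ii) Set $\underline k[\ell]:=k$. (iii) Determine $\mathcal M_\ell\subseteq\mathcal T_\ell$ with $\theta\,\eta_\ell(u_\ell^{\underline k,\underline j})^2\le\eta_\ell(\mathcal M_\ell;u_\ell^{\underline k,\underline j})^2$ whose cardinality is minimal among all such sets up to the factor $C_{\rm mark}$. (iv) $\mathcal T_{\ell+1}:=\mathtt{refine}(\mathcal T_\ell,\mathcal M_\ell)$ and $u_{\ell+1}^{0,0}:=u_{\ell+1}^{0,\underline j}:=u_{\ell+1}^{0,\star}:=u_\ell^{\underline k,\underline j}$. Arguments of $\underline k,\underline j$ are omitted when clear, e.g. $u_\ell^{k,\underline j}:=u_\ell^{k,\underline j[\ell,k]}$, $u_\ell^{\underline k,\underline j}:=u_\ell^{\underline k[\ell],\underline j[\ell,\underline k[\ell]]}$. **Index set.** $\mathcal Q:=\{(\ell,k,j)\in\mathbb N_0^3: u_\ell^{k,j}\text{ is used in the algorithm}\}$ (which runs without overall stopping, so $\#\mathcal Q=\infty$), $\underline\ell:=\sup\{\ell:(\ell,0,0)\in\mathcal Q\}$, $\underline k[\ell]:=\sup\{k:(\ell,k,0)\in\mathcal Q\}$, $\underline j[\ell,k]:=\sup\{j:(\ell,k,j)\in\mathcal Q\}$, all in $\mathbb N_0\cup\{\infty\}$. $\mathcal Q$ is totally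 ordered lexicographically (i.e., by the order of computation in the algorithm), and $|\ell,k,j|:=\#\{(\ell',k',j')\in\mathcal Q:(\ell',k',j')\le(\ell,k,j)\}$. *)

theory Defs
  imports "HOL-Analysis.Analysis" "HOL-Library.Extended_Nat"
begin

section \<open>Euclidean space of dimension d\<close>

text \<open>
  The constants of the theorem must not depend on the space dimension, so the dimension is
  quantified inside the statement and cannot be a type. Points of \<open>R^d\<close> are therefore the
  extensional functions \<open>{..<d} \<rightarrow>\<^sub>E UNIV\<close>, with topology \<^term>\<open>powertop_real {..<d}\<close> and the product
  Lebesgue--Borel measure.
\<close>

type_synonym pt = "nat \<Rightarrow> real"
type_synonym fn = "pt \<Rightarrow> real"

definition Rd :: "nat \<Rightarrow> pt set"
  where "Rd d = {..<d} \<rightarrow>\<^sub>E UNIV"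

definition vol :: "nat \<Rightarrow> pt set \<Rightarrow> pt measure"
  where "vol d \<Omega> = restrict_space (Pi\<^sub>M {..<d} (\<lambda>_. lborel)) \<Omega>"

definition dot :: "nat \<Rightarrow> pt \<Rightarrow> pt \<Rightarrow> real"
  where "dot d x y = (\<Sum>i<d. x i * y i)"

definition edist :: "nat \<Rightarrow> pt \<Rightarrow> pt \<Rightarrow> real"
  where "edist d x y = L2_set (\<lambda>i. x i - y i) {..<d}"

definition midpt :: "nat \<Rightarrow> pt \<Rightarrow> pt \<Rightarrow> pt"
  where "midpt d x y = (\<lambda>i\<in>{..<d}. (x i + y i) / 2)"

text \<open>For finite \<open>S\<close>; the function type is not a \<open>real_vector\<close>, so \<open>convex hull\<close> does not apply.\<close>

definition chull :: "nat \<Rightarrow> pt set \<Rightarrow> pt set"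
  where "chull d S =
    {(\<lambda>i\<in>{..<d}. \<Sum>z\<in>S. c z * z i) | c. (\<forall>z\<in>S. 0 \<le> c z) \<and> (\<Sum>z\<in>S. c z) = (1::real)}"

definition aff_indep :: "nat \<Rightarrow> pt set \<Rightarrow> bool"
  where "aff_indep d S \<longleftrightarrow>
    (\<forall>c. (\<Sum>z\<in>S. c z) = (0::real) \<and> (\<forall>i<d. (\<Sum>z\<in>S. c z * z i) = 0) \<longrightarrow> (\<forall>z\<in>S. c z = 0))"

text \<open>
  Near each boundary point, \<open>\<Omega>\<close> is the part of a ball above a Lipschitz graph in the direction of a
  unit vector \<open>\<nu>\<close>; \<open>\<gamma>\<close> is evaluated at the component orthogonal to \<open>\<nu>\<close>.
\<close>

definition lipschitz_boundary :: "nat \<Rightarrow> pt set \<Rightarrow> bool"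
  where "lipschitz_boundary d \<Omega> \<longleftrightarrow>
    (\<forall>x\<in>powertop_real {..<d} frontier_of \<Omega>. \<exists>\<nu>\<in>Rd d. \<exists>r>0. \<exists>\<Lambda>::real. \<exists>\<gamma>::fn.
        dot d \<nu> \<nu> = 1 \<and>
        (\<forall>y\<in>Rd d. \<forall>z\<in>Rd d. \<bar>\<gamma> y - \<gamma> z\<bar> \<le> \<Lambda> * edist d y z) \<and>
        (\<forall>y\<in>Rd d. edist d x y < r \<longrightarrow>
           (y \<in> \<Omega> \<longleftrightarrow> \<gamma> (\<lambda>i\<in>{..<d}. y i - dot d \<nu> y * \<nu> i) < dot d \<nu> y)))"

definition polyhedral_lipschitz_domain :: "nat \<Rightarrow> pt set \<Rightarrow> bool"
  where "polyhedral_lipschitz_domain d \<Omega> \<longleftrightarrow>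
    \<Omega> \<noteq> {} \<and> openin (powertop_real {..<d}) \<Omega> \<and> connectedin (powertop_real {..<d}) \<Omega> \<and>
    (\<exists>B. \<forall>x\<in>\<Omega>. \<forall>i<d. \<bar>x i\<bar> \<le> B) \<and> lipschitz_boundary d \<Omega> \<and>
    (\<exists>\<P>. finite \<P> \<and> (\<forall>S\<in>\<P>. finite S \<and> S \<subseteq> Rd d) \<and>
       powertop_real {..<d} closure_of \<Omega> = (\<Union>S\<in>\<P>. chull d S))"


section \<open>Lebesgue and Sobolev spaces\<close>

text \<open>
  Elements of function spaces are represented by functions; equality in the function space is
  equality almost everywhere. Values outside \<open>\<Omega>\<close> are irrelevant.
\<close>

definition L2 :: "nat \<Rightarrow> pt set \<Rightarrow> fn set"
  where "L2 d \<Omega> = {f \<in> borel_measurable (vol d \<Omega>). integrable (vol d \<Omega>) (\<lambda>x. (f x)\<^sup>2)}"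

definition Linf :: "nat \<Rightarrow> pt set \<Rightarrow> fn set"
  where "Linf d \<Omega> = {f \<in> borel_measurable (vol d \<Omega>). \<exists>B. AE x in vol d \<Omega>. \<bar>f x\<bar> \<le> B}"

definition pd :: "nat \<Rightarrow> fn \<Rightarrow> fn"
  where "pd i \<phi> x = deriv (\<lambda>t. \<phi> (x(i := t))) (x i)"

text \<open>Smoothness: iterated partial derivatives of every order exist and are continuous.\<close>

definition smooth :: "nat \<Rightarrow> fn \<Rightarrow> bool"
  where "smooth d \<phi> \<longleftrightarrow>
    (\<forall>is. set is \<subseteq> {..<d} \<longrightarrow>
       continuous_map (powertop_real {..<d}) euclideanreal (foldr pd is \<phi>) \<and>
       (\<forall>x\<in>Rd d. \<forall>i<d. (\<lambda>t. foldr pd is \<phi> (x(i := t))) field_differentiable at (x i)))"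

definition test_functions :: "nat \<Rightarrow> pt set \<Rightarrow> fn set"
  where "test_functions d \<Omega> =
    {\<phi>. smooth d \<phi> \<and>
        compactin (powertop_real {..<d}) (powertop_real {..<d} closure_of {x \<in> Rd d. \<phi> x \<noteq> 0}) \<and>
        powertop_real {..<d} closure_of {x \<in> Rd d. \<phi> x \<noteq> 0} \<subseteq> \<Omega>}"

definition weak_gradient :: "nat \<Rightarrow> pt set \<Rightarrow> fn \<Rightarrow> (nat \<Rightarrow> fn) \<Rightarrow> bool"
  where "weak_gradient d \<Omega> u g \<longleftrightarrow>
    (\<forall>i<d. g i \<in> L2 d \<Omega> \<and>
       (\<forall>\<phi>\<in>test_functions d \<Omega>.
          (\<integral>x. u x * pd i \<phi> x \<partial>vol d \<Omega>) = - (\<integral>x. g i x * \<phi> x \<partial>vol d \<Omega>)))"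

definition H1 :: "nat \<Rightarrow> pt set \<Rightarrow> fn set"
  where "H1 d \<Omega> = {u \<in> L2 d \<Omega>. \<exists>g. weak_gradient d \<Omega> u g}"

text \<open>A representative of the weak gradient, which is unique almost everywhere.\<close>

definition grad :: "nat \<Rightarrow> pt set \<Rightarrow> fn \<Rightarrow> nat \<Rightarrow> fn"
  where "grad d \<Omega> u = (SOME g. weak_gradient d \<Omega> u g)"

definition h1norm :: "nat \<Rightarrow> pt set \<Rightarrow> fn \<Rightarrow> real"
  where "h1norm d \<Omega> u =
    sqrt ((\<integral>x. (u x)\<^sup>2 \<partial>vol d \<Omega>) + (\<Sum>i<d. \<integral>x. (grad d \<Omega> u i x)\<^sup>2 \<partial>vol d \<Omega>))"

definition H10 :: "nat \<Rightarrow> pt set \<Rightarrow> fn set"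
  where "H10 d \<Omega> =
    {u \<in> H1 d \<Omega>. \<exists>\<phi>. (\<forall>n::nat. \<phi> n \<in> test_functions d \<Omega>) \<and>
        (\<lambda>n. h1norm d \<Omega> (\<lambda>x. u x - \<phi> n x)) \<longlonglongrightarrow> 0}"


section \<open>Model problem\<close>

record bvp =
  dm :: nat
  omega :: "pt set"
  cA :: "nat \<Rightarrow> nat \<Rightarrow> fn"
  cb :: "nat \<Rightarrow> fn"
  cc :: fn
  rf :: fn
  rfv :: "nat \<Rightarrow> fn"

abbreviation XX :: "bvp \<Rightarrow> fn set"
  where "XX P \<equiv> H10 (dm P) (omega P)"

abbreviation gr :: "bvp \<Rightarrow> fn \<Rightarrow> nat \<Rightarrow> fn"
  where "gr P \<equiv> grad (dm P) (omega P)"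

abbreviation vo :: "bvp \<Rightarrow> pt measure"
  where "vo P \<equiv> vol (dm P) (omega P)"

definition aform :: "bvp \<Rightarrow> fn \<Rightarrow> fn \<Rightarrow> real"
  where "aform P u v =
    (\<integral>x. (\<Sum>i<dm P. (\<Sum>j<dm P. cA P i j x * gr P u j x) * gr P v i x) \<partial>vo P)"

definition Kform :: "bvp \<Rightarrow> fn \<Rightarrow> fn \<Rightarrow> real"
  where "Kform P u v = (\<integral>x. ((\<Sum>i<dm P. cb P i x * gr P u i x) + cc P x * u x) * v x \<partial>vo P)"

definition bform :: "bvp \<Rightarrow> fn \<Rightarrow> fn \<Rightarrow> real"
  where "bform P u v = aform P u v + Kform P u v"

definition Ffun :: "bvp \<Rightarrow> fn \<Rightarrow> real"
  where "Ffun P v =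
    (\<integral>x. rf P x * v x \<partial>vo P) + (\<integral>x. (\<Sum>i<dm P. rfv P i x * gr P v i x) \<partial>vo P)"

definition enorm :: "bvp \<Rightarrow> fn \<Rightarrow> real"
  where "enorm P v = sqrt (aform P v v)"

definition edst :: "bvp \<Rightarrow> fn \<Rightarrow> fn \<Rightarrow> real"
  where "edst P v w = enorm P (\<lambda>x. v x - w x)"

definition dual :: "bvp \<Rightarrow> (fn \<Rightarrow> real) set"
  where "dual P =
    {G. (\<forall>u\<in>XX P. \<forall>v\<in>XX P. \<forall>r s. G (\<lambda>x. r * u x + s * v x) = r * G u + s * G v) \<and>
        (\<exists>C. \<forall>v\<in>XX P. \<bar>G v\<bar> \<le> C * h1norm (dm P) (omega P) v)}"

definition problem_data :: "bvp \<Rightarrow> bool"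
  where "problem_data P \<longleftrightarrow>
    1 \<le> dm P \<and> polyhedral_lipschitz_domain (dm P) (omega P) \<and>
    (\<forall>i<dm P. \<forall>j<dm P. cA P i j \<in> Linf (dm P) (omega P)) \<and>
    (AE x in vo P. \<forall>i<dm P. \<forall>j<dm P. cA P i j x = cA P j i x) \<and>
    (\<forall>i<dm P. cb P i \<in> Linf (dm P) (omega P)) \<and> cc P \<in> Linf (dm P) (omega P) \<and>
    rf P \<in> L2 (dm P) (omega P) \<and> (\<forall>i<dm P. rfv P i \<in> L2 (dm P) (omega P))"

definition continuous_elliptic :: "bvp \<Rightarrow> bool"
  where "continuous_elliptic P \<longleftrightarrow>
    (\<exists>C. \<forall>u\<in>XX P. \<forall>v\<in>XX P.
       \<bar>bform P u v\<bar> \<le> C * h1norm (dm P) (omega P) u * h1norm (dm P) (omega P) v) \<and>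
    (\<exists>c>0. \<forall>u\<in>XX P. c * (h1norm (dm P) (omega P) u)\<^sup>2 \<le> bform P u u)"

text \<open>
  The energy norm is equivalent to the norm of \<open>H\<^sup>1\<^sub>0\<close> (the lower bound makes \<^const>\<open>aform\<close> positive
  definite), and \<open>\<alpha>\<close>, \<open>L\<close> are ellipticity and continuity constants of \<^const>\<open>bform\<close> with respect to it.
\<close>

definition energy_constants :: "bvp \<Rightarrow> real \<Rightarrow> real \<Rightarrow> bool"
  where "energy_constants P \<alpha> L \<longleftrightarrow>
    (\<exists>c>0. \<exists>C>0. \<forall>v\<in>XX P. c * h1norm (dm P) (omega P) v \<le> enorm P v \<and>
                            enorm P v \<le> C * h1norm (dm P) (omega P) v) \<and>
    0 < \<alpha> \<and> \<alpha> \<le> L \<and>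
    (\<forall>u\<in>XX P. \<alpha> * (enorm P u)\<^sup>2 \<le> bform P u u) \<and>
    (\<forall>u\<in>XX P. \<forall>v\<in>XX P. \<bar>bform P u v\<bar> \<le> L * enorm P u * enorm P v)"

definition exact_solution :: "bvp \<Rightarrow> fn \<Rightarrow> bool"
  where "exact_solution P u \<longleftrightarrow> u \<in> XX P \<and> (\<forall>v\<in>XX P. bform P u v = Ffun P v)"


section \<open>Newest vertex bisection\<close>

text \<open>
  A tagged simplex \<open>(z\<^sub>0, \<dots>, z\<^sub>d)\<^sub>\<gamma>\<close> in the sense of Stevenson: ordered vertices and a type
  \<open>\<gamma> < d\<close>; the refinement edge joins \<open>z\<^sub>0\<close> and \<open>z\<^sub>d\<close>.
\<close>

type_synonym tsimplex = "pt list \<times> nat"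
type_synonym mesh = "tsimplex set"

abbreviation verts :: "tsimplex \<Rightarrow> pt set"
  where "verts t \<equiv> set (fst t)"

definition body :: "nat \<Rightarrow> tsimplex \<Rightarrow> pt set"
  where "body d t = chull d (verts t)"

definition tagged_simplex :: "nat \<Rightarrow> tsimplex \<Rightarrow> bool"
  where "tagged_simplex d t \<longleftrightarrow>
    length (fst t) = d + 1 \<and> distinct (fst t) \<and> verts t \<subseteq> Rd d \<and> aff_indep d (verts t) \<and> snd t < d"

text \<open>
  The children are
  \<open>(z\<^sub>0, m, z\<^sub>1, \<dots>, z\<^sub>\<gamma>, z\<^bsub>\<gamma>+1\<^esub>, \<dots>, z\<^bsub>d-1\<^esub>)\<close> and
  \<open>(z\<^sub>d, m, z\<^sub>1, \<dots>, z\<^sub>\<gamma>, z\<^bsub>d-1\<^esub>, \<dots>, z\<^bsub>\<gamma>+1\<^esub>)\<close>, both of type \<open>(\<gamma> + 1) mod d\<close>, where \<open>m\<close> is the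
  midpoint of the refinement edge. For \<open>d \<le> 2\<close> the type has no influence on the children's vertices.
\<close>

definition children :: "nat \<Rightarrow> tsimplex \<Rightarrow> mesh"
  where "children d t =
    (let zs = fst t; \<gamma> = snd t; m = midpt d (hd zs) (last zs); inner = butlast (tl zs)
     in {(hd zs # m # inner, Suc \<gamma> mod d),
         (last zs # m # take \<gamma> inner @ rev (drop \<gamma> inner), Suc \<gamma> mod d)})"

definition conforming :: "nat \<Rightarrow> mesh \<Rightarrow> bool"
  where "conforming d \<T> \<longleftrightarrow>
    inj_on verts \<T> \<and> (\<forall>t\<in>\<T>. \<forall>t'\<in>\<T>. body d t \<inter> body d t' = chull d (verts t \<inter> verts t'))"

definition triangulation :: "nat \<Rightarrow> pt set \<Rightarrow> mesh \<Rightarrow> bool"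
  where "triangulation d \<Omega> \<T> \<longleftrightarrow>
    finite \<T> \<and> (\<forall>t\<in>\<T>. tagged_simplex d t) \<and> conforming d \<T> \<and>
    (\<Union>t\<in>\<T>. body d t) = powertop_real {..<d} closure_of \<Omega>"

text \<open>
  Stevenson's admissibility (2008): all simplices have the same type and any two neighbours match.
  \<open>flip_tag\<close> is the other tagging of the same simplex that yields the same children.
\<close>

definition neighbours :: "nat \<Rightarrow> tsimplex \<Rightarrow> tsimplex \<Rightarrow> bool"
  where "neighbours d t t' \<longleftrightarrow> verts t \<noteq> verts t' \<and> card (verts t \<inter> verts t') = d"

definition flip_tag :: "tsimplex \<Rightarrow> tsimplex"
  where "flip_tag t =
    (let zs = fst t; \<gamma> = snd t; inner = butlast (tl zs)
     in (last zs # take \<gamma> inner @ rev (drop \<gamma> inner) @ [hd zs], \<gamma>))"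

definition all_but_one :: "nat \<Rightarrow> pt list \<Rightarrow> pt list \<Rightarrow> bool"
  where "all_but_one d xs ys \<longleftrightarrow> card {i. i \<le> d \<and> xs ! i \<noteq> ys ! i} = 1"

definition reflected_neighbours :: "nat \<Rightarrow> tsimplex \<Rightarrow> tsimplex \<Rightarrow> bool"
  where "reflected_neighbours d t t' \<longleftrightarrow>
    snd t = snd t' \<and> neighbours d t t' \<and>
    (all_but_one d (fst t) (fst t') \<or> all_but_one d (fst (flip_tag t)) (fst t'))"

definition refinement_edge :: "tsimplex \<Rightarrow> pt set"
  where "refinement_edge t = {hd (fst t), last (fst t)}"

definition admissible :: "nat \<Rightarrow> mesh \<Rightarrow> bool"
  where "admissible d \<T> \<longleftrightarrow>
    (\<exists>\<gamma>. \<forall>t\<in>\<T>. snd t = \<gamma>) \<and>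
    (\<forall>t\<in>\<T>. \<forall>t'\<in>\<T>. neighbours d t t' \<longrightarrow>
       (if refinement_edge t \<subseteq> verts t' \<or> refinement_edge t' \<subseteq> verts t
        then reflected_neighbours d t t'
        else (\<forall>s\<in>children d t. \<forall>s'\<in>children d t'.
                neighbours d s s' \<longrightarrow> reflected_neighbours d s s')))"

definition initial_mesh :: "nat \<Rightarrow> pt set \<Rightarrow> mesh \<Rightarrow> bool"
  where "initial_mesh d \<Omega> \<T> \<longleftrightarrow> triangulation d \<Omega> \<T> \<and> (3 \<le> d \<longrightarrow> admissible d \<T>)"

text \<open>Refinement by finitely many bisections, not necessarily conforming.\<close>

inductive nvb :: "nat \<Rightarrow> mesh \<Rightarrow> mesh \<Rightarrow> bool" for d :: nat and \<T> :: mesh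
  where
    nvb_refl: "nvb d \<T> \<T>"
  | nvb_bisect: "nvb d \<T> \<S> \<Longrightarrow> t \<in> \<S> \<Longrightarrow> nvb d \<T> (\<S> - {t} \<union> children d t)"

text \<open>\<open>\<T>'\<close> is the coarsest conforming refinement of \<open>\<T>\<close> in which every element of \<open>\<M>\<close> is bisected.\<close>

definition is_refine :: "nat \<Rightarrow> mesh \<Rightarrow> mesh \<Rightarrow> mesh \<Rightarrow> bool"
  where "is_refine d \<T> \<M> \<T>' \<longleftrightarrow>
    \<M> \<subseteq> \<T> \<and> nvb d \<T> \<T>' \<and> conforming d \<T>' \<and> \<M> \<inter> \<T>' = {} \<and>
    (\<forall>\<S>. nvb d \<T> \<S> \<and> conforming d \<S> \<and> \<M> \<inter> \<S> = {} \<longrightarrow> nvb d \<T>' \<S>)"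

inductive_set refinements :: "nat \<Rightarrow> mesh \<Rightarrow> mesh set" for d :: nat and \<T> :: mesh
  where
    refinements_self: "\<T> \<in> refinements d \<T>"
  | refinements_step: "\<S> \<in> refinements d \<T> \<Longrightarrow> is_refine d \<S> \<M> \<S>' \<Longrightarrow> \<S>' \<in> refinements d \<T>"


section \<open>Discrete spaces, estimator, Zarantonello mapping and algebraic solver\<close>

definition polynomial_fun :: "nat \<Rightarrow> nat \<Rightarrow> fn \<Rightarrow> bool"
  where "polynomial_fun d m p \<longleftrightarrow>
    (\<exists>c. \<forall>x\<in>Rd d. p x =
       (\<Sum>\<beta> | \<beta> \<in> {..<d} \<rightarrow>\<^sub>E {..m} \<and> (\<Sum>i<d. \<beta> i) \<le> m. c \<beta> * (\<Prod>i<d. x i ^ \<beta> i)))"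

definition VH :: "bvp \<Rightarrow> nat \<Rightarrow> mesh \<Rightarrow> fn set"
  where "VH P m \<T> =
    {v \<in> XX P. \<forall>t\<in>\<T>. \<exists>p. polynomial_fun (dm P) m p \<and>
        (AE x in vo P. x \<in> body (dm P) t \<longrightarrow> v x = p x)}"

definition galerkin_solutions :: "bvp \<Rightarrow> nat \<Rightarrow> mesh \<Rightarrow> (mesh \<Rightarrow> fn) \<Rightarrow> bool"
  where "galerkin_solutions P m \<T>0 uG \<longleftrightarrow>
    (\<forall>\<T>\<in>refinements (dm P) \<T>0.
       uG \<T> \<in> VH P m \<T> \<and> (\<forall>v\<in>VH P m \<T>. bform P (uG \<T>) v = Ffun P v))"

type_synonym estimator = "mesh \<Rightarrow> tsimplex \<Rightarrow> fn \<Rightarrow> real"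

definition eta_set :: "estimator \<Rightarrow> mesh \<Rightarrow> mesh \<Rightarrow> fn \<Rightarrow> real"
  where "eta_set \<eta> \<T> \<U> v = sqrt (\<Sum>t\<in>\<U>. (\<eta> \<T> t v)\<^sup>2)"

abbreviation eta_tot :: "estimator \<Rightarrow> mesh \<Rightarrow> fn \<Rightarrow> real"
  where "eta_tot \<eta> \<T> v \<equiv> eta_set \<eta> \<T> \<T> v"

definition estimator_nonneg :: "bvp \<Rightarrow> nat \<Rightarrow> mesh \<Rightarrow> estimator \<Rightarrow> bool"
  where "estimator_nonneg P m \<T>0 \<eta> \<longleftrightarrow>
    (\<forall>\<T>\<in>refinements (dm P) \<T>0. \<forall>t\<in>\<T>. \<forall>v\<in>VH P m \<T>. 0 \<le> \<eta> \<T> t v)"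

definition stability :: "bvp \<Rightarrow> nat \<Rightarrow> mesh \<Rightarrow> estimator \<Rightarrow> real \<Rightarrow> bool"
  where "stability P m \<T>0 \<eta> Cstab \<longleftrightarrow>
    (\<forall>\<T>\<in>refinements (dm P) \<T>0. \<forall>\<T>'\<in>refinements (dm P) \<T>.
       \<forall>v'\<in>VH P m \<T>'. \<forall>v\<in>VH P m \<T>. \<forall>\<U>. \<U> \<subseteq> \<T> \<inter> \<T>' \<longrightarrow>
         \<bar>eta_set \<eta> \<T>' \<U> v' - eta_set \<eta> \<T> \<U> v\<bar> \<le> Cstab * edst P v' v)"

definition reduction :: "bvp \<Rightarrow> nat \<Rightarrow> mesh \<Rightarrow> estimator \<Rightarrow> real \<Rightarrow> bool"
  where "reduction P m \<T>0 \<eta> qred \<longleftrightarrow>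
    (\<forall>\<T>\<in>refinements (dm P) \<T>0. \<forall>\<T>'\<in>refinements (dm P) \<T>. \<forall>v\<in>VH P m \<T>.
       eta_set \<eta> \<T>' (\<T>' - \<T>) v \<le> qred * eta_set \<eta> \<T> (\<T> - \<T>') v)"

definition reliability ::
    "bvp \<Rightarrow> mesh \<Rightarrow> estimator \<Rightarrow> fn \<Rightarrow> (mesh \<Rightarrow> fn) \<Rightarrow> real \<Rightarrow> bool"
  where "reliability P \<T>0 \<eta> ustar uG Crel \<longleftrightarrow>
    (\<forall>\<T>\<in>refinements (dm P) \<T>0. edst P ustar (uG \<T>) \<le> Crel * eta_tot \<eta> \<T> (uG \<T>))"

definition Gfun :: "bvp \<Rightarrow> real \<Rightarrow> fn \<Rightarrow> fn \<Rightarrow> real"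
  where "Gfun P \<delta> w v = aform P w v + \<delta> * (Ffun P v - bform P w v)"

definition zarantonello_map :: "bvp \<Rightarrow> nat \<Rightarrow> mesh \<Rightarrow> real \<Rightarrow> (mesh \<Rightarrow> fn \<Rightarrow> fn) \<Rightarrow> bool"
  where "zarantonello_map P m \<T>0 \<delta> \<Phi> \<longleftrightarrow>
    (\<forall>\<T>\<in>refinements (dm P) \<T>0. \<forall>u\<in>VH P m \<T>.
       \<Phi> \<T> u \<in> VH P m \<T> \<and> (\<forall>v\<in>VH P m \<T>. aform P (\<Phi> \<T> u) v = Gfun P \<delta> u v))"

definition zarantonello_contraction ::
    "bvp \<Rightarrow> nat \<Rightarrow> mesh \<Rightarrow> (mesh \<Rightarrow> fn \<Rightarrow> fn) \<Rightarrow> real \<Rightarrow> bool"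
  where "zarantonello_contraction P m \<T>0 \<Phi> qsym \<longleftrightarrow>
    (\<forall>\<T>\<in>refinements (dm P) \<T>0. \<forall>u\<in>VH P m \<T>. \<forall>w\<in>VH P m \<T>.
       edst P (\<Phi> \<T> u) (\<Phi> \<T> w) \<le> qsym * edst P u w)"

definition algebraic_solver ::
    "bvp \<Rightarrow> nat \<Rightarrow> mesh \<Rightarrow> (mesh \<Rightarrow> (fn \<Rightarrow> real) \<Rightarrow> fn \<Rightarrow> fn) \<Rightarrow> real \<Rightarrow> bool"
  where "algebraic_solver P m \<T>0 \<Psi> qalg \<longleftrightarrow>
    (\<forall>\<T>\<in>refinements (dm P) \<T>0. \<forall>G\<in>dual P.
       (\<forall>w\<in>VH P m \<T>. \<Psi> \<T> G w \<in> VH P m \<T>) \<and>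
       (\<forall>wstar\<in>VH P m \<T>. (\<forall>v\<in>VH P m \<T>. aform P wstar v = G v) \<longrightarrow>
          (\<forall>w\<in>VH P m \<T>. edst P wstar (\<Psi> \<T> G w) \<le> qalg * edst P wstar w)))"

definition qbar_sym :: "real \<Rightarrow> real \<Rightarrow> real \<Rightarrow> real"
  where "qbar_sym qsym qalg lam =
    (qsym + 2 * (qalg / (1 - qalg)) * lam) / (1 - 2 * (qalg / (1 - qalg)) * lam)"


section \<open>The AISFEM algorithm\<close>

text \<open>
  The objects produced by a run: meshes \<open>\<T>\<^sub>l\<close>, marked elements, iterates \<open>u\<^sub>l\<^bsup>k,j\<^esup>\<close> (field \<open>uit\<close>) and
  the auxiliary \<open>u\<^sub>l\<^bsup>k,\<star>\<^esup>\<close> (field \<open>uex\<close>). They are meaningful only at indices used by the algorithm.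
\<close>

record run =
  msh :: "nat \<Rightarrow> mesh"
  mrk :: "nat \<Rightarrow> mesh"
  uit :: "nat \<Rightarrow> nat \<Rightarrow> nat \<Rightarrow> fn"
  uex :: "nat \<Rightarrow> nat \<Rightarrow> fn"

text \<open>
  In the stopping criteria, the previous outer
  iterate is written as \<open>u\<^sub>l\<^bsup>k,0\<^esup>\<close>, to which the algorithm assigns it.

  \<open>j_final l k j\<close> says that \<open>j\<close> terminates the inner loop; the index \<open>k = 0\<close> has the
  single inner index 0. \<open>k_final l k j\<close> says that moreover \<open>k\<close> terminates the outer loop.
\<close>

definition j_final :: "bvp \<Rightarrow> estimator \<Rightarrow> real \<Rightarrow> real \<Rightarrow> run \<Rightarrow> nat \<Rightarrow> nat \<Rightarrow> nat \<Rightarrow> bool"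
  where "j_final P \<eta> lamsym lamalg R l k j \<longleftrightarrow>
    (k = 0 \<and> j = 0) \<or>
    (1 \<le> k \<and> 1 \<le> j \<and>
     edst P (uit R l k j) (uit R l k (j - 1))
       \<le> lamalg * (lamsym * eta_tot \<eta> (msh R l) (uit R l k j) + edst P (uit R l k j) (uit R l k 0)))"

definition k_final :: "bvp \<Rightarrow> estimator \<Rightarrow> real \<Rightarrow> real \<Rightarrow> run \<Rightarrow> nat \<Rightarrow> nat \<Rightarrow> nat \<Rightarrow> bool"
  where "k_final P \<eta> lamsym lamalg R l k j \<longleftrightarrow>
    1 \<le> k \<and> j_final P \<eta> lamsym lamalg R l k j \<and>
    edst P (uit R l k j) (uit R l k 0) \<le> lamsym * eta_tot \<eta> (msh R l) (uit R l k j)"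

text \<open>
  The rules follow the control flow of the nested loops. If an inner or outer loop does not
  terminate, no index of a later level belongs to the set.
\<close>

inductive_set QQ :: "bvp \<Rightarrow> estimator \<Rightarrow> real \<Rightarrow> real \<Rightarrow> run \<Rightarrow> (nat \<times> nat \<times> nat) set"
  for P :: bvp and \<eta> :: estimator and lamsym lamalg :: real and R :: run
  where
    QQ_start: "(0, 0, 0) \<in> QQ P \<eta> lamsym lamalg R"
  | QQ_alg: "(l, k, j) \<in> QQ P \<eta> lamsym lamalg R \<Longrightarrow> \<not> j_final P \<eta> lamsym lamalg R l k j \<Longrightarrow>
      (l, k, Suc j) \<in> QQ P \<eta> lamsym lamalg R"
  | QQ_sym: "(l, k, j) \<in> QQ P \<eta> lamsym lamalg R \<Longrightarrow> j_final P \<eta> lamsym lamalg R l k j \<Longrightarrow>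
      \<not> k_final P \<eta> lamsym lamalg R l k j \<Longrightarrow> (l, Suc k, 0) \<in> QQ P \<eta> lamsym lamalg R"
  | QQ_mesh: "(l, k, j) \<in> QQ P \<eta> lamsym lamalg R \<Longrightarrow> k_final P \<eta> lamsym lamalg R l k j \<Longrightarrow>
      (Suc l, 0, 0) \<in> QQ P \<eta> lamsym lamalg R"

definition marking :: "estimator \<Rightarrow> real \<Rightarrow> real \<Rightarrow> mesh \<Rightarrow> fn \<Rightarrow> mesh \<Rightarrow> bool"
  where "marking \<eta> \<theta> Cmark \<T> v \<M> \<longleftrightarrow>
    \<M> \<subseteq> \<T> \<and> \<theta> * (eta_tot \<eta> \<T> v)\<^sup>2 \<le> (eta_set \<eta> \<T> \<M> v)\<^sup>2 \<and>
    (\<forall>\<U>. \<U> \<subseteq> \<T> \<and> \<theta> * (eta_tot \<eta> \<T> v)\<^sup>2 \<le> (eta_set \<eta> \<T> \<U> v)\<^sup>2 \<longrightarrow>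
       real (card \<M>) \<le> Cmark * real (card \<U>))"

definition aisfem_run ::
    "bvp \<Rightarrow> mesh \<Rightarrow> estimator \<Rightarrow> real \<Rightarrow> (mesh \<Rightarrow> fn \<Rightarrow> fn) \<Rightarrow> (mesh \<Rightarrow> (fn \<Rightarrow> real) \<Rightarrow> fn \<Rightarrow> fn) \<Rightarrow>
     real \<Rightarrow> real \<Rightarrow> real \<Rightarrow> real \<Rightarrow> run \<Rightarrow> bool"
  where "aisfem_run P \<T>0 \<eta> \<delta> \<Phi> \<Psi> \<theta> Cmark lamsym lamalg R \<longleftrightarrow>
    msh R 0 = \<T>0 \<and> uit R 0 0 0 = (\<lambda>_. 0) \<and> uex R 0 0 = (\<lambda>_. 0) \<and>
    (\<forall>l k j. (l, k, j) \<in> QQ P \<eta> lamsym lamalg R \<longrightarrow>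
       (\<not> j_final P \<eta> lamsym lamalg R l k j \<longrightarrow>
          uit R l k (Suc j) = \<Psi> (msh R l) (Gfun P \<delta> (uit R l k 0)) (uit R l k j)) \<and>
       (j_final P \<eta> lamsym lamalg R l k j \<and> \<not> k_final P \<eta> lamsym lamalg R l k j \<longrightarrow>
          uit R l (Suc k) 0 = uit R l k j \<and> uex R l (Suc k) = \<Phi> (msh R l) (uit R l k j)) \<and>
       (k_final P \<eta> lamsym lamalg R l k j \<longrightarrow>
          marking \<eta> \<theta> Cmark (msh R l) (uit R l k j) (mrk R l) \<and>
          is_refine (dm P) (msh R l) (mrk R l) (msh R (Suc l)) \<and>
          uit R (Suc l) 0 0 = uit R l k j \<and> uex R (Suc l) 0 = uit R l k j))"

text \<open>The largest level index, or infinity if there is none.\<close>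

definition ell_sup :: "(nat \<times> nat \<times> nat) set \<Rightarrow> enat"
  where "ell_sup Q = (SUP l\<in>{l. (l, 0, 0) \<in> Q}. enat l)"

definition pos :: "(nat \<times> nat \<times> nat) set \<Rightarrow> nat \<times> nat \<times> nat \<Rightarrow> nat"
  where "pos Q p = card {q \<in> Q. q = p \<or> (q, p) \<in> less_than <*lex*> less_than <*lex*> less_than}"

definition quasi_error :: "bvp \<Rightarrow> estimator \<Rightarrow> fn \<Rightarrow> run \<Rightarrow> nat \<times> nat \<times> nat \<Rightarrow> real"
  where "quasi_error P \<eta> ustar R = (\<lambda>(l, k, j).
    edst P ustar (uit R l k j) + edst P (uex R l k) (uit R l k j) +
    eta_tot \<eta> (msh R l) (uit R l k j))"

end

theory Submission
  imports Defs "HOL-Complex_Analysis.Conformal_Mappings"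
begin

text \<open>
  The convergence is uniform from the first level on (\<open>ell0 = 0\<close>), because compactness of the lower
  order term is replaced by a quantitative quasi-orthogonality. Let \<open>d\<^sub>k\<close> be the difference of the
  Galerkin solutions on levels \<open>k + 1\<close> and \<open>k\<close>. Galerkin orthogonality makes the matrix
  \<open>b(d\<^sub>k, d\<^sub>j)\<close> triangular, so \<open>h(z) = \<Sum>\<^sub>k\<^sub>\<le>\<^sub>j b(d\<^sub>k, d\<^sub>j) z\<^sup>j\<^sup>-\<^sup>k\<close> is a polynomial. On the unit
  circle its values lie in the numerical range of \<open>b\<close>, which is contained in a sector of opening less
  than \<open>\<pi>\<close> depending only on \<open>L / \<alpha>\<close>. A Harnack inequality for the sector compares
  \<open>h(0) = \<Sum>\<^sub>k b(d\<^sub>k, d\<^sub>k)\<close> with \<open>h(1 - 1/(2n))\<close>, and the latter is bounded by summation by parts and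
  Cea's lemma. Thus the sum of the squared increments over \<open>n\<close> levels is \<open>O(n\<^sup>\<gamma>)\<close> times the squared
  error, with \<open>\<gamma> < 1\<close>. Together with estimator reduction this yields R-linear convergence over the
  levels. Failed stopping criteria give geometric decay within the inner loops; summing everything in
  the order of computation gives a tail bound, which is equivalent to linear convergence.
\<close>


section \<open>A Harnack inequality for functions with values in a sector\<close>

text \<open>At the boundary point 1, \<open>h\<close> equals \<open>b\<close> of the whole error
  with itself, but the Harnack factor from 0 to the boundary is infinite. Stepping back to
  \<open>1 - 1/(2n)\<close> costs a power of \<open>n\<close>, while the weights \<open>r^j\<close>
  and \<open>r^(-k)\<close> keep a variation bounded independently of \<open>n\<close>. In a half
  plane this power would be 1, and averaging over \<open>n\<close> levels would gain nothing. A
  second obstacle is representation: elements of the function spaces are plain functions, and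
  \<open>grad\<close> is an arbitrary choice among weak gradients. Bilinearity of the forms
  therefore rests on uniqueness of weak gradients almost everywhere, that is, on the fundamental
  lemma of the calculus of variations. Boxes, bump functions and Dynkin's argument serve it;
  integration by parts puts test functions into \<open>H1\<close>, which makes \<open>H10\<close> a
  vector space.\<close>

lemma Re_nonneg_ball_if_sphere:
  assumes hol: "f holomorphic_on UNIV"
    and bd: "\<And>z. norm z = 1 \<Longrightarrow> 0 \<le> Re (f z)"
    and z: "norm z \<le> 1"
  shows "0 \<le> Re (f z)"
proof -
  \<comment> \<open>The modulus of \<open>exp (- f z)\<close> is \<open>exp (- Re (f z))\<close>, so
    the maximum principle for \<open>exp (- f)\<close> is a minimum principle for
    \<open>Re f\<close>.\<close>
  have "norm (exp (- f z)) \<le> 1"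
  proof (rule maximum_modulus_frontier [where S = "cball 0 1" and f = "\<lambda>z. exp (- f z)"])
    show "(\<lambda>z. exp (- f z)) holomorphic_on interior (cball 0 1)"
      by (intro holomorphic_intros holomorphic_on_subset [OF hol]) auto
    show "continuous_on (closure (cball 0 1)) (\<lambda>z. exp (- f z))"
      by (intro continuous_intros holomorphic_on_imp_continuous_on holomorphic_on_subset [OF hol]) auto
    fix \<xi> :: complex assume "\<xi> \<in> frontier (cball 0 1)"
    then show "norm (exp (- f \<xi>)) \<le> 1" using bd [of \<xi>] by simp
  qed (use z in auto)
  then show ?thesis by simp
qed

text \<open>The Cayley transform \<open>(g - c) / (g + c)\<close> maps the right half plane to the
  unit disc and \<open>g 0\<close> to 0, so the Schwarz lemma bounds it by \<open>r\<close> at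
  \<open>r\<close>; solving for \<open>g\<close> gives the claim.\<close>

lemma Harnack_half_plane:
  assumes hol: "g holomorphic_on ball 0 1"
    and pos: "\<And>z. norm z < 1 \<Longrightarrow> 0 < Re (g z)"
    and g0: "g 0 = of_real c" and r: "0 \<le> r" "r < 1"
  shows "c * (1 - r) \<le> (1 + r) * norm (g (of_real r))"
proof -
  have c: "0 < c" using pos [of 0] g0 by simp
  define f where "f z = (g z - of_real c) / (g z + of_real c)" for z
  have ne: "g z + of_real c \<noteq> 0" if "norm z < 1" for z
  proof
    assume "g z + of_real c = 0"
    then have "Re (g z + of_real c) = 0" by simp
    then show False using pos [OF that] c by simp
  qed
  have lt: "norm (g z - of_real c) < norm (g z + of_real c)" if "norm z < 1" for z
  proof -
    have "0 < c * Re (g z)" using pos [OF that] c by simp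
    then have "(norm (g z - of_real c))\<^sup>2 < (norm (g z + of_real c))\<^sup>2"
      unfolding cmod_power2 by (simp add: power2_eq_square algebra_simps)
    then show ?thesis by (rule power_less_imp_less_base) simp
  qed
  have "norm (f (of_real r)) \<le> norm (of_real r :: complex)"
  proof (rule Schwarz_Lemma)
    show "f holomorphic_on ball 0 1"
      unfolding f_def by (intro holomorphic_intros hol) (use ne in auto)
    show "f 0 = 0" by (simp add: f_def g0)
    show "norm (f z) < 1" if "norm z < 1" for z
      using lt [OF that] ne [OF that] by (simp add: f_def norm_divide)
    show "norm (of_real r :: complex) < 1" using r by simp
  qed
  moreover have nr: "norm (of_real r :: complex) < 1" using r by simp
  ultimately have "norm (g (of_real r) - of_real c) \<le> r * norm (g (of_real r) + of_real c)"
    using ne [OF nr] r by (simp add: f_def norm_divide field_simps)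
  also have "\<dots> \<le> r * (norm (g (of_real r)) + c)"
    using norm_triangle_ineq [of "g (of_real r)" "of_real c"] r c by (intro mult_left_mono) auto
  finally have "norm (g (of_real r) - of_real c) \<le> r * (norm (g (of_real r)) + c)" .
  moreover have "c - norm (g (of_real r)) \<le> norm (g (of_real r) - of_real c)"
    using norm_triangle_ineq2 [of "of_real c" "g (of_real r)"] c by (simp add: norm_minus_commute)
  ultimately show ?thesis by (simp add: algebra_simps)
qed

lemma abs_Arg_le_arctan:
  assumes "0 < Re k" and "\<bar>Im k\<bar> \<le> \<tau> * Re k"
  shows "\<bar>Arg k\<bar> \<le> arctan \<tau>"
proof -
  have q: "\<bar>Im k / Re k\<bar> \<le> \<tau>" using assms by (simp add: field_simps)
  have "Arg k = arctan (Im k / Re k)" using assms(1) by (rule arg_conv_arctan)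
  moreover have "\<bar>arctan (Im k / Re k)\<bar> = arctan \<bar>Im k / Re k\<bar>"
    by (simp add: abs_if arctan_minus)
  ultimately show ?thesis using q by (simp add: arctan_le_iff)
qed

text \<open>The exponent is less than 1 because the sector is strictly smaller than the half plane; for the
  half plane itself it would be 1.\<close>

definition sector_exponent :: "real \<Rightarrow> real"
  where "sector_exponent \<tau> = 2 * arctan (\<tau> + 1) / pi"

lemma sector_exponent_bounds:
  assumes "0 \<le> \<tau>"
  shows "0 < sector_exponent \<tau>" "sector_exponent \<tau> < 1"
  using assms arctan_ubound [of "\<tau> + 1"] by (auto simp: sector_exponent_def field_simps)

text \<open>A power larger than 1 opens the sector to the half plane. The half plane inequality is
  applied to that power of \<open>h\<close>; taking the root afterwards puts the exponent
  \<open>sector_exponent \<tau>\<close> on the factor.\<close>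

lemma Harnack_sector:
  assumes hol: "h holomorphic_on UNIV" and \<tau>: "0 \<le> \<tau>"
    and sect: "\<And>z. norm z = 1 \<Longrightarrow> \<bar>Im (h z)\<bar> \<le> \<tau> * Re (h z)"
    and pos: "\<And>z. norm z = 1 \<Longrightarrow> 0 \<le> Re (h z)"
    and h0: "h 0 = of_real D" and r: "0 \<le> r" "r < 1"
  shows "D \<le> ((1 + r) / (1 - r)) powr sector_exponent \<tau> * norm (h (of_real r))"
proof -
  let ?\<gamma> = "sector_exponent \<tau>"
  note \<gamma> = sector_exponent_bounds [OF \<tau>]
  have re: "0 \<le> Re (h z)" if "norm z \<le> 1" for z
    using hol pos that by (rule Re_nonneg_ball_if_sphere)
  \<comment> \<open>The sector is the intersection of two rotated half planes, so two applications
    of the minimum principle transfer it from the circle to the disc.\<close>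
  have im: "\<bar>Im (h z)\<bar> \<le> \<tau> * Re (h z)" if "norm z \<le> 1" for z
  proof -
    have "0 \<le> Re (Complex \<tau> 1 * h z)"
    proof (rule Re_nonneg_ball_if_sphere [OF _ _ that])
      show "0 \<le> Re (Complex \<tau> 1 * h z)" if "norm z = 1" for z
        using sect [OF that] by simp
    qed (intro holomorphic_intros hol)
    moreover have "0 \<le> Re (Complex \<tau> (-1) * h z)"
    proof (rule Re_nonneg_ball_if_sphere [OF _ _ that])
      show "0 \<le> Re (Complex \<tau> (-1) * h z)" if "norm z = 1" for z
        using sect [OF that] by simp
    qed (intro holomorphic_intros hol)
    ultimately show ?thesis by simp
  qed
  have D: "0 \<le> D" using re [of 0] h0 by simp
  \<comment> \<open>The shift by \<open>\<epsilon>\<close> moves the values away from 0, where no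
    holomorphic logarithm exists. It preserves the sector and disappears in the limit.\<close>
  have main: "D \<le> ((1 + r) / (1 - r)) powr ?\<gamma> * norm (h (of_real r))
      + (((1 + r) / (1 - r)) powr ?\<gamma>) * \<epsilon>" if \<epsilon>: "0 < \<epsilon>" for \<epsilon>
  proof -
    define k where "k z = h z + of_real \<epsilon>" for z
    define p where "p = 1 / ?\<gamma>"
    have p: "0 < p" "?\<gamma> * p = 1" using \<gamma> by (auto simp: p_def)
    have kre: "0 < Re (k z)" if "norm z < 1" for z
      using re [of z] that \<epsilon> by (simp add: k_def)
    have kim: "\<bar>Im (k z)\<bar> \<le> \<tau> * Re (k z)" if "norm z < 1" for z
    proof -
      have "\<bar>Im (h z)\<bar> \<le> \<tau> * Re (h z)" using im [of z] that by simp
      also have "\<dots> \<le> \<tau> * Re (k z)" using \<tau> \<epsilon> by (simp add: k_def mult_left_mono)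
      finally show ?thesis by (simp add: k_def)
    qed
    have kne: "k z \<noteq> 0" if "norm z < 1" for z using kre [OF that] by auto
    have kpos: "k z \<notin> \<real>\<^sub>\<le>\<^sub>0" if "norm z < 1" for z
      using kre [OF that] by (auto simp: complex_nonpos_Reals_iff)
    define g where "g z = exp (of_real p * Ln (k z))" for z
    have "(D + \<epsilon>) powr p * (1 - r) \<le> (1 + r) * norm (g (of_real r))"
    proof (rule Harnack_half_plane [OF _ _ _ r])
      show "g holomorphic_on ball 0 1"
        unfolding g_def k_def
        by (intro holomorphic_intros holomorphic_on_subset [OF hol]) (use kpos in \<open>auto simp: k_def\<close>)
      show "0 < Re (g z)" if z: "norm z < 1" for z
      proof -
        have "\<bar>Arg (k z)\<bar> \<le> arctan \<tau>" by (rule abs_Arg_le_arctan [OF kre [OF z] kim [OF z]])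
        \<comment> \<open>The \<open>+ 1\<close> in \<open>sector_exponent\<close> provides this
          strict inequality, which keeps the power inside the open half plane.\<close>
        also have "\<dots> < arctan (\<tau> + 1)" by (simp add: arctan_less_iff)
        finally have "p * \<bar>Arg (k z)\<bar> < p * arctan (\<tau> + 1)" using p by simp
        also have "p * arctan (\<tau> + 1) = pi / 2"
          using \<gamma> \<tau> by (simp add: p_def sector_exponent_def)
        finally have "\<bar>p * Arg (k z)\<bar> < pi / 2" using p by (simp add: abs_mult)
        then have "0 < cos (p * Arg (k z))" by (intro cos_gt_zero_pi) auto
        then show ?thesis using kne [OF z] by (simp add: g_def Re_exp Arg_eq_Im_Ln)
      qed
      show "g 0 = of_real ((D + \<epsilon>) powr p)"
      proof -
        have "Ln (k 0) = of_real (ln (D + \<epsilon>))"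
          using D \<epsilon> Ln_of_real [of "D + \<epsilon>"] by (simp add: k_def h0)
        then show ?thesis using D \<epsilon> by (simp add: g_def powr_def exp_of_real [symmetric])
      qed
    qed
    moreover have "norm (g (of_real r)) = norm (k (of_real r)) powr p"
      using kne [of "of_real r"] r by (simp add: g_def powr_def norm_exp_eq_Re)
    moreover have "norm (k (of_real r)) \<le> norm (h (of_real r)) + \<epsilon>"
      unfolding k_def using \<epsilon> norm_triangle_ineq [of "h (of_real r)" "of_real \<epsilon>"] by simp
    then have "norm (k (of_real r)) powr p \<le> (norm (h (of_real r)) + \<epsilon>) powr p"
      using p by (intro powr_mono2) auto
    ultimately have "(D + \<epsilon>) powr p * (1 - r) \<le> (1 + r) * (norm (h (of_real r)) + \<epsilon>) powr p"
      using r by (smt (verit, best) mult_left_mono)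
    then have "(D + \<epsilon>) powr p \<le> (1 + r) / (1 - r) * (norm (h (of_real r)) + \<epsilon>) powr p"
      using r by (simp add: field_simps)
    then have "((D + \<epsilon>) powr p) powr ?\<gamma>
        \<le> ((1 + r) / (1 - r) * (norm (h (of_real r)) + \<epsilon>) powr p) powr ?\<gamma>"
      using \<gamma> by (intro powr_mono2) auto
    then have "D + \<epsilon> \<le> ((1 + r) / (1 - r)) powr ?\<gamma> * ((norm (h (of_real r)) + \<epsilon>) powr p) powr ?\<gamma>"
      using r \<epsilon> D p by (subst powr_mult [symmetric]) (auto simp: powr_powr mult.commute)
    then have "D + \<epsilon> \<le> ((1 + r) / (1 - r)) powr ?\<gamma> * (norm (h (of_real r)) + \<epsilon>)"
      using \<epsilon> p by (simp add: powr_powr mult.commute)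
    then show ?thesis using \<epsilon> by (simp add: algebra_simps)
  qed
  show ?thesis
  proof (rule field_le_epsilon)
    fix e :: real assume e: "0 < e"
    let ?c = "((1 + r) / (1 - r)) powr ?\<gamma>"
    have c: "0 < ?c" using r by simp
    then show "D \<le> ?c * norm (h (of_real r)) + e"
      using main [of "e / ?c"] e by simp
  qed
qed


section \<open>R-linear convergence of sequences\<close>

text \<open>Squaring the recursion with Young's inequality leaves the factor \<open>q\<close> on the
  old square, so the sum of squares can be absorbed into itself.\<close>

lemma sum_squares_contraction:
  fixes H d :: "nat \<Rightarrow> real"
  assumes q: "0 \<le> q" "q < 1"
    and rec: "\<And>k. k < n \<Longrightarrow> H (Suc k) \<le> q * (H k + d k)"
    and nn: "\<And>k. 0 \<le> H k" "\<And>k. 0 \<le> d k"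
  shows "(\<Sum>k<Suc n. (H k)\<^sup>2) \<le> ((H 0)\<^sup>2 + (\<Sum>k<n. (d k)\<^sup>2)) / (1 - q)\<^sup>2"
proof -
  have sq: "(H (Suc k))\<^sup>2 \<le> q * (H k)\<^sup>2 + (d k)\<^sup>2 / (1 - q)" if "k < n" for k
  proof -
    have "(H (Suc k))\<^sup>2 \<le> (q * (H k + d k))\<^sup>2"
      using rec [OF that] nn by (intro power_mono) auto
    moreover have "(q * (H k + d k))\<^sup>2 = q\<^sup>2 * (H k + d k)\<^sup>2" by (simp add: power_mult_distrib)
    moreover have "q\<^sup>2 * (H k + d k)\<^sup>2 \<le> q * (H k)\<^sup>2 + (d k)\<^sup>2 / (1 - q)"
    proof -
      \<comment> \<open>Young's inequality with weight \<open>(1 - q) / q\<close>, multiplied out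
        because \<open>q\<close> may be 0.\<close>
      have "0 \<le> ((1 - q) * H k - q * d k)\<^sup>2" by simp
      then have "2 * q * (1 - q) * (H k * d k) \<le> (1 - q)\<^sup>2 * (H k)\<^sup>2 + q\<^sup>2 * (d k)\<^sup>2"
        by (simp add: power2_eq_square algebra_simps)
      then have "q * (2 * q * (1 - q) * (H k * d k)) \<le> q * ((1 - q)\<^sup>2 * (H k)\<^sup>2 + q\<^sup>2 * (d k)\<^sup>2)"
        using q by (intro mult_left_mono) auto
      then have "(1 - q) * (q\<^sup>2 * (H k + d k)\<^sup>2)
          \<le> (1 - q) * q\<^sup>2 * ((H k)\<^sup>2 + (d k)\<^sup>2) + q * ((1 - q)\<^sup>2 * (H k)\<^sup>2 + q\<^sup>2 * (d k)\<^sup>2)"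
        by (simp add: power2_eq_square algebra_simps)
      also have "\<dots> = (1 - q) * q * (H k)\<^sup>2 + q\<^sup>2 * (d k)\<^sup>2"
        by (simp add: power2_eq_square algebra_simps)
      also have "q\<^sup>2 * (d k)\<^sup>2 \<le> 1 * (d k)\<^sup>2"
        using q by (intro mult_right_mono) (auto simp: power_le_one)
      finally show ?thesis using q by (simp add: field_simps)
    qed
    ultimately show ?thesis by linarith
  qed
  let ?S = "\<Sum>k<Suc n. (H k)\<^sup>2"
  have "?S = (H 0)\<^sup>2 + (\<Sum>k<n. (H (Suc k))\<^sup>2)"
    by (simp only: sum.lessThan_Suc_shift)
  also have "(\<Sum>k<n. (H (Suc k))\<^sup>2) \<le> (\<Sum>k<n. q * (H k)\<^sup>2 + (d k)\<^sup>2 / (1 - q))"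
    using sq by (intro sum_mono) auto
  also have "\<dots> = q * (\<Sum>k<n. (H k)\<^sup>2) + (\<Sum>k<n. (d k)\<^sup>2) / (1 - q)"
    by (simp add: sum.distrib sum_distrib_left sum_divide_distrib)
  also have "\<dots> \<le> q * ?S + (\<Sum>k<n. (d k)\<^sup>2) / (1 - q)"
    using q by (intro add_right_mono mult_left_mono) auto
  finally have "(1 - q) * ?S \<le> (H 0)\<^sup>2 + (\<Sum>k<n. (d k)\<^sup>2) / (1 - q)"
    by (simp add: algebra_simps)
  then have "(1 - q) * ((1 - q) * ?S) \<le> (1 - q) * ((H 0)\<^sup>2 + (\<Sum>k<n. (d k)\<^sup>2) / (1 - q))"
    using q by (intro mult_left_mono) auto
  also have "\<dots> = (1 - q) * (H 0)\<^sup>2 + (\<Sum>k<n. (d k)\<^sup>2)" using q by (simp add: field_simps)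
  also have "\<dots> \<le> (H 0)\<^sup>2 + (\<Sum>k<n. (d k)\<^sup>2)" using q by (simp add: mult_left_le_one_le)
  finally have "(1 - q)\<^sup>2 * ?S \<le> (H 0)\<^sup>2 + (\<Sum>k<n. (d k)\<^sup>2)" by (simp only: power2_eq_square mult.assoc)
  moreover have "0 < (1 - q)\<^sup>2" using q by simp
  ultimately show ?thesis by (metis mult.commute pos_le_divide_eq)
qed

text \<open>Perturbations bounded by the initial term add up like a geometric series: the factor
  \<open>1 + K / (1 - q)\<close> is reproduced by one step of the recursion. This compares every
  term with any earlier one.\<close>

lemma perturbed_contraction_bounded:
  fixes H d :: "nat \<Rightarrow> real"
  assumes q: "0 \<le> q" "q < 1"
    and rec: "\<And>k. k < n \<Longrightarrow> H (Suc k) \<le> q * (H k + d k)"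
    and d: "\<And>k. k < n \<Longrightarrow> d k \<le> K * H 0" and K: "0 \<le> K" and H0: "0 \<le> H 0"
  shows "H n \<le> (1 + K / (1 - q)) * H 0"
proof -
  have "H m \<le> (1 + K / (1 - q)) * H 0" if "m \<le> n" for m
    using that
  proof (induction m)
    case 0
    have "1 * H 0 \<le> (1 + K / (1 - q)) * H 0" using K q H0 by (intro mult_right_mono) auto
    then show ?case by simp
  next
    case (Suc m)
    have "H (Suc m) \<le> q * (H m + d m)" using rec Suc.prems by simp
    also have "\<dots> \<le> q * ((1 + K / (1 - q)) * H 0 + K * H 0)"
      using Suc d [of m] q by (intro mult_left_mono) auto
    also have "\<dots> = (q + q * K * (1 / (1 - q) + 1)) * H 0" by (simp add: algebra_simps)
    also have "\<dots> \<le> (1 + K / (1 - q)) * H 0"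
    proof (intro mult_right_mono H0)
      have "q * (1 / (1 - q) + 1) \<le> 1 / (1 - q)"
      proof -
        have "1 / (1 - q) = 1 + q / (1 - q)" using q by (simp add: field_simps)
        moreover have "q * (1 / (1 - q) + 1) = q / (1 - q) + q" by (simp add: distrib_left)
        ultimately show ?thesis using q by linarith
      qed
      then have "K * (q * (1 / (1 - q) + 1)) \<le> K * (1 / (1 - q))" by (rule mult_left_mono [OF _ K])
      then show "q + q * K * (1 / (1 - q) + 1) \<le> 1 + K / (1 - q)"
        using q by (simp add: mult_ac)
    qed
    finally show ?case .
  qed
  then show ?thesis by simp
qed

text \<open>An \<open>O(n\<^sup>\<gamma>)\<close> bound with \<open>\<gamma> < 1\<close> on the perturbations suffices: averaging the squares over a window
  of \<open>n\<close> terms then yields a contraction over this window as soon as \<open>n\<close> is large.\<close>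

lemma R_linear_convergence:
  fixes q K C \<gamma> :: real
  assumes q: "0 \<le> q" "q < 1" and K: "0 \<le> K" and C: "0 \<le> C" and \<gamma>: "0 < \<gamma>" "\<gamma> < 1"
  obtains A \<rho> where "1 \<le> A" "0 < \<rho>" "\<rho> < 1"
    and "\<And>H d M. (\<And>l. 0 \<le> H l) \<Longrightarrow> (\<And>l. 0 \<le> d l) \<Longrightarrow>
        (\<And>l. l < M \<Longrightarrow> H (Suc l) \<le> q * (H l + d l)) \<Longrightarrow>
        (\<And>l k. l + k < M \<Longrightarrow> d (l + k) \<le> K * H l) \<Longrightarrow>
        (\<And>l n. 1 \<le> n \<Longrightarrow> l + n \<le> M \<Longrightarrow> (\<Sum>k<n. (d (l + k))\<^sup>2) \<le> C * real n powr \<gamma> * (H l)\<^sup>2) \<Longrightarrow>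
        (\<And>l n. l + n \<le> M \<Longrightarrow> H (l + n) \<le> A * \<rho> ^ n * (H l :: real))"
proof -
  define B where "B = 1 + K / (1 - q)"
  have B: "1 \<le> B" using K q by (simp add: B_def)
  \<comment> \<open>The factor 4 is the one needed to turn the bound on the mean of the squares into
    a halving of \<open>H\<close> over a window; \<open>n\<close> is then chosen with
    \<open>E * n powr \<gamma> \<le> n\<close>.\<close>
  define E where "E = 4 * B\<^sup>2 * ((1 + C) / (1 - q)\<^sup>2)"
  have E: "0 < E" using B C q by (simp add: E_def)
  have "(\<lambda>n. real n powr (\<gamma> - 1)) \<longlonglongrightarrow> 0"
    using \<gamma> by (intro tendsto_neg_powr filterlim_real_sequentially) auto
  then have "\<forall>\<^sub>F n in sequentially. real n powr (\<gamma> - 1) < 1 / E"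
    using E by (intro order_tendstoD) auto
  then obtain N where N: "\<And>n. N \<le> n \<Longrightarrow> real n powr (\<gamma> - 1) < 1 / E"
    unfolding eventually_sequentially by blast
  define n where "n = Suc N"
  have n1: "1 \<le> n" by (simp add: n_def)
  have nE: "E * real n powr \<gamma> \<le> real n"
  proof -
    have "real n powr \<gamma> = real n powr (\<gamma> - 1) * real n"
      using n1 by (simp add: powr_diff)
    moreover have "real n powr (\<gamma> - 1) * E \<le> 1" using N [of n] E by (simp add: n_def field_simps)
    ultimately have "E * real n powr \<gamma> = (real n powr (\<gamma> - 1) * E) * real n" by simp
    also have "\<dots> \<le> 1 * real n"
      using \<open>real n powr (\<gamma> - 1) * E \<le> 1\<close> by (intro mult_right_mono) auto
    finally show ?thesis by simp
  qed
  define \<rho> where "\<rho> = (1 / 2 :: real) powr (1 / real n)"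
  have \<rho>: "0 < \<rho>" "\<rho> < 1"
    using n1 by (auto simp: \<rho>_def powr01_less_one)
  have \<rho>n: "\<rho> ^ n = 1 / 2" using n1 by (simp add: \<rho>_def powr_powr powr_realpow [symmetric])
  show ?thesis
  proof (rule that [of "2 * B" \<rho>])
    show "1 \<le> 2 * B" using B by simp
    show "0 < \<rho>" "\<rho> < 1" by fact+
    fix H d :: "nat \<Rightarrow> real" and M l m :: nat
    assume nn: "\<And>l. 0 \<le> H l" "\<And>l. 0 \<le> d l"
      and rec: "\<And>l. l < M \<Longrightarrow> H (Suc l) \<le> q * (H l + d l)"
      and dK: "\<And>l k. l + k < M \<Longrightarrow> d (l + k) \<le> K * H l"
      and dC: "\<And>l n. 1 \<le> n \<Longrightarrow> l + n \<le> M \<Longrightarrow> (\<Sum>k<n. (d (l + k))\<^sup>2) \<le> C * real n powr \<gamma> * (H l)\<^sup>2"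
    have bd: "H (l + m) \<le> B * H l" if "l + m \<le> M" for l m
      unfolding B_def
      using perturbed_contraction_bounded [of q m "\<lambda>k. H (l + k)" "\<lambda>k. d (l + k)" K] q that rec dK K nn
      by simp
    have half: "H (l + n) \<le> 1 / 2 * H l" if le: "l + n \<le> M" for l
    proof -
      \<comment> \<open>By \<open>bd\<close> the square of the term after the window is at most
        \<open>B\<^sup>2\<close> times the square of each term of the window, hence also of their
        mean.\<close>
      have "real n * (H (l + n))\<^sup>2 = (\<Sum>k<n. (H (l + n))\<^sup>2)" by simp
      also have "\<dots> \<le> (\<Sum>k<n. B\<^sup>2 * (H (l + k))\<^sup>2)"
      proof (rule sum_mono)
        fix k assume "k \<in> {..<n}"
        then have "H (l + n) \<le> B * H (l + k)" using bd [of "l + k" "n - k"] le by simp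
        then show "(H (l + n))\<^sup>2 \<le> B\<^sup>2 * (H (l + k))\<^sup>2"
          using nn by (metis power_mono power_mult_distrib)
      qed
      also have "\<dots> \<le> B\<^sup>2 * (\<Sum>k<Suc n. (H (l + k))\<^sup>2)"
        unfolding sum_distrib_left [symmetric] by (intro mult_left_mono) auto
      also have "\<dots> \<le> B\<^sup>2 * (((H (l + 0))\<^sup>2 + (\<Sum>k<n. (d (l + k))\<^sup>2)) / (1 - q)\<^sup>2)"
        using sum_squares_contraction [of q n "\<lambda>k. H (l + k)" "\<lambda>k. d (l + k)"] q le rec nn
        by (intro mult_left_mono) auto
      also have "\<dots> \<le> B\<^sup>2 * (((H l)\<^sup>2 + C * real n powr \<gamma> * (H l)\<^sup>2) / (1 - q)\<^sup>2)"
        using dC [OF n1 le] by (intro mult_left_mono divide_right_mono) auto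
      also have "\<dots> \<le> B\<^sup>2 * ((real n powr \<gamma> * (H l)\<^sup>2 + C * real n powr \<gamma> * (H l)\<^sup>2) / (1 - q)\<^sup>2)"
      proof -
        have "1 \<le> real n powr \<gamma>" using n1 \<gamma> by (simp add: ge_one_powr_ge_zero)
        then have "1 * (H l)\<^sup>2 \<le> real n powr \<gamma> * (H l)\<^sup>2" by (intro mult_right_mono) auto
        then show ?thesis by (intro mult_left_mono divide_right_mono) auto
      qed
      also have "\<dots> = (E * real n powr \<gamma>) * (H l)\<^sup>2 / 4"
      proof -
        have eq: "b * ((x * h + C * x * h) / k) = (4 * b * ((1 + C) / k) * x) * h / 4" if "k \<noteq> 0" for b x h k
          using that by (simp add: field_simps)
        have "(1 - q)\<^sup>2 \<noteq> 0" using q by simp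
        then show ?thesis unfolding E_def by (rule eq)
      qed
      also have "\<dots> \<le> real n * (H l)\<^sup>2 / 4"
        using nE by (intro divide_right_mono mult_right_mono) auto
      also have "\<dots> = real n * (1 / 2 * H l)\<^sup>2" by (simp add: power2_eq_square)
      finally have "(H (l + n))\<^sup>2 \<le> (1 / 2 * H l)\<^sup>2"
        using n1 by simp
      then show ?thesis by (rule power2_le_imp_le) (use nn [of l] in simp)
    qed
    have iter: "H (l + i * n) \<le> (1 / 2) ^ i * H l" if "l + i * n \<le> M" for l i
      using that
    proof (induction i)
      case (Suc i)
      have "H (l + Suc i * n) = H ((l + i * n) + n)" by (simp add: algebra_simps)
      also have "\<dots> \<le> 1 / 2 * H (l + i * n)" using Suc.prems by (intro half) (simp add: algebra_simps)
      also have "\<dots> \<le> 1 / 2 * ((1 / 2) ^ i * H l)" using Suc by (intro mult_left_mono) auto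
      finally show ?case by simp
    qed simp
    assume le: "l + m \<le> M"
    define i where "i = m div n"
    define j where "j = m mod n"
    have m: "m = i * n + j" by (simp add: i_def j_def)
    have "H (l + m) \<le> B * H (l + i * n)" using bd [of "l + i * n" j] le m by (simp add: add.assoc)
    also have "\<dots> \<le> B * ((1 / 2) ^ i * H l)" using iter [of l i] le m B by (intro mult_left_mono) auto
    \<comment> \<open>Rounding \<open>m\<close> down to complete windows loses at most the factor
      \<open>\<rho> ^ n = 1/2\<close>, hence the 2 in \<open>2 * B\<close>; the \<open>B\<close>
      comes from the incomplete window.\<close>
    also have "\<dots> \<le> B * ((2 * \<rho> ^ m) * H l)"
    proof (intro mult_left_mono mult_right_mono nn)
      have "\<rho> ^ m = (1 / 2) ^ i * \<rho> ^ j" by (simp add: m power_add power_mult \<rho>n mult.commute [of i])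
      moreover have "\<rho> ^ n \<le> \<rho> ^ j" using \<rho> n1 by (intro power_decreasing) (auto simp: j_def)
      then have "1 \<le> 2 * \<rho> ^ j" by (simp add: \<rho>n)
      then have "(1 / 2) ^ i * 1 \<le> (1 / 2) ^ i * (2 * \<rho> ^ j)" by (intro mult_left_mono) auto
      ultimately show "(1 / 2) ^ i \<le> 2 * \<rho> ^ m" by simp
    qed (use B in simp)
    finally show "H (l + m) \<le> 2 * B * \<rho> ^ m * H l" by (simp add: mult_ac)
  qed
qed

text \<open>Models a loop in which decay at \<open>Suc k\<close> is known only if a further step
  follows, since only then has the stopping criterion failed there. The last step is covered by the
  growth bound \<open>C1\<close>, and the division by \<open>q\<^sup>2\<close> makes up for the two
  missing powers.\<close>

lemma geometric_decay_final:
  fixes D :: "nat \<Rightarrow> real"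
  assumes q: "0 < q" "q < 1" and C: "1 \<le> C1" "1 \<le> C2" and nn: "0 \<le> D i"
    and step: "\<And>k. i \<le> k \<Longrightarrow> k < n \<Longrightarrow> D (Suc k) \<le> C1 * D k"
    and dec: "\<And>k. i \<le> k \<Longrightarrow> Suc k < n \<Longrightarrow> D (Suc k) \<le> C2 * q ^ (k - i) * D i"
    and le: "i \<le> n"
  shows "D n \<le> C1 * C2 / q\<^sup>2 * q ^ (n - i) * D i"
proof -
  have CC: "1 \<le> C1 * C2" using C by (rule mult_ge1_I)
  have q2: "q\<^sup>2 \<le> 1" using q by (simp add: power_le_one)
  consider "n = i" | "n = Suc i" | k where "i \<le> k" "n = Suc (Suc k)"
    using le by (metis Suc_leI le_Suc_eq less_imp_Suc_add le_add1 nat_less_le)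
  then show ?thesis
  proof cases
    case 1
    have "1 * D i \<le> C1 * C2 / q\<^sup>2 * D i"
      using CC q2 q nn by (intro mult_right_mono) (auto simp: field_simps)
    with 1 show ?thesis by simp
  next
    case 2
    have "D n \<le> C1 * D i" using step [of i] 2 by simp
    also have "\<dots> \<le> (C1 * C2 / q\<^sup>2 * q) * D i"
    proof (intro mult_right_mono nn)
      have "C1 * q \<le> C1 * C2 * 1" using C q CC by (intro mult_mono) auto
      then show "C1 \<le> C1 * C2 / q\<^sup>2 * q" using q by (simp add: field_simps power2_eq_square)
    qed
    finally show ?thesis using 2 by simp
  next
    case 3
    have "D n \<le> C1 * D (Suc k)" using step [of "Suc k"] 3 by simp
    also have "\<dots> \<le> C1 * (C2 * q ^ (k - i) * D i)"
      using dec [of k] 3 C by (intro mult_left_mono) auto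
    also have "\<dots> = C1 * C2 / q\<^sup>2 * q ^ (n - i) * D i"
    proof -
      have "n - i = 2 + (k - i)" using 3 by simp
      then show ?thesis using q by (simp only: power_add) simp
    qed
    finally show ?thesis .
  qed
qed

text \<open>The first term of a tail sum is at least the fraction \<open>1 / C\<close> of it, so
  dropping this term contracts the tail sum by \<open>1 - 1 / C\<close>.\<close>

lemma linear_convergence_if_sum_bound:
  fixes x :: "nat \<Rightarrow> real"
  assumes C: "1 < C" and nn: "\<And>n. 0 \<le> x n"
    and sum: "\<And>m n. m \<le> n \<Longrightarrow> (\<Sum>k = m..n. x k) \<le> C * x m"
    and le: "m \<le> n"
  shows "x n \<le> C * (1 - 1 / C) ^ (n - m) * x m"
proof -
  have "(\<Sum>k = m + i..n. x k) \<le> (1 - 1 / C) ^ i * (\<Sum>k = m..n. x k)" if "m + i \<le> n" for i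
    using that
  proof (induction i)
    case (Suc i)
    let ?S = "\<lambda>i. \<Sum>k = m + i..n. x k"
    have "?S i = x (m + i) + ?S (Suc i)"
      using Suc.prems by (simp add: sum.atLeast_Suc_atMost)
    moreover have "?S i \<le> C * x (m + i)" using Suc.prems by (intro sum) auto
    ultimately have "?S (Suc i) \<le> (1 - 1 / C) * ?S i" using C by (simp add: field_simps)
    also have "\<dots> \<le> (1 - 1 / C) * ((1 - 1 / C) ^ i * ?S 0)"
      using Suc C by (intro mult_left_mono) auto
    finally show ?case by simp
  qed simp
  from this [of "n - m"] le have "x n \<le> (1 - 1 / C) ^ (n - m) * (\<Sum>k = m..n. x k)" by simp
  also have "\<dots> \<le> (1 - 1 / C) ^ (n - m) * (C * x m)"
    using sum [OF le] C by (intro mult_left_mono zero_le_power) auto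
  finally show ?thesis by (simp add: mult_ac)
qed


section \<open>Boxes, measurability and integration in \<open>R\<^sup>d\<close>\<close>

abbreviation leb :: "nat \<Rightarrow> pt measure"
  where "leb d \<equiv> Pi\<^sub>M {..<d} (\<lambda>_. lborel)"

interpretation lborel_product: product_sigma_finite "\<lambda>_::nat. lborel :: real measure"
  by standard

lemma space_leb: "space (leb d) = Rd d"
  by (simp add: space_PiM Rd_def)

lemma topspace_powertop: "topspace (powertop_real {..<d}) = Rd d"
  by (simp add: Rd_def)

lemma Rd_upd: "x \<in> Rd d \<Longrightarrow> i < d \<Longrightarrow> x(i := t) \<in> Rd d"
  by (auto simp: Rd_def PiE_iff extensional_def)

text \<open>Rational end points leave only countably many boxes. The open box contains
  \<open>x\<close> while the closed one stays in \<open>U\<close>, so that bump functions of the box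
  have compact support in \<open>U\<close>.\<close>

lemma openin_powertop_box:
  assumes "openin (powertop_real {..<d}) U" "x \<in> U"
  obtains a b where "a \<in> {..<d} \<rightarrow>\<^sub>E \<rat>" "b \<in> {..<d} \<rightarrow>\<^sub>E \<rat>"
    and "\<And>i. i < d \<Longrightarrow> a i < x i \<and> x i < b i" and "Pi\<^sub>E {..<d} (\<lambda>i. {a i..b i}) \<subseteq> U"
proof -
  obtain V where V: "\<And>i. i < d \<Longrightarrow> open (V i)" and xV: "x \<in> Pi\<^sub>E {..<d} V" and VU: "Pi\<^sub>E {..<d} V \<subseteq> U"
  proof -
    have "\<exists>V. (\<forall>i<d. open (V i)) \<and> x \<in> Pi\<^sub>E {..<d} V \<and> Pi\<^sub>E {..<d} V \<subseteq> U"
    proof -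
      obtain V where V: "\<forall>i\<in>{..<d}. openin euclideanreal (V i)" "x \<in> Pi\<^sub>E {..<d} V" "Pi\<^sub>E {..<d} V \<subseteq> U"
        using bspec [OF assms(1) [unfolded openin_product_topology_alt] assms(2)] by blast
      then have "\<forall>i<d. open (V i)" by simp
      with V show ?thesis by blast
    qed
    then show ?thesis using that by blast
  qed
  have "\<exists>l u. l \<in> \<rat> \<and> u \<in> \<rat> \<and> l < x i \<and> x i < u \<and> {l..u} \<subseteq> V i" if "i < d" for i
  proof -
    have "x i \<in> V i" using xV that by auto
    then obtain e where e: "0 < e" "ball (x i) e \<subseteq> V i" using V [OF \<open>i < d\<close>] open_contains_ball by blast
    obtain l where l: "l \<in> \<rat>" "x i - e < l" "l < x i" using Rats_dense_in_real [of "x i - e" "x i"] e by auto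
    obtain u where u: "u \<in> \<rat>" "x i < u" "u < x i + e" using Rats_dense_in_real [of "x i" "x i + e"] e by auto
    have "{l..u} \<subseteq> ball (x i) e" using l u by (auto simp: dist_real_def)
    then show ?thesis using l u e by blast
  qed
  then obtain a b where ab: "\<And>i. i < d \<Longrightarrow> a i \<in> \<rat> \<and> b i \<in> \<rat> \<and> a i < x i \<and> x i < b i \<and> {a i..b i} \<subseteq> V i"
    by metis
  show ?thesis
  proof (rule that [of "restrict a {..<d}" "restrict b {..<d}"])
    have "Pi\<^sub>E {..<d} (\<lambda>i. {restrict a {..<d} i..restrict b {..<d} i}) \<subseteq> Pi\<^sub>E {..<d} V"
      using ab by (intro PiE_mono) auto
    then show "Pi\<^sub>E {..<d} (\<lambda>i. {restrict a {..<d} i..restrict b {..<d} i}) \<subseteq> U" by (rule subset_trans [OF _ VU])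
    show "restrict a {..<d} i < x i \<and> x i < restrict b {..<d} i" if "i < d" for i using ab [OF that] that by simp
  qed (use ab in \<open>simp_all add: restrict_PiE_iff\<close>)
qed

definition rational_boxes :: "nat \<Rightarrow> (pt \<times> pt) set"
  where "rational_boxes d = ({..<d} \<rightarrow>\<^sub>E \<rat>) \<times> ({..<d} \<rightarrow>\<^sub>E \<rat>)"

lemma countable_rational_boxes: "countable (rational_boxes d)"
  unfolding rational_boxes_def by (intro countable_SIGMA countable_PiE) (auto simp: countable_rat)

lemma openin_eq_Union_boxes:
  assumes "openin (powertop_real {..<d}) U"
  shows "U = (\<Union>(a, b)\<in>{(a, b) \<in> rational_boxes d. Pi\<^sub>E {..<d} (\<lambda>i. {a i..b i}) \<subseteq> U}.
      Pi\<^sub>E {..<d} (\<lambda>i. {a i<..<b i}))" (is "U = ?R")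
proof (intro equalityI subsetI)
  fix x assume x: "x \<in> U"
  then have xR: "x \<in> Rd d" using openin_subset [OF assms] topspace_powertop by blast
  obtain a b where ab: "a \<in> {..<d} \<rightarrow>\<^sub>E \<rat>" "b \<in> {..<d} \<rightarrow>\<^sub>E \<rat>"
    and xab: "\<And>i. i < d \<Longrightarrow> a i < x i \<and> x i < b i" and sub: "Pi\<^sub>E {..<d} (\<lambda>i. {a i..b i}) \<subseteq> U"
    by (rule openin_powertop_box [OF assms x]) (rule that)
  have "x \<in> Pi\<^sub>E {..<d} (\<lambda>i. {a i<..<b i})"
  proof (rule PiE_I)
    show "x i \<in> {a i<..<b i}" if "i \<in> {..<d}" for i using xab [of i] that by simp
    show "x i = undefined" if "i \<notin> {..<d}" for i using xR that unfolding Rd_def by (rule PiE_arb)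
  qed
  moreover have "(a, b) \<in> rational_boxes d" using ab by (simp add: rational_boxes_def)
  ultimately show "x \<in> ?R" using sub by blast
next
  fix x assume "x \<in> ?R"
  then obtain a b where s: "Pi\<^sub>E {..<d} (\<lambda>i. {a i..b i}) \<subseteq> U" and x: "x \<in> Pi\<^sub>E {..<d} (\<lambda>i. {a i<..<b i})" by auto
  have "x \<in> Pi\<^sub>E {..<d} (\<lambda>i. {a i..b i})" using x by (auto simp: PiE_iff intro: less_imp_le)
  then show "x \<in> U" using s by blast
qed

text \<open>The topology admits arbitrary unions, the sigma-algebra only countable ones; the
  rational boxes reconcile the two.\<close>

lemma openin_powertop_measurable:
  assumes "openin (powertop_real {..<d}) U"
  shows "U \<in> sets (leb d)"
proof -
  have "(\<Union>(a, b)\<in>{(a, b) \<in> rational_boxes d. Pi\<^sub>E {..<d} (\<lambda>i. {a i..b i}) \<subseteq> U}.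
      Pi\<^sub>E {..<d} (\<lambda>i. {a i<..<b i})) \<in> sets (leb d)"
    by (intro sets.countable_UN' countable_subset [OF _ countable_rational_boxes]) auto
  then show ?thesis using openin_eq_Union_boxes [OF assms] by simp
qed

lemma continuous_map_borel_measurable:
  assumes "continuous_map (powertop_real {..<d}) euclideanreal f"
  shows "f \<in> borel_measurable (leb d)"
proof (rule borel_measurableI)
  fix S :: "real set" assume "open S"
  then have "openin (powertop_real {..<d}) {x \<in> topspace (powertop_real {..<d}). f x \<in> S}"
    using assms by (intro openin_continuous_map_preimage) auto
  moreover have "f -` S \<inter> space (leb d) = {x \<in> topspace (powertop_real {..<d}). f x \<in> S}"
    unfolding space_leb topspace_powertop by blast
  ultimately show "f -` S \<inter> space (leb d) \<in> sets (leb d)"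
    using openin_powertop_measurable by simp
qed

lemma closed_box_compactin: "compactin (powertop_real {..<d}) (Pi\<^sub>E {..<d} (\<lambda>i. {a i..b i}))"
  by (auto simp: compactin_PiE)

lemma continuous_map_upd:
  assumes "x \<in> Rd d" "i < d"
  shows "continuous_map euclideanreal (powertop_real {..<d}) (\<lambda>t. x(i := t))"
  unfolding continuous_map_componentwise
proof (intro conjI ballI)
  show "(\<lambda>t. x(i := t)) ` topspace euclideanreal \<subseteq> extensional {..<d}"
    using assms by (auto simp: Rd_def PiE_iff extensional_def)
  show "continuous_map euclideanreal euclideanreal (\<lambda>t. (x(i := t)) k)" for k
    by (cases "k = i") auto
qed

locale open_bounded =
  fixes d :: nat and \<Omega> :: "pt set"
  assumes op: "openin (powertop_real {..<d}) \<Omega>"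
    and bdd: "\<exists>B. \<forall>x\<in>\<Omega>. \<forall>i<d. \<bar>x i\<bar> \<le> B"
begin

lemma sub_Rd: "\<Omega> \<subseteq> Rd d"
  using openin_subset [OF op] topspace_powertop by blast

lemma measurable_dom: "\<Omega> \<in> sets (leb d)"
  using op by (rule openin_powertop_measurable)

lemma int_space: "\<Omega> \<inter> space (leb d) \<in> sets (leb d)"
  using measurable_dom by simp

lemma space_vol: "space (vol d \<Omega>) = \<Omega>"
  using sub_Rd by (auto simp: vol_def space_restrict_space space_leb)

lemma measurable_vol: "f \<in> borel_measurable (leb d) \<Longrightarrow> f \<in> borel_measurable (vol d \<Omega>)"
  unfolding vol_def by (rule measurable_restrict_space1)

lemma dom_sub_box:
  obtains B where "0 < B" "\<Omega> \<subseteq> Pi\<^sub>E {..<d} (\<lambda>_. {-B..B})" and "\<And>x i. x \<in> \<Omega> \<Longrightarrow> i < d \<Longrightarrow> \<bar>x i\<bar> < B"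
proof -
  obtain B where B: "\<And>x i. x \<in> \<Omega> \<Longrightarrow> i < d \<Longrightarrow> \<bar>x i\<bar> \<le> B" using bdd by blast
  have lt: "\<bar>x i\<bar> < \<bar>B\<bar> + 1" if "x \<in> \<Omega>" "i < d" for x i using B [OF that] by linarith
  show ?thesis
  proof (rule that [of "\<bar>B\<bar> + 1"])
    show "\<Omega> \<subseteq> Pi\<^sub>E {..<d} (\<lambda>_. {-(\<bar>B\<bar> + 1)..\<bar>B\<bar> + 1})"
    proof
      fix x assume x: "x \<in> \<Omega>"
      then have "x \<in> Rd d" using sub_Rd by blast
      moreover have "x i \<in> {-(\<bar>B\<bar> + 1)..\<bar>B\<bar> + 1}" if "i < d" for i
        using lt [OF x that] unfolding abs_less_iff by simp
      ultimately show "x \<in> Pi\<^sub>E {..<d} (\<lambda>_. {-(\<bar>B\<bar> + 1)..\<bar>B\<bar> + 1})"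
        unfolding Rd_def PiE_iff by blast
    qed
    show "\<bar>x i\<bar> < \<bar>B\<bar> + 1" if "x \<in> \<Omega>" "i < d" for x i using that by (rule lt)
  qed simp
qed

lemma finite_measure_vol: "finite_measure (vol d \<Omega>)"
proof (rule finite_measureI)
  obtain B where B: "0 < B" "\<Omega> \<subseteq> Pi\<^sub>E {..<d} (\<lambda>_. {-B..B})" by (rule dom_sub_box) (rule that)
  have "emeasure (vol d \<Omega>) (space (vol d \<Omega>)) = emeasure (leb d) \<Omega>"
    unfolding space_vol unfolding vol_def using int_space by (simp add: emeasure_restrict_space)
  also have "\<dots> \<le> emeasure (leb d) (Pi\<^sub>E {..<d} (\<lambda>_. {-B..B}))"
    using B by (intro emeasure_mono) auto
  also have "\<dots> = (\<Prod>i<d. ennreal (2 * B))"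
    using B by (subst lborel_product.emeasure_PiM) auto
  also have "\<dots> < \<infinity>" by (simp add: power_less_top_ennreal)
  finally show "emeasure (vol d \<Omega>) (space (vol d \<Omega>)) \<noteq> \<infinity>" by simp
qed

sublocale finite_measure "vol d \<Omega>"
  by (rule finite_measure_vol)

lemma continuous_bounded_dom:
  assumes "continuous_map (powertop_real {..<d}) euclideanreal f"
  obtains C where "0 \<le> C" "\<And>x. x \<in> \<Omega> \<Longrightarrow> \<bar>f x\<bar> \<le> C"
proof -
  obtain B where B: "\<Omega> \<subseteq> Pi\<^sub>E {..<d} (\<lambda>_. {-B..B})" by (rule dom_sub_box) (rule that)
  have "compactin euclideanreal (f ` Pi\<^sub>E {..<d} (\<lambda>_. {-B..B}))"
    using closed_box_compactin assms by (rule image_compactin)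
  then have "bounded (f ` Pi\<^sub>E {..<d} (\<lambda>_. {-B..B}))" by (simp add: compact_imp_bounded)
  then obtain C where C: "\<forall>y\<in>f ` Pi\<^sub>E {..<d} (\<lambda>_. {-B..B}). norm y \<le> C"
    unfolding bounded_iff by blast
  have "\<bar>f x\<bar> \<le> \<bar>C\<bar>" if "x \<in> \<Omega>" for x
  proof -
    have "norm (f x) \<le> C" using C B that by blast
    then show ?thesis by simp
  qed
  then show ?thesis by (intro that [of "\<bar>C\<bar>"]) auto
qed

lemma continuous_measurable_vol:
  "continuous_map (powertop_real {..<d}) euclideanreal f \<Longrightarrow> f \<in> borel_measurable (vol d \<Omega>)"
  by (intro measurable_vol continuous_map_borel_measurable)

lemma continuous_integrable:
  assumes "continuous_map (powertop_real {..<d}) euclideanreal f"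
  shows "integrable (vol d \<Omega>) f"
proof -
  obtain C where "\<And>x. x \<in> \<Omega> \<Longrightarrow> \<bar>f x\<bar> \<le> C" using continuous_bounded_dom [OF assms] by blast
  then show ?thesis
    by (intro integrable_const_bound [where B = C] continuous_measurable_vol assms) (auto simp: space_vol)
qed

lemma continuous_L2:
  assumes "continuous_map (powertop_real {..<d}) euclideanreal f"
  shows "f \<in> L2 d \<Omega>"
  unfolding L2_def power2_eq_square
  using assms by (auto intro!: continuous_measurable_vol continuous_integrable continuous_map_real_mult)

end


section \<open>Smooth bump functions\<close>

text \<open>The smooth function \<open>exp (-1/w)\<close>, set to 0 where the polynomial \<open>w\<close> is not positive, together with
  a class of functions that contains all its derivatives.\<close>

definition bump :: "real poly \<Rightarrow> real poly \<Rightarrow> nat \<Rightarrow> real \<Rightarrow> real"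
  where "bump w p k x =
    (if 0 < poly w x then poly p x * (1 / poly w x) ^ k * exp (- (1 / poly w x)) else 0)"

lemma power_le_fact_exp: "0 \<le> s \<Longrightarrow> s ^ n \<le> fact n * exp (s::real)"
proof -
  assume s: "0 \<le> s"
  have "(\<Sum>i\<in>{n}. s ^ i /\<^sub>R fact i) \<le> exp s"
    unfolding exp_def using s by (intro sum_le_suminf summable_exp_generic) auto
  then show ?thesis by (simp add: field_simps)
qed

text \<open>One term of the exponential series bounds \<open>s ^ (k + 2) * exp (- s)\<close> for
  \<open>s = 1 / w\<close>. Two powers of \<open>w\<close> are left over, which makes the derivative
  vanish at the zeros of \<open>w\<close>.\<close>

lemma bump_bound: "\<bar>bump w p k x\<bar> \<le> fact (k + 2) * \<bar>poly p x\<bar> * (poly w x)\<^sup>2"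
proof (cases "0 < poly w x")
  case True
  define s where "s = 1 / poly w x"
  have s: "0 < s" "poly w x = 1 / s" using True by (auto simp: s_def)
  have "s ^ (k + 2) * exp (- s) \<le> fact (k + 2)"
    using power_le_fact_exp [of s "k + 2"] s by (simp add: exp_minus field_simps)
  then have "(\<bar>poly p x\<bar> * (1 / s)\<^sup>2) * (s ^ (k + 2) * exp (- s)) \<le> (\<bar>poly p x\<bar> * (1 / s)\<^sup>2) * fact (k + 2)"
    by (intro mult_left_mono) auto
  moreover have "\<bar>bump w p k x\<bar> = (\<bar>poly p x\<bar> * (1 / s)\<^sup>2) * (s ^ (k + 2) * exp (- s))"
  proof -
    have "bump w p k x = poly p x * s ^ k * exp (- s)" using True by (simp add: bump_def s_def)
    then have "\<bar>bump w p k x\<bar> = \<bar>poly p x\<bar> * s ^ k * exp (- s)" using s(1) by (simp add: abs_mult)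
    moreover have "(1 / s)\<^sup>2 * s ^ (k + 2) = s ^ k" using s(1) by (simp add: power_add power2_eq_square)
    moreover have "(\<bar>poly p x\<bar> * (1 / s)\<^sup>2) * (s ^ (k + 2) * exp (- s)) = \<bar>poly p x\<bar> * ((1 / s)\<^sup>2 * s ^ (k + 2)) * exp (- s)"
      by (simp only: mult_ac)
    ultimately show ?thesis by (simp only:)
  qed
  ultimately show ?thesis by (simp add: s mult_ac)
qed (simp add: bump_def)

text \<open>Numerator of the derivative over the common denominator \<open>w ^ (k + 2)\<close>;
  being a polynomial, it keeps the class closed under differentiation.\<close>

definition bump_deriv :: "real poly \<Rightarrow> real poly \<Rightarrow> nat \<Rightarrow> real poly"
  where "bump_deriv w p k = pderiv p * w\<^sup>2 - smult (of_nat k) (p * pderiv w * w) + p * pderiv w"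

lemma bump_has_derivative:
  "(bump w p k has_field_derivative bump w (bump_deriv w p k) (k + 2) x) (at x)"
proof (rule linorder_cases [of "poly w x" 0])
  assume neg: "poly w x < 0"
  have "open {y. poly w y < 0}" by (intro open_Collect_less continuous_intros)
  moreover have "(\<lambda>_. 0) y = bump w p k y" if "y \<in> {y. poly w y < 0}" for y using that by (simp add: bump_def)
  moreover have "((\<lambda>_. 0 :: real) has_field_derivative 0) (at x)" by simp
  ultimately have "(bump w p k has_field_derivative 0) (at x)"
    using neg has_field_derivative_transform_within_open [of "\<lambda>_. 0" 0 x "{y. poly w y < 0}" "bump w p k"] by simp
  then show ?thesis using neg by (simp add: bump_def)
next
  \<comment> \<open>At a zero of \<open>w\<close>, the difference quotient is dominated by a locally
    bounded factor times \<open>w\<close> times the difference quotient of \<open>w\<close>, which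
    tends to 0.\<close>
  assume zero: "poly w x = 0"
  have b0: "bump w q j x = 0" for q j using zero by (simp add: bump_def)
  have "(poly w has_field_derivative poly (pderiv w) x) (at x)" by (rule poly_DERIV)
  then have lim: "((\<lambda>y. (poly w y - poly w x) / (y - x)) \<longlongrightarrow> poly (pderiv w) x) (at x)"
    by (simp add: has_field_derivative_iff)
  have "((\<lambda>y. fact (k + 2) * \<bar>poly p y\<bar> * (\<bar>poly w y\<bar> * \<bar>(poly w y - poly w x) / (y - x)\<bar>))
      \<longlongrightarrow> fact (k + 2) * \<bar>poly p x\<bar> * (\<bar>poly w x\<bar> * \<bar>poly (pderiv w) x\<bar>)) (at x)"
    by (intro tendsto_intros lim)
  then have l0: "((\<lambda>y. fact (k + 2) * \<bar>poly p y\<bar> * (\<bar>poly w y\<bar> * \<bar>poly w y / (y - x)\<bar>)) \<longlongrightarrow> 0) (at x)"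
    by (simp add: zero)
  have "((\<lambda>y. (bump w p k y - bump w p k x) / (y - x)) \<longlongrightarrow> 0) (at x)"
  proof (rule Lim_null_comparison [OF _ l0], rule always_eventually, intro allI)
    fix y
    have "norm ((bump w p k y - bump w p k x) / (y - x)) = \<bar>bump w p k y\<bar> / \<bar>y - x\<bar>" by (simp add: b0)
    also have "\<dots> \<le> fact (k + 2) * \<bar>poly p y\<bar> * (poly w y)\<^sup>2 / \<bar>y - x\<bar>"
      by (intro divide_right_mono bump_bound) auto
    also have "\<dots> = fact (k + 2) * \<bar>poly p y\<bar> * (\<bar>poly w y\<bar> * \<bar>poly w y / (y - x)\<bar>)"
      by (simp add: power2_eq_square abs_mult [symmetric])
    finally show "norm ((bump w p k y - bump w p k x) / (y - x))
        \<le> fact (k + 2) * \<bar>poly p y\<bar> * (\<bar>poly w y\<bar> * \<bar>poly w y / (y - x)\<bar>)" .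
  qed
  then show ?thesis by (simp add: has_field_derivative_iff b0)
next
  assume pos: "0 < poly w x"
  let ?W = "poly w x" and ?W' = "poly (pderiv w) x" and ?P = "poly p x" and ?P' = "poly (pderiv p) x"
  let ?f = "\<lambda>y. poly p y * (1 / poly w y) ^ k * exp (- (1 / poly w y))"
  let ?e = "exp (- (1 / ?W))"
  have dw: "((\<lambda>y. 1 / poly w y) has_field_derivative - (?W' / ?W\<^sup>2)) (at x)"
    using pos by (auto intro!: derivative_eq_intros simp: power2_eq_square)
  have "(?f has_field_derivative
      (?P' * (1 / ?W) ^ k + ?P * (of_nat k * (1 / ?W) ^ (k - 1) * - (?W' / ?W\<^sup>2))) * ?e
      + ?P * (1 / ?W) ^ k * (?e * (?W' / ?W\<^sup>2))) (at x)"
    by (rule derivative_eq_intros dw refl poly_DERIV)+ (simp add: algebra_simps)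
  also have "(?P' * (1 / ?W) ^ k + ?P * (of_nat k * (1 / ?W) ^ (k - 1) * - (?W' / ?W\<^sup>2))) * ?e
      + ?P * (1 / ?W) ^ k * (?e * (?W' / ?W\<^sup>2)) = bump w (bump_deriv w p k) (k + 2) x"
  proof -
    have "of_nat k * (1 / ?W) ^ (k - 1) = of_nat k * (1 / ?W) ^ k * ?W"
      using pos by (cases k) auto
    then have "(?P' * (1 / ?W) ^ k + ?P * (of_nat k * (1 / ?W) ^ (k - 1) * - (?W' / ?W\<^sup>2))) * ?e
      + ?P * (1 / ?W) ^ k * (?e * (?W' / ?W\<^sup>2))
      = (?P' * ?W\<^sup>2 - of_nat k * (?P * ?W' * ?W) + ?P * ?W') * ((1 / ?W) ^ k * (1 / ?W)\<^sup>2) * ?e"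
      using pos by (simp only:) (simp add: field_simps power2_eq_square)
    then show ?thesis using pos by (simp add: bump_def bump_deriv_def power_add power2_eq_square)
  qed
  finally have *: "(?f has_field_derivative bump w (bump_deriv w p k) (k + 2) x) (at x)" .
  have "open {y. 0 < poly w y}" by (intro open_Collect_less continuous_intros)
  moreover have "?f y = bump w p k y" if "y \<in> {y. 0 < poly w y}" for y using that by (simp add: bump_def)
  ultimately show ?thesis
    using pos has_field_derivative_transform_within_open [OF *, of "{y. 0 < poly w y}" "bump w p k"] by simp
qed

lemma bump_higher_deriv: "\<exists>p' k'. (deriv ^^ n) (bump w p k) = bump w p' k'"
proof (induction n)
  case (Suc n)
  then obtain p' k' where "(deriv ^^ n) (bump w p k) = bump w p' k'" by blast
  then have "(deriv ^^ Suc n) (bump w p k) = bump w (bump_deriv w p' k') (k' + 2)"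
    using DERIV_imp_deriv [OF bump_has_derivative] by auto
  then show ?case by blast
qed auto

lemma continuous_bump: "continuous_on UNIV (bump w p k)"
  using bump_has_derivative by (meson DERIV_continuous_on has_field_derivative_at_within)

text \<open>A partial derivative acts on its own factor only, so just the multiplicity of each
  direction in the list matters.\<close>

lemma foldr_pd_prod:
  assumes diff: "\<And>i n t. i < d \<Longrightarrow> (deriv ^^ n) (f i) field_differentiable at t"
    and "set is \<subseteq> {..<d}"
  shows "foldr pd is (\<lambda>x. \<Prod>i<d. f i (x i)) = (\<lambda>x. \<Prod>i<d. (deriv ^^ count_list is i) (f i) (x i))"
  using assms(2)
proof (induction "is")
  case (Cons k "is")
  then have k: "k < d" and IH: "foldr pd is (\<lambda>x. \<Prod>i<d. f i (x i)) = (\<lambda>x. \<Prod>i<d. (deriv ^^ count_list is i) (f i) (x i))"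
    by auto
  let ?g = "\<lambda>i. (deriv ^^ count_list is i) (f i)"
  have "pd k (\<lambda>x. \<Prod>i<d. ?g i (x i)) x = (\<Prod>i<d. (deriv ^^ count_list (k # is) i) (f i) (x i))" for x
  proof -
    let ?c = "\<Prod>i\<in>{..<d} - {k}. ?g i (x i)"
    have split: "(\<Prod>i<d. h i) = h k * (\<Prod>i\<in>{..<d} - {k}. h i)" for h :: "nat \<Rightarrow> real"
      using k by (simp add: prod.remove)
    have "(\<lambda>t. \<Prod>i<d. ?g i ((x(k := t)) i)) = (\<lambda>t. ?g k t * ?c)"
      unfolding split by (intro ext arg_cong2 [where f = "(*)"] prod.cong) auto
    then have "pd k (\<lambda>x. \<Prod>i<d. ?g i (x i)) x = deriv (\<lambda>t. ?g k t * ?c) (x k)" by (simp add: pd_def)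
    also have "\<dots> = deriv (?g k) (x k) * ?c"
      using diff [OF k] by (intro DERIV_imp_deriv DERIV_cmult_right) (auto simp: DERIV_deriv_iff_field_differentiable)
    also have "\<dots> = (\<Prod>i<d. (deriv ^^ count_list (k # is) i) (f i) (x i))"
      unfolding split by (intro arg_cong2 [where f = "(*)"] prod.cong) auto
    finally show ?thesis .
  qed
  then show ?case by (simp add: IH fun_eq_iff)
qed simp

lemma smooth_prod_bump: "smooth d (\<lambda>x. \<Prod>i<d. bump (w i) (p i) (k i) (x i))"
  unfolding smooth_def
proof (intro allI impI)
  fix "is" assume "is": "set is \<subseteq> {..<d}"
  let ?\<phi> = "\<lambda>x. \<Prod>i<d. bump (w i) (p i) (k i) (x i)"
  have diff: "(deriv ^^ n) (bump (w i) (p i) (k i)) field_differentiable at t" for i n t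
    using bump_higher_deriv [of n "w i" "p i" "k i"] bump_has_derivative
    by (metis field_differentiable_def)
  have "\<forall>i. \<exists>p' k'. (deriv ^^ count_list is i) (bump (w i) (p i) (k i)) = bump (w i) p' k'"
    using bump_higher_deriv by blast
  then obtain p' k' where pk: "\<And>i. (deriv ^^ count_list is i) (bump (w i) (p i) (k i)) = bump (w i) (p' i) (k' i)"
    by metis
  have eq: "foldr pd is ?\<phi> = (\<lambda>x. \<Prod>i<d. bump (w i) (p' i) (k' i) (x i))"
    by (subst foldr_pd_prod [OF _ "is"]) (auto simp: diff pk)
  show "continuous_map (powertop_real {..<d}) euclideanreal (foldr pd is ?\<phi>) \<and>
      (\<forall>x\<in>Rd d. \<forall>i<d. (\<lambda>t. foldr pd is ?\<phi> (x(i := t))) field_differentiable at (x i))"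
  proof (intro conjI ballI allI impI)
    have "continuous_map (powertop_real {..<d}) euclideanreal (\<lambda>x. bump (w i) (p' i) (k' i) (x i))" if "i < d" for i
    proof -
      have "continuous_map euclideanreal euclideanreal (bump (w i) (p' i) (k' i))"
        using continuous_bump by simp
      then show ?thesis
        using continuous_map_compose [OF continuous_map_product_projection [of i "{..<d}" "\<lambda>_. euclideanreal"]] that
        unfolding o_def by blast
    qed
    then show "continuous_map (powertop_real {..<d}) euclideanreal (foldr pd is ?\<phi>)"
      unfolding eq by (intro continuous_map_prod) auto
    fix x :: pt and i assume "i < d"
    have "(\<lambda>t. \<Prod>j<d. bump (w j) (p' j) (k' j) ((x(i := t)) j))
        = (\<lambda>t. bump (w i) (p' i) (k' i) t * (\<Prod>j\<in>{..<d} - {i}. bump (w j) (p' j) (k' j) (x j)))"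
      using \<open>i < d\<close> by (intro ext) (subst prod.remove [of _ i], auto intro!: prod.cong arg_cong2 [where f = "(*)"])
    then show "(\<lambda>t. foldr pd is ?\<phi> (x(i := t))) field_differentiable at (x i)"
      unfolding eq field_differentiable_def using DERIV_cmult_right [OF bump_has_derivative] by (simp only:) blast
  qed
qed

text \<open>Positive exactly on the open interval; there the factor \<open>Suc n\<close> drives
  \<open>exp (-1/w)\<close> to 1 as \<open>n\<close> grows, which yields the indicator in the
  limit.\<close>

definition interval_poly :: "real \<Rightarrow> real \<Rightarrow> nat \<Rightarrow> real poly"
  where "interval_poly a b n = smult (of_nat (Suc n)) ([:-a, 1:] * [:b, -1:])"

lemma poly_interval_poly: "poly (interval_poly a b n) x = real (Suc n) * ((x - a) * (b - x))"
  by (simp add: interval_poly_def algebra_simps)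

lemma interval_poly_pos_iff: "a < b \<Longrightarrow> 0 < poly (interval_poly a b n) x \<longleftrightarrow> x \<in> {a<..<b}"
  unfolding poly_interval_poly by (auto simp: zero_less_mult_iff)

lemma interval_bump_bounds: "0 \<le> bump (interval_poly a b n) 1 0 x" "bump (interval_poly a b n) 1 0 x \<le> 1"
  by (auto simp: bump_def)

lemma interval_bump_tendsto:
  assumes "a < b"
  shows "(\<lambda>n. bump (interval_poly a b n) 1 0 x) \<longlonglongrightarrow> indicator {a<..<b} x"
proof (cases "x \<in> {a<..<b}")
  case True
  then have pos: "0 < (x - a) * (b - x)" by simp
  have "(\<lambda>n. 1 / (x - a) / (b - x) * inverse (real (Suc n))) \<longlonglongrightarrow> 1 / (x - a) / (b - x) * 0"
    by (intro tendsto_intros LIMSEQ_inverse_real_of_nat)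
  then have "(\<lambda>n. exp (- (1 / (real (Suc n) * ((x - a) * (b - x)))))) \<longlonglongrightarrow> exp (- (1 / (x - a) / (b - x) * 0))"
    by (intro tendsto_exp tendsto_minus) (simp add: field_simps)
  then show ?thesis using True interval_poly_pos_iff [OF assms]
    by (simp add: bump_def poly_interval_poly)
next
  case False
  then have "\<not> 0 < poly (interval_poly a b n) x" for n using interval_poly_pos_iff [OF assms] by blast
  then show ?thesis using False by (simp add: bump_def)
qed

lemma box_bump_test_function:
  assumes ab: "\<And>i. i < d \<Longrightarrow> a i < b i" and sub: "Pi\<^sub>E {..<d} (\<lambda>i. {a i..b i}) \<subseteq> \<Omega>"
  shows "(\<lambda>x. \<Prod>i<d. bump (interval_poly (a i) (b i) n) 1 0 (x i)) \<in> test_functions d \<Omega>" (is "?\<phi> \<in> _")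
proof -
  let ?T = "powertop_real {..<d}" and ?K = "Pi\<^sub>E {..<d} (\<lambda>i. {a i..b i})"
  have "?\<phi> x = 0" if x: "x \<in> Rd d - ?K" for x
  proof -
    obtain i where i: "i < d" "x i \<notin> {a i..b i}" using x by (auto simp: Rd_def PiE_iff)
    then have "bump (interval_poly (a i) (b i) n) 1 0 (x i) = 0"
      using interval_poly_pos_iff [OF ab, of i] by (auto simp: bump_def)
    then show ?thesis using i by (meson finite_lessThan lessThan_iff prod_zero)
  qed
  then have "{x \<in> Rd d. ?\<phi> x \<noteq> 0} \<subseteq> ?K" by blast
  moreover have "closedin ?T ?K" by (auto simp: closedin_product_topology)
  ultimately have cl: "?T closure_of {x \<in> Rd d. ?\<phi> x \<noteq> 0} \<subseteq> ?K" by (rule closure_of_minimal)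
  then have "compactin ?T (?T closure_of {x \<in> Rd d. ?\<phi> x \<noteq> 0})"
    by (rule closed_compactin [OF closed_box_compactin]) simp
  then show ?thesis
    unfolding test_functions_def mem_Collect_eq
    by (intro conjI smooth_prod_bump subset_trans [OF cl sub])
qed


section \<open>Square integrable functions and weak gradients\<close>

lemma integrable_mult_if_square_integrable:
  fixes f g :: "'a \<Rightarrow> real"
  assumes [measurable]: "f \<in> borel_measurable M" "g \<in> borel_measurable M"
    and "integrable M (\<lambda>x. (f x)\<^sup>2)" "integrable M (\<lambda>x. (g x)\<^sup>2)"
  shows "integrable M (\<lambda>x. f x * g x)"
proof (rule Bochner_Integration.integrable_bound)
  show "integrable M (\<lambda>x. (f x)\<^sup>2 + (g x)\<^sup>2)" using assms by simp
  have "\<bar>a * b\<bar> \<le> a\<^sup>2 + b\<^sup>2" for a b :: real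
  proof -
    have "0 \<le> (\<bar>a\<bar> - \<bar>b\<bar>)\<^sup>2" by simp
    then have "2 * (\<bar>a\<bar> * \<bar>b\<bar>) \<le> a\<^sup>2 + b\<^sup>2" by (simp add: power2_diff)
    moreover have "0 \<le> \<bar>a\<bar> * \<bar>b\<bar>" by simp
    ultimately show ?thesis unfolding abs_mult by linarith
  qed
  then show "AE x in M. norm (f x * g x) \<le> norm ((f x)\<^sup>2 + (g x)\<^sup>2)" by simp
qed simp

lemma L2_mult_integrable: "f \<in> L2 d \<Omega> \<Longrightarrow> g \<in> L2 d \<Omega> \<Longrightarrow> integrable (vol d \<Omega>) (\<lambda>x. f x * g x)"
  unfolding L2_def by (auto intro: integrable_mult_if_square_integrable)

lemma L2_lin:
  assumes "f \<in> L2 d \<Omega>" "g \<in> L2 d \<Omega>"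
  shows "(\<lambda>x. r * f x + s * g x) \<in> L2 d \<Omega>"
proof -
  have [measurable]: "f \<in> borel_measurable (vol d \<Omega>)" "g \<in> borel_measurable (vol d \<Omega>)"
    using assms by (auto simp: L2_def)
  have "integrable (vol d \<Omega>) (\<lambda>x. r\<^sup>2 * (f x)\<^sup>2 + 2 * r * s * (f x * g x) + s\<^sup>2 * (g x)\<^sup>2)"
    using assms L2_mult_integrable [OF assms] by (intro Bochner_Integration.integrable_add) (auto simp: L2_def)
  moreover have "r\<^sup>2 * (f x)\<^sup>2 + 2 * r * s * (f x * g x) + s\<^sup>2 * (g x)\<^sup>2 = (r * f x + s * g x)\<^sup>2" for x
    by (simp add: power2_eq_square algebra_simps)
  ultimately show ?thesis by (simp add: L2_def)
qed

lemma L2_zero: "(\<lambda>_. 0) \<in> L2 d \<Omega>"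
  by (simp add: L2_def)

lemma L2_add: "f \<in> L2 d \<Omega> \<Longrightarrow> g \<in> L2 d \<Omega> \<Longrightarrow> (\<lambda>x. f x + g x) \<in> L2 d \<Omega>"
  using L2_lin [of f d \<Omega> g 1 1] by simp

lemma L2_sum: "(\<And>i. i \<in> I \<Longrightarrow> f i \<in> L2 d \<Omega>) \<Longrightarrow> (\<lambda>x. \<Sum>i\<in>I. f i x) \<in> L2 d \<Omega>"
  by (induction I rule: infinite_finite_induct) (auto intro: L2_zero L2_add)

lemma L2_Linf_mult:
  assumes "c \<in> Linf d \<Omega>" "f \<in> L2 d \<Omega>"
  shows "(\<lambda>x. c x * f x) \<in> L2 d \<Omega>"
proof -
  have [measurable]: "f \<in> borel_measurable (vol d \<Omega>)" "c \<in> borel_measurable (vol d \<Omega>)"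
    using assms by (auto simp: L2_def Linf_def)
  obtain B where B: "AE x in vol d \<Omega>. \<bar>c x\<bar> \<le> B" using assms by (auto simp: Linf_def)
  have "integrable (vol d \<Omega>) (\<lambda>x. (c x * f x)\<^sup>2)"
  proof (rule Bochner_Integration.integrable_bound)
    show "integrable (vol d \<Omega>) (\<lambda>x. B\<^sup>2 * (f x)\<^sup>2)" using assms by (simp add: L2_def)
    show "AE x in vol d \<Omega>. norm ((c x * f x)\<^sup>2) \<le> norm (B\<^sup>2 * (f x)\<^sup>2)"
      using B
    proof eventually_elim
      case (elim x)
      then have "(c x)\<^sup>2 \<le> B\<^sup>2" by (metis abs_ge_zero power2_abs power_mono)
      then show ?case by (simp add: power_mult_distrib mult_right_mono)
    qed
  qed simp
  then show ?thesis by (simp add: L2_def)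
qed

section \<open>Smooth functions and the vector space of test functions\<close>

lemma test_function_smooth: "\<phi> \<in> test_functions d \<Omega> \<Longrightarrow> smooth d \<phi>"
  by (simp add: test_functions_def)

lemma smooth_continuous: "smooth d \<phi> \<Longrightarrow> continuous_map (powertop_real {..<d}) euclideanreal \<phi>"
  unfolding smooth_def by (drule spec [of _ "[]"]) simp

lemma smooth_continuous_pd:
  "smooth d \<phi> \<Longrightarrow> i < d \<Longrightarrow> continuous_map (powertop_real {..<d}) euclideanreal (pd i \<phi>)"
  unfolding smooth_def by (drule spec [of _ "[i]"]) simp

lemma smooth_has_pd:
  assumes "smooth d \<phi>" "x \<in> Rd d" "i < d"
  shows "((\<lambda>s. \<phi> (x(i := s))) has_field_derivative pd i \<phi> (x(i := t))) (at t)"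
proof -
  have "(\<lambda>s. foldr pd [] \<phi> ((x(i := t))(i := s))) field_differentiable at ((x(i := t)) i)"
    using assms Rd_upd [of x d i t] unfolding smooth_def by (metis empty_subsetI list.set(1))
  then have "((\<lambda>s. \<phi> (x(i := s))) has_field_derivative deriv (\<lambda>s. \<phi> (x(i := s))) t) (at t)"
    by (simp add: DERIV_deriv_iff_field_differentiable)
  then show ?thesis by (simp add: pd_def)
qed

lemma foldr_pd_lin:
  assumes "smooth d \<phi>" "smooth d \<psi>" "set is \<subseteq> {..<d}" "x \<in> Rd d"
  shows "foldr pd is (\<lambda>x. r * \<phi> x + s * \<psi> x) x = r * foldr pd is \<phi> x + s * foldr pd is \<psi> x"
  using assms(3,4)
proof (induction "is" arbitrary: x)
  case (Cons i "is")
  then have i: "i < d" and sub: "set is \<subseteq> {..<d}" by auto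
  let ?F = "\<lambda>t. foldr pd is \<phi> (x(i := t))" and ?G = "\<lambda>t. foldr pd is \<psi> (x(i := t))"
  have d: "?F field_differentiable at (x i)" "?G field_differentiable at (x i)"
    using assms(1,2) sub i Cons.prems(2) unfolding smooth_def by blast+
  have "(\<lambda>t. foldr pd is (\<lambda>x. r * \<phi> x + s * \<psi> x) (x(i := t))) = (\<lambda>t. r * ?F t + s * ?G t)"
    using Cons.IH [OF sub Rd_upd [OF Cons.prems(2) i]] by (intro ext)
  then have "foldr pd (i # is) (\<lambda>x. r * \<phi> x + s * \<psi> x) x = deriv (\<lambda>t. r * ?F t + s * ?G t) (x i)"
    by (simp add: pd_def)
  also have "\<dots> = r * deriv ?F (x i) + s * deriv ?G (x i)"
    using d by (intro DERIV_imp_deriv DERIV_add DERIV_cmult) (auto simp: DERIV_deriv_iff_field_differentiable)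
  finally show ?case by (simp add: pd_def [of i])
qed simp

lemma smooth_lin:
  assumes "smooth d \<phi>" "smooth d \<psi>"
  shows "smooth d (\<lambda>x. r * \<phi> x + s * \<psi> x)"
  unfolding smooth_def
proof (intro allI impI conjI ballI)
  fix "is" assume sub: "set is \<subseteq> {..<d}"
  note lin = foldr_pd_lin [OF assms sub]
  have c: "continuous_map (powertop_real {..<d}) euclideanreal (foldr pd is \<phi>)"
    "continuous_map (powertop_real {..<d}) euclideanreal (foldr pd is \<psi>)"
    using assms sub unfolding smooth_def by blast+
  show "continuous_map (powertop_real {..<d}) euclideanreal (foldr pd is (\<lambda>x. r * \<phi> x + s * \<psi> x))"
  proof (rule continuous_map_eq)
    show "continuous_map (powertop_real {..<d}) euclideanreal (\<lambda>x. r * foldr pd is \<phi> x + s * foldr pd is \<psi> x)"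
      by (intro continuous_intros c continuous_map_real_mult continuous_map_add) auto
  qed (use lin in \<open>simp add: topspace_powertop del: topspace_product_topology\<close>)
  fix x i assume x: "x \<in> Rd d" and i: "i < d"
  have "(\<lambda>t. foldr pd is (\<lambda>x. r * \<phi> x + s * \<psi> x) (x(i := t)))
      = (\<lambda>t. r * foldr pd is \<phi> (x(i := t)) + s * foldr pd is \<psi> (x(i := t)))"
    using lin [OF Rd_upd [OF x i]] by (intro ext)
  moreover have "(\<lambda>t. foldr pd is \<phi> (x(i := t))) field_differentiable at (x i)"
    "(\<lambda>t. foldr pd is \<psi> (x(i := t))) field_differentiable at (x i)"
    using assms sub x i unfolding smooth_def by blast+
  ultimately show "(\<lambda>t. foldr pd is (\<lambda>x. r * \<phi> x + s * \<psi> x) (x(i := t))) field_differentiable at (x i)"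
    by (simp add: field_differentiable_add field_differentiable_mult)
qed

lemma test_functions_lin:
  assumes "\<phi> \<in> test_functions d \<Omega>" "\<psi> \<in> test_functions d \<Omega>"
  shows "(\<lambda>x. r * \<phi> x + s * \<psi> x) \<in> test_functions d \<Omega>"
proof -
  let ?T = "powertop_real {..<d}"
  let ?S = "\<lambda>\<zeta>::fn. ?T closure_of {x \<in> Rd d. \<zeta> x \<noteq> 0}"
  let ?\<zeta> = "\<lambda>x. r * \<phi> x + s * \<psi> x"
  have "{x \<in> Rd d. ?\<zeta> x \<noteq> 0} \<subseteq> {x \<in> Rd d. \<phi> x \<noteq> 0} \<union> {x \<in> Rd d. \<psi> x \<noteq> 0}" by auto
  from closure_of_mono [OF this, of ?T] have sub: "?S ?\<zeta> \<subseteq> ?S \<phi> \<union> ?S \<psi>"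
    unfolding closure_of_Un .
  have "compactin ?T (?S \<phi> \<union> ?S \<psi>)" using assms by (intro compactin_Un) (auto simp: test_functions_def)
  then have "compactin ?T (?S ?\<zeta>)" using sub by (rule closed_compactin) simp
  moreover have "?S ?\<zeta> \<subseteq> \<Omega>" using sub assms by (auto simp: test_functions_def)
  ultimately show ?thesis using assms smooth_lin by (simp add: test_functions_def)
qed

lemma smooth_zero: "smooth d (\<lambda>_. 0)"
proof -
  have "foldr pd is (\<lambda>_. 0) = (\<lambda>_. 0)" for "is" by (induction "is") (auto simp: pd_def)
  then show ?thesis by (simp add: smooth_def)
qed

lemma test_functions_zero: "(\<lambda>_. 0) \<in> test_functions d \<Omega>"
  by (simp add: test_functions_def smooth_zero)

lemma test_function_outside:
  assumes "\<phi> \<in> test_functions d \<Omega>" "x \<in> Rd d" "x \<notin> \<Omega>"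
  shows "\<phi> x = 0"
proof (rule ccontr)
  assume "\<phi> x \<noteq> 0"
  have "{x \<in> Rd d. \<phi> x \<noteq> 0} \<subseteq> powertop_real {..<d} closure_of {x \<in> Rd d. \<phi> x \<noteq> 0}"
    by (rule closure_of_subset) (auto simp: topspace_powertop simp del: topspace_product_topology)
  then show False using assms \<open>\<phi> x \<noteq> 0\<close> unfolding test_functions_def by blast
qed

section \<open>Fundamental lemma of the calculus of variations\<close>

definition open_boxes :: "nat \<Rightarrow> pt set set"
  where "open_boxes d = {Pi\<^sub>E {..<d} (\<lambda>i. {a i<..<b i}) | a b. True}"

lemma open_boxesI: "Pi\<^sub>E {..<d} (\<lambda>i. {a i<..<b i}) \<in> open_boxes d"
  unfolding open_boxes_def by (rule CollectI, rule exI [of _ a], rule exI [of _ b]) simp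

lemma box_Int:
  "Pi\<^sub>E {..<d} (\<lambda>i. {a i<..<b i :: real}) \<inter> Pi\<^sub>E {..<d} (\<lambda>i. {a' i<..<b' i})
    = Pi\<^sub>E {..<d} (\<lambda>i. {max (a i) (a' i)<..<min (b i) (b' i)})"
  unfolding PiE_Int by (intro PiE_cong) auto

lemma open_boxes_Rd: "open_boxes d \<subseteq> Pow (Rd d)"
proof
  fix X assume "X \<in> open_boxes d"
  then obtain a b where "X = Pi\<^sub>E {..<d} (\<lambda>i. {a i<..<b i})" unfolding open_boxes_def by blast
  moreover have "Pi\<^sub>E {..<d} (\<lambda>i. {a i<..<b i}) \<subseteq> Rd d" unfolding Rd_def by (rule PiE_mono) simp
  ultimately show "X \<in> Pow (Rd d)" by simp
qed

text \<open>Open boxes are an intersection-stable generator, as Dynkin's argument requires.\<close>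

lemma sets_leb: "sets (leb d) = sigma_sets (Rd d) (open_boxes d)"
proof -
  let ?E = "range (\<lambda>(a::real, b). box a b)"
  have "sets (leb d) = sets (Pi\<^sub>M {..<d} (\<lambda>_. sigma UNIV ?E))"
  proof (rule sets_PiM_cong [OF refl])
    show "sets lborel = sets (sigma UNIV ?E)" by (simp only: sets_lborel borel_eq_box)
  qed
  also have "\<dots> = sets (sigma (Pi\<^sub>E {..<d} (\<lambda>_. UNIV))
      {{f \<in> Pi\<^sub>E {..<d} (\<lambda>_. UNIV). \<forall>i\<in>j. f i \<in> A i} | A j. j \<in> {{..<d}} \<and> A \<in> Pi j (\<lambda>_. ?E)})"
  proof (rule sets_PiM_sigma)
    show "\<exists>S\<subseteq>?E. countable S \<and> UNIV = \<Union>S"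
    proof (intro exI conjI)
      show "range (\<lambda>n. box (- real n) (real n)) \<subseteq> ?E" by auto
      have "x \<in> \<Union> (range (\<lambda>n. box (- real n) (real n)))" for x
      proof -
        obtain n where "\<bar>x\<bar> < real n" using reals_Archimedean2 by blast
        then have "x \<in> box (- real n) (real n)" by auto
        then show ?thesis by blast
      qed
      then show "UNIV = \<Union> (range (\<lambda>n. box (- real n) (real n)))" by blast
    qed simp
  qed auto
  also have "{{f \<in> Pi\<^sub>E {..<d} (\<lambda>_. UNIV). \<forall>i\<in>j. f i \<in> A i} | A j. j \<in> {{..<d}} \<and> A \<in> Pi j (\<lambda>_. ?E)} = open_boxes d"
    (is "?L = _")
  proof (intro equalityI subsetI)
    fix X assume "X \<in> ?L"
    then obtain A j where "X = {f \<in> Pi\<^sub>E {..<d} (\<lambda>_. UNIV). \<forall>i\<in>j. f i \<in> A i}" "j \<in> {{..<d}}" "A \<in> Pi j (\<lambda>_. ?E)"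
      unfolding mem_Collect_eq by (elim exE conjE) (rule that)
    then have X: "X = {f \<in> Pi\<^sub>E {..<d} (\<lambda>_. UNIV). \<forall>i\<in>{..<d}. f i \<in> A i}" and A: "A \<in> Pi {..<d} (\<lambda>_. ?E)"
      unfolding singleton_iff by simp_all
    have "\<forall>i\<in>{..<d}. \<exists>a b. A i = {a<..<b}"
    proof
      fix i assume "i \<in> {..<d}"
      then have "A i \<in> ?E" using A by (rule Pi_mem [rotated])
      then show "\<exists>a b. A i = {a<..<b}" by (auto simp: box_real)
    qed
    then obtain a b where ab: "\<And>i. i \<in> {..<d} \<Longrightarrow> A i = {a i<..<b i}" by metis
    have "X = Pi\<^sub>E {..<d} A" unfolding X set_eq_iff mem_Collect_eq PiE_iff by (simp add: conj_commute)
    also have "\<dots> = Pi\<^sub>E {..<d} (\<lambda>i. {a i<..<b i})" using ab by (rule PiE_cong)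
    finally have "X = Pi\<^sub>E {..<d} (\<lambda>i. {a i<..<b i})" .
    then show "X \<in> open_boxes d" by (simp only: open_boxesI)
  next
    fix X assume "X \<in> open_boxes d"
    then obtain a b where X: "X = Pi\<^sub>E {..<d} (\<lambda>i. {a i<..<b i})" unfolding open_boxes_def by blast
    have "X = {f \<in> Pi\<^sub>E {..<d} (\<lambda>_. UNIV). \<forall>i\<in>{..<d}. f i \<in> box (a i) (b i)}"
      unfolding X set_eq_iff mem_Collect_eq PiE_iff by (simp add: conj_commute)
    moreover have "(\<lambda>i. box (a i) (b i)) \<in> Pi {..<d} (\<lambda>_. ?E)" by (rule Pi_I) auto
    ultimately show "X \<in> ?L" unfolding mem_Collect_eq by (intro exI conjI) (assumption | rule singletonI)+
  qed
  also have "sets (sigma (Pi\<^sub>E {..<d} (\<lambda>_. UNIV)) (open_boxes d)) = sigma_sets (Rd d) (open_boxes d)"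
    using open_boxes_Rd unfolding Rd_def by (rule sets_measure_of)
  finally show ?thesis .
qed

context open_bounded
begin

lemma L2_integrable: "f \<in> L2 d \<Omega> \<Longrightarrow> integrable (vol d \<Omega>) f"
  using L2_mult_integrable [of f d \<Omega> "\<lambda>_. 1"] by (simp add: L2_def)

lemma test_L2:
  assumes "\<phi> \<in> test_functions d \<Omega>"
  shows "\<phi> \<in> L2 d \<Omega>" "i < d \<Longrightarrow> pd i \<phi> \<in> L2 d \<Omega>"
  using test_function_smooth [OF assms] smooth_continuous smooth_continuous_pd continuous_L2 by blast+

lemma sets_vol: "A \<in> sets (leb d) \<Longrightarrow> \<Omega> \<inter> A \<in> sets (vol d \<Omega>)"
  unfolding vol_def sets_restrict_space by blast

lemma indicator_measurable_vol:
  "A \<in> sets (leb d) \<Longrightarrow> (indicator A :: pt \<Rightarrow> real) \<in> borel_measurable (vol d \<Omega>)"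
  by (intro measurable_vol borel_measurable_indicator)

lemma integrable_indicator_mult:
  fixes f :: fn
  assumes "integrable (vol d \<Omega>) f" "A \<in> sets (leb d)"
  shows "integrable (vol d \<Omega>) (\<lambda>x. f x * indicator A x)"
proof (rule Bochner_Integration.integrable_bound [OF assms(1)])
  show "(\<lambda>x. f x * indicator A x) \<in> borel_measurable (vol d \<Omega>)"
    using assms indicator_measurable_vol by (intro borel_measurable_times) auto
qed (auto simp: indicator_def)

text \<open>Bump functions supported in the closed box lie between 0 and 1 and converge to the
  indicator of the open box; dominated convergence with majorant \<open>\<bar>f x\<bar>\<close> does
  the rest.\<close>

lemma box_integral_zero:
  assumes f: "integrable (vol d \<Omega>) f"
    and test: "\<And>\<phi>. \<phi> \<in> test_functions d \<Omega> \<Longrightarrow> (\<integral>x. f x * \<phi> x \<partial>vol d \<Omega>) = 0"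
    and sub: "Pi\<^sub>E {..<d} (\<lambda>i. {a i..b i}) \<subseteq> \<Omega>"
  shows "(\<integral>x. f x * indicator (Pi\<^sub>E {..<d} (\<lambda>i. {a i<..<b i})) x \<partial>vol d \<Omega>) = 0"
proof (cases "\<forall>i<d. a i < b i")
  case True
  define \<phi> where "\<phi> n x = (\<Prod>i<d. bump (interval_poly (a i) (b i) n) 1 0 (x i))" for n and x :: pt
  have \<phi>: "\<phi> n \<in> test_functions d \<Omega>" for n
    unfolding \<phi>_def using True sub by (intro box_bump_test_function) auto
  have \<phi>01: "0 \<le> \<phi> n x \<and> \<phi> n x \<le> 1" for n x
    unfolding \<phi>_def by (intro conjI prod_nonneg prod_le_1 ballI interval_bump_bounds)
  let ?Q = "Pi\<^sub>E {..<d} (\<lambda>i. {a i<..<b i})"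
  have lim: "(\<lambda>n. \<phi> n x) \<longlonglongrightarrow> indicator ?Q x" if "x \<in> \<Omega>" for x
  proof -
    have x: "x \<in> Rd d" using that sub_Rd by blast
    have "(\<lambda>n. \<phi> n x) \<longlonglongrightarrow> (\<Prod>i<d. indicator {a i<..<b i} (x i))"
      unfolding \<phi>_def using True by (intro tendsto_prod interval_bump_tendsto) auto
    moreover have "(\<Prod>i<d. indicator {a i<..<b i} (x i)) = (indicator ?Q x :: real)"
    proof (cases "x \<in> ?Q")
      case True
      then have "x i \<in> {a i<..<b i}" if "i \<in> {..<d}" for i using that by (rule PiE_mem)
      then show ?thesis using True by simp
    next
      case False
      then obtain i where "i \<in> {..<d}" "x i \<notin> {a i<..<b i}" using x unfolding Rd_def PiE_iff by blast
      then have "(\<Prod>i<d. indicator {a i<..<b i} (x i)) = (0 :: real)"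
        by (intro prod_zero) (auto intro!: bexI [of _ i])
      then show ?thesis using False by simp
    qed
    ultimately show ?thesis by simp
  qed
  have "(\<lambda>n. \<integral>x. f x * \<phi> n x \<partial>vol d \<Omega>) \<longlonglongrightarrow> (\<integral>x. f x * indicator ?Q x \<partial>vol d \<Omega>)"
  proof (rule integral_dominated_convergence [where w = "\<lambda>x. \<bar>f x\<bar>"])
    show "(\<lambda>x. f x * indicator ?Q x) \<in> borel_measurable (vol d \<Omega>)"
      using f by (intro borel_measurable_times indicator_measurable_vol) auto
    show "(\<lambda>x. f x * \<phi> n x) \<in> borel_measurable (vol d \<Omega>)" for n
      using f test_L2(1) [OF \<phi>] by (intro borel_measurable_times) (auto simp: L2_def)
    show "integrable (vol d \<Omega>) (\<lambda>x. \<bar>f x\<bar>)" using f by simp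
    show "AE x in vol d \<Omega>. (\<lambda>n. f x * \<phi> n x) \<longlonglongrightarrow> f x * indicator ?Q x"
      using lim by (intro AE_I2 tendsto_mult_left) (simp add: space_vol)
    show "AE x in vol d \<Omega>. norm (f x * \<phi> n x) \<le> \<bar>f x\<bar>" for n
    proof (intro AE_I2)
      fix x
      have "\<bar>f x\<bar> * \<bar>\<phi> n x\<bar> \<le> \<bar>f x\<bar> * 1" using \<phi>01 [of n x] by (intro mult_left_mono) auto
      then show "norm (f x * \<phi> n x) \<le> \<bar>f x\<bar>" by (simp add: abs_mult)
    qed
  qed
  then show ?thesis using test [OF \<phi>] by (simp add: LIMSEQ_const_iff)
next
  case False
  then have "Pi\<^sub>E {..<d} (\<lambda>i. {a i<..<b i}) = {}" by (auto simp: PiE_eq_empty_iff not_less)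
  then show ?thesis by simp
qed

text \<open>Dynkin's argument in \<open>S\<close>. Fixing one box whose closure lies in
  \<open>\<Omega>\<close> gives its intersection with any other open box the same property, so
  \<open>box_integral_zero\<close> applies on the generator.\<close>

lemma box_subset_integral_zero:
  assumes f: "integrable (vol d \<Omega>) f"
    and test: "\<And>\<phi>. \<phi> \<in> test_functions d \<Omega> \<Longrightarrow> (\<integral>x. f x * \<phi> x \<partial>vol d \<Omega>) = 0"
    and sub: "Pi\<^sub>E {..<d} (\<lambda>i. {a i..b i}) \<subseteq> \<Omega>" and S: "S \<in> sets (leb d)"
  shows "(\<integral>x. (f x * indicator (Pi\<^sub>E {..<d} (\<lambda>i. {a i<..<b i})) x) * indicator S x \<partial>vol d \<Omega>) = 0"
proof -
  let ?Q = "Pi\<^sub>E {..<d} (\<lambda>i. {a i<..<b i})"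
  let ?g = "\<lambda>x. f x * indicator ?Q x"
  have g: "integrable (vol d \<Omega>) ?g" using f by (intro integrable_indicator_mult) auto
  have gS: "integrable (vol d \<Omega>) (\<lambda>x. ?g x * indicator S x)" if "S \<in> sets (leb d)" for S
    using integrable_indicator_mult [OF g that] .
  have "Int_stable (open_boxes d)"
  proof (rule Int_stableI)
    fix A B assume "A \<in> open_boxes d" "B \<in> open_boxes d"
    then obtain a b a' b' where "A = Pi\<^sub>E {..<d} (\<lambda>i. {a i<..<b i})" "B = Pi\<^sub>E {..<d} (\<lambda>i. {a' i<..<b' i})"
      unfolding open_boxes_def by blast
    then have "A \<inter> B = Pi\<^sub>E {..<d} (\<lambda>i. {max (a i) (a' i)<..<min (b i) (b' i)})" by (simp only: box_Int)
    then show "A \<inter> B \<in> open_boxes d" by (simp only: open_boxesI)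
  qed
  moreover note open_boxes_Rd
  moreover have "S \<in> sigma_sets (Rd d) (open_boxes d)" using S by (simp add: sets_leb)
  ultimately show ?thesis
  proof (induction rule: sigma_sets_induct_disjoint)
    case (basic S)
    then obtain a' b' where S: "S = Pi\<^sub>E {..<d} (\<lambda>i. {a' i<..<b' i})" unfolding open_boxes_def by blast
    have "(\<lambda>x. ?g x * indicator S x)
        = (\<lambda>x. f x * indicator (Pi\<^sub>E {..<d} (\<lambda>i. {max (a i) (a' i)<..<min (b i) (b' i)})) x)"
      unfolding S mult.assoc indicator_inter_arith [symmetric] box_Int ..
    moreover have "Pi\<^sub>E {..<d} (\<lambda>i. {max (a i) (a' i)..min (b i) (b' i)}) \<subseteq> \<Omega>"
      by (rule subset_trans [OF PiE_mono sub]) auto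
    ultimately show ?case using box_integral_zero [OF f test] by simp
  next
    case empty
    then show ?case by simp
  next
    case (compl S)
    then have S: "S \<in> sets (leb d)" by (simp add: sets_leb)
    have "(\<integral>x. ?g x * indicator (Rd d - S) x \<partial>vol d \<Omega>) = (\<integral>x. ?g x - ?g x * indicator S x \<partial>vol d \<Omega>)"
      using sub_Rd by (intro Bochner_Integration.integral_cong) (auto simp: space_vol indicator_def)
    also have "\<dots> = (\<integral>x. ?g x \<partial>vol d \<Omega>) - (\<integral>x. ?g x * indicator S x \<partial>vol d \<Omega>)"
      by (rule Bochner_Integration.integral_diff [OF g gS [OF S]])
    also have "\<dots> = 0" using compl box_integral_zero [OF f test sub] by simp
    finally show ?case .
  next
    case (union A)
    then have A: "A i \<in> sets (leb d)" for i by (auto simp: sets_leb)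
    have "(LINT x:(\<Union>i. \<Omega> \<inter> A i)|vol d \<Omega>. ?g x) = (\<Sum>i. (LINT x:\<Omega> \<inter> A i|vol d \<Omega>. ?g x))"
    proof (rule lebesgue_integral_countable_add)
      show "\<Omega> \<inter> A i \<in> sets (vol d \<Omega>)" for i using A by (rule sets_vol)
      show "(\<Omega> \<inter> A i) \<inter> (\<Omega> \<inter> A j) = {}" if "i \<noteq> j" for i j
        using union(1) that by (auto simp: disjoint_family_on_def)
      show "set_integrable (vol d \<Omega>) (\<Union>i. \<Omega> \<inter> A i) ?g"
        unfolding set_integrable_def using g
        by (intro integrable_mult_indicator sets.countable_UN') (auto intro: sets_vol A)
    qed
    moreover have "(LINT x:\<Omega> \<inter> B|vol d \<Omega>. ?g x) = (\<integral>x. ?g x * indicator B x \<partial>vol d \<Omega>)" for B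
      unfolding set_lebesgue_integral_def
      by (intro Bochner_Integration.integral_cong) (auto simp: space_vol indicator_def)
    moreover have "(\<Union>i. \<Omega> \<inter> A i) = \<Omega> \<inter> (\<Union>i. A i)" by blast
    ultimately show ?case using union(3) by simp
  qed
qed

text \<open>With the set where \<open>f\<close> is positive as \<open>S\<close>, the integral of the
  positive part over the box is 0.\<close>

lemma AE_le_zero_on_box:
  assumes f: "integrable (vol d \<Omega>) f"
    and test: "\<And>\<phi>. \<phi> \<in> test_functions d \<Omega> \<Longrightarrow> (\<integral>x. f x * \<phi> x \<partial>vol d \<Omega>) = 0"
    and sub: "Pi\<^sub>E {..<d} (\<lambda>i. {a i..b i}) \<subseteq> \<Omega>"
  shows "AE x in vol d \<Omega>. x \<in> Pi\<^sub>E {..<d} (\<lambda>i. {a i<..<b i}) \<longrightarrow> f x \<le> 0"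
proof -
  let ?Q = "Pi\<^sub>E {..<d} (\<lambda>i. {a i<..<b i})"
  have fm [measurable]: "f \<in> borel_measurable (vol d \<Omega>)" using f by simp
  have "{x \<in> space (vol d \<Omega>). 0 < f x} \<in> sets (vol d \<Omega>)" by measurable
  then obtain S where S: "S \<in> sets (leb d)" "{x \<in> space (vol d \<Omega>). 0 < f x} = \<Omega> \<inter> S"
    unfolding vol_def sets_restrict_space by blast
  let ?g = "\<lambda>x. (f x * indicator ?Q x) * indicator S x"
  have Q: "?Q \<in> sets (leb d)" by auto
  have g: "integrable (vol d \<Omega>) ?g"
    using f Q S(1) by (intro integrable_indicator_mult)
  have mem: "x \<in> S \<longleftrightarrow> 0 < f x" if "x \<in> \<Omega>" for x using S(2) that by (auto simp: space_vol)
  have "AE x in vol d \<Omega>. 0 \<le> ?g x"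
    using mem by (intro AE_I2) (auto simp: space_vol indicator_def)
  then have "AE x in vol d \<Omega>. ?g x = 0"
    using integral_nonneg_eq_0_iff_AE [OF g] box_subset_integral_zero [OF f test sub S(1)] by simp
  then show ?thesis
  proof (rule AE_mp, intro AE_I2 impI)
    fix x assume x: "x \<in> space (vol d \<Omega>)" and g0: "?g x = 0" and xQ: "x \<in> ?Q"
    show "f x \<le> 0"
    proof (rule ccontr)
      assume pos: "\<not> f x \<le> 0"
      then have "x \<in> S" using mem [of x] x unfolding space_vol by linarith
      then have "?g x = f x" using xQ by (simp only: indicator_simps mult_1_right)
      then show False using g0 pos by linarith
    qed
  qed
qed

text \<open>The estimate on a box is used for \<open>f\<close> and for \<open>- f\<close>; the
  countably many rational boxes cover \<open>\<Omega>\<close>, so their exceptional null sets may be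
  united.\<close>

lemma AE_zero_if_test_zero:
  assumes f: "integrable (vol d \<Omega>) f"
    and test: "\<And>\<phi>. \<phi> \<in> test_functions d \<Omega> \<Longrightarrow> (\<integral>x. f x * \<phi> x \<partial>vol d \<Omega>) = 0"
  shows "AE x in vol d \<Omega>. f x = 0"
proof -
  let ?X = "{ab \<in> rational_boxes d. Pi\<^sub>E {..<d} (\<lambda>i. {fst ab i..snd ab i}) \<subseteq> \<Omega>}"
  have "AE x in vol d \<Omega>. \<forall>ab\<in>?X. x \<in> Pi\<^sub>E {..<d} (\<lambda>i. {fst ab i<..<snd ab i}) \<longrightarrow> f x = 0"
  proof (rule AE_ball_countable')
    show "countable ?X" by (rule countable_subset [OF _ countable_rational_boxes]) blast
    fix ab assume "ab \<in> ?X"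
    then have sub: "Pi\<^sub>E {..<d} (\<lambda>i. {fst ab i..snd ab i}) \<subseteq> \<Omega>" by blast
    have "AE x in vol d \<Omega>. x \<in> Pi\<^sub>E {..<d} (\<lambda>i. {fst ab i<..<snd ab i}) \<longrightarrow> f x \<le> 0"
      using f test sub by (rule AE_le_zero_on_box)
    moreover have "AE x in vol d \<Omega>. x \<in> Pi\<^sub>E {..<d} (\<lambda>i. {fst ab i<..<snd ab i}) \<longrightarrow> - f x \<le> 0"
      using f test sub by (intro AE_le_zero_on_box) auto
    ultimately show "AE x in vol d \<Omega>. x \<in> Pi\<^sub>E {..<d} (\<lambda>i. {fst ab i<..<snd ab i}) \<longrightarrow> f x = 0"
    proof eventually_elim
      case (elim x)
      then show ?case by (meson antisym neg_le_0_iff_le)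
    qed
  qed
  then show ?thesis
  proof (rule AE_mp, intro AE_I2 impI)
    fix x assume x: "x \<in> space (vol d \<Omega>)"
      and z: "\<forall>ab\<in>?X. x \<in> Pi\<^sub>E {..<d} (\<lambda>i. {fst ab i<..<snd ab i}) \<longrightarrow> f x = 0"
    have "x \<in> (\<Union>(a, b)\<in>{(a, b) \<in> rational_boxes d. Pi\<^sub>E {..<d} (\<lambda>i. {a i..b i}) \<subseteq> \<Omega>}.
      Pi\<^sub>E {..<d} (\<lambda>i. {a i<..<b i}))"
      using x openin_eq_Union_boxes [OF op] by (simp add: space_vol)
    then obtain a b where "(a, b) \<in> rational_boxes d" "Pi\<^sub>E {..<d} (\<lambda>i. {a i..b i}) \<subseteq> \<Omega>"
      "x \<in> Pi\<^sub>E {..<d} (\<lambda>i. {a i<..<b i})" by blast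
    then show "f x = 0" using bspec [OF z, of "(a, b)"] by simp
  qed
qed

section \<open>Weak gradients of linear combinations and of test functions\<close>

lemma weak_gradient_lin:
  assumes "u \<in> L2 d \<Omega>" "v \<in> L2 d \<Omega>" and wg: "weak_gradient d \<Omega> u g" "weak_gradient d \<Omega> v h"
  shows "weak_gradient d \<Omega> (\<lambda>x. r * u x + s * v x) (\<lambda>i x. r * g i x + s * h i x)"
  unfolding weak_gradient_def
proof (intro allI impI conjI ballI)
  fix i assume i: "i < d"
  then have gh: "g i \<in> L2 d \<Omega>" "h i \<in> L2 d \<Omega>" using wg by (auto simp: weak_gradient_def)
  then show "(\<lambda>x. r * g i x + s * h i x) \<in> L2 d \<Omega>" by (rule L2_lin)
  fix \<phi> assume \<phi>: "\<phi> \<in> test_functions d \<Omega>"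
  note int = L2_mult_integrable [OF assms(1) test_L2(2) [OF \<phi> i]] L2_mult_integrable [OF assms(2) test_L2(2) [OF \<phi> i]]
    L2_mult_integrable [OF gh(1) test_L2(1) [OF \<phi>]] L2_mult_integrable [OF gh(2) test_L2(1) [OF \<phi>]]
  have "(\<integral>x. (r * u x + s * v x) * pd i \<phi> x \<partial>vol d \<Omega>)
      = r * (\<integral>x. u x * pd i \<phi> x \<partial>vol d \<Omega>) + s * (\<integral>x. v x * pd i \<phi> x \<partial>vol d \<Omega>)"
    using int by (simp add: distrib_right mult.assoc)
  also have "\<dots> = - (r * (\<integral>x. g i x * \<phi> x \<partial>vol d \<Omega>) + s * (\<integral>x. h i x * \<phi> x \<partial>vol d \<Omega>))"
    using wg i \<phi> by (simp add: weak_gradient_def)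
  also have "\<dots> = - (\<integral>x. (r * g i x + s * h i x) * \<phi> x \<partial>vol d \<Omega>)"
    using int by (simp add: distrib_right mult.assoc)
  finally show "(\<integral>x. (r * u x + s * v x) * pd i \<phi> x \<partial>vol d \<Omega>)
    = - (\<integral>x. (r * g i x + s * h i x) * \<phi> x \<partial>vol d \<Omega>)" .
qed

lemma weak_gradient_unique:
  assumes wg: "weak_gradient d \<Omega> u g" "weak_gradient d \<Omega> u h" and i: "i < d"
  shows "AE x in vol d \<Omega>. g i x = h i x"
proof -
  have gh: "g i \<in> L2 d \<Omega>" "h i \<in> L2 d \<Omega>" using wg i by (auto simp: weak_gradient_def)
  have "AE x in vol d \<Omega>. g i x - h i x = 0"
  proof (rule AE_zero_if_test_zero)
    show "integrable (vol d \<Omega>) (\<lambda>x. g i x - h i x)" using L2_integrable gh by simp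
    fix \<phi> assume \<phi>: "\<phi> \<in> test_functions d \<Omega>"
    have "- (\<integral>x. g i x * \<phi> x \<partial>vol d \<Omega>) = - (\<integral>x. h i x * \<phi> x \<partial>vol d \<Omega>)"
      using wg i \<phi> unfolding weak_gradient_def by metis
    then show "(\<integral>x. (g i x - h i x) * \<phi> x \<partial>vol d \<Omega>) = 0"
      using L2_mult_integrable [OF gh(1) test_L2(1) [OF \<phi>]] L2_mult_integrable [OF gh(2) test_L2(1) [OF \<phi>]]
      by (simp add: left_diff_distrib)
  qed
  then show ?thesis by simp
qed

lemma H1_L2: "u \<in> H1 d \<Omega> \<Longrightarrow> u \<in> L2 d \<Omega>"
  by (simp add: H1_def)

lemma weak_gradient_grad: "u \<in> H1 d \<Omega> \<Longrightarrow> weak_gradient d \<Omega> u (grad d \<Omega> u)"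
  unfolding H1_def grad_def mem_Collect_eq by (elim conjE) (rule someI_ex [of "weak_gradient d \<Omega> u"])

lemma grad_L2: "u \<in> H1 d \<Omega> \<Longrightarrow> i < d \<Longrightarrow> grad d \<Omega> u i \<in> L2 d \<Omega>"
  using weak_gradient_grad by (auto simp: weak_gradient_def)

lemma H1_lin: "u \<in> H1 d \<Omega> \<Longrightarrow> v \<in> H1 d \<Omega> \<Longrightarrow> (\<lambda>x. r * u x + s * v x) \<in> H1 d \<Omega>"
  using L2_lin weak_gradient_lin unfolding H1_def by blast

text \<open>Each \<open>grad\<close> is chosen independently, so linearity can come only from
  uniqueness and holds only almost everywhere.\<close>

lemma grad_lin:
  assumes "u \<in> H1 d \<Omega>" "v \<in> H1 d \<Omega>"
  shows "AE x in vol d \<Omega>. \<forall>i<d. grad d \<Omega> (\<lambda>x. r * u x + s * v x) i x = r * grad d \<Omega> u i x + s * grad d \<Omega> v i x"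
proof -
  have "AE x in vol d \<Omega>. \<forall>i\<in>{..<d}. grad d \<Omega> (\<lambda>x. r * u x + s * v x) i x = r * grad d \<Omega> u i x + s * grad d \<Omega> v i x"
    using weak_gradient_unique [OF weak_gradient_grad [OF H1_lin [OF assms]]
        weak_gradient_lin [OF H1_L2 [OF assms(1)] H1_L2 [OF assms(2)]
          weak_gradient_grad [OF assms(1)] weak_gradient_grad [OF assms(2)]]]
    by (intro AE_ball_countable') auto
  then show ?thesis unfolding Ball_def lessThan_iff .
qed

text \<open>Both functions vanish outside \<open>\<Omega>\<close>, so the integral extends to the
  whole space. Fubini isolates direction \<open>i\<close>, and the fundamental theorem of calculus
  leaves boundary values that are 0.\<close>

lemma test_integration_by_parts:
  assumes \<phi>: "\<phi> \<in> test_functions d \<Omega>" and \<psi>: "\<psi> \<in> test_functions d \<Omega>" and i: "i < d"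
  shows "(\<integral>x. \<phi> x * pd i \<psi> x \<partial>vol d \<Omega>) = - (\<integral>x. pd i \<phi> x * \<psi> x \<partial>vol d \<Omega>)"
proof -
  note sm = test_function_smooth [OF \<phi>] test_function_smooth [OF \<psi>]
  let ?f = "\<lambda>x. \<phi> x * pd i \<psi> x + pd i \<phi> x * \<psi> x"
  note int = L2_mult_integrable [OF test_L2(1) [OF \<phi>] test_L2(2) [OF \<psi> i]]
    L2_mult_integrable [OF test_L2(2) [OF \<phi> i] test_L2(1) [OF \<psi>]]
  have out: "?f x = 0" "\<phi> x * \<psi> x = 0" if "x \<in> Rd d" "x \<notin> \<Omega>" for x
    using test_function_outside [OF \<phi> that] test_function_outside [OF \<psi> that] by auto
  obtain B where B: "0 < B" "\<And>x i. x \<in> \<Omega> \<Longrightarrow> i < d \<Longrightarrow> \<bar>x i\<bar> < B" by (rule dom_sub_box) (rule that)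
  have eq: "indicator \<Omega> x *\<^sub>R ?f x = ?f x" if "x \<in> space (leb d)" for x
    using out that by (auto simp: space_leb indicator_def)
  have fint: "integrable (vol d \<Omega>) ?f" using int by simp
  then have "integrable (leb d) (\<lambda>x. indicator \<Omega> x *\<^sub>R ?f x)"
    unfolding vol_def by (subst (asm) integrable_restrict_space [OF int_space])
  then have fleb: "integrable (leb d) ?f"
    using eq by (subst (asm) Bochner_Integration.integrable_cong [OF refl])
  have "integral\<^sup>L (vol d \<Omega>) ?f = (\<integral>x. indicator \<Omega> x *\<^sub>R ?f x \<partial>leb d)"
    unfolding vol_def by (rule integral_restrict_space [OF int_space])
  also have "\<dots> = integral\<^sup>L (leb d) ?f" using eq by (rule Bochner_Integration.integral_cong [OF refl])
  also have "\<dots> = 0"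
  proof -
    let ?I = "{..<d} - {i}"
    have ins: "insert i ?I = {..<d}" using i by auto
    have "integral\<^sup>L (Pi\<^sub>M (insert i ?I) (\<lambda>_. lborel)) ?f
        = (\<integral>x. (\<integral>y. ?f (x(i := y)) \<partial>lborel) \<partial>Pi\<^sub>M ?I (\<lambda>_. lborel))"
      by (rule lborel_product.product_integral_insert) (use fleb ins in auto)
    also have "\<dots> = (\<integral>x. (0 :: real) \<partial>Pi\<^sub>M ?I (\<lambda>_. lborel :: real measure))"
    proof (rule Bochner_Integration.integral_cong [OF refl])
      fix x :: pt assume "x \<in> space (Pi\<^sub>M ?I (\<lambda>_. lborel))"
      then have "x \<in> Pi\<^sub>E ?I (\<lambda>_. UNIV)" by (simp add: space_PiM)
      then have x: "x(i := t) \<in> Rd d" for t using i by (auto simp: Rd_def PiE_iff extensional_def)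
      let ?x = "x(i := 0)"
      have xx: "?x(i := t) = x(i := t)" for t by simp
      let ?F = "\<lambda>t. \<phi> (x(i := t)) * \<psi> (x(i := t))"
      have D: "(?F has_field_derivative ?f (x(i := t))) (at t)" for t
        using DERIV_mult [OF smooth_has_pd [OF sm(1) x [of 0] i, of t] smooth_has_pd [OF sm(2) x [of 0] i, of t]]
        by (simp add: algebra_simps)
      have C: "isCont (\<lambda>t. ?f (x(i := t))) t" for t
      proof -
        have "continuous_map (powertop_real {..<d}) euclideanreal ?f"
          by (intro continuous_map_add continuous_map_real_mult smooth_continuous sm smooth_continuous_pd i)
        then have "continuous_map euclideanreal euclideanreal (?f \<circ> (\<lambda>t. ?x(i := t)))"
          using continuous_map_upd [OF x i] by (rule continuous_map_compose [rotated])
        then show ?thesis by (simp add: o_def continuous_on_eq_continuous_at)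
      qed
      \<comment> \<open>The cube strictly contains \<open>\<Omega>\<close>, so the end points
        \<open>B\<close> and \<open>- B\<close> themselves are already outside.\<close>
      have zero: "?f (x(i := t)) = 0" "?F t = 0" if "B \<le> \<bar>t\<bar>" for t
      proof -
        have "x(i := t) \<notin> \<Omega>" using B(2) [of "x(i := t)" i] that i by auto
        then show "?f (x(i := t)) = 0" "?F t = 0" using out [OF x] by auto
      qed
      have "(\<integral>y. ?f (x(i := y)) \<partial>lborel) = (\<integral>y. ?f (x(i := y)) * indicator {-B..B} y \<partial>lborel)"
      proof (rule Bochner_Integration.integral_cong [OF refl])
        fix y
        show "?f (x(i := y)) = ?f (x(i := y)) * indicator {-B..B} y"
          using zero(1) [of y] by (cases "y \<in> {-B..B}") auto
      qed
      also have "\<dots> = ?F B - ?F (-B)"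
        using B(1) by (intro integral_FTC_Icc_real D C) linarith
      also have "\<dots> = 0"
      proof -
        have "?F B = 0" "?F (-B) = 0" using B(1) by (intro zero(2); simp)+
        then show ?thesis by linarith
      qed
      finally show "(\<integral>y. ?f (x(i := y)) \<partial>lborel) = 0" .
    qed
    finally show ?thesis unfolding ins by simp
  qed
  finally show ?thesis using int by simp
qed

lemma test_H1: "\<phi> \<in> test_functions d \<Omega> \<Longrightarrow> \<phi> \<in> H1 d \<Omega>"
  unfolding H1_def weak_gradient_def
  by (intro CollectI conjI exI [of _ "\<lambda>i. pd i \<phi>"] allI impI ballI test_L2 test_integration_by_parts)

end


section \<open>Bilinear forms on spaces of functions\<close>

locale function_space =
  fixes V :: "('a \<Rightarrow> real) set"
  assumes lin: "\<And>u v r s. u \<in> V \<Longrightarrow> v \<in> V \<Longrightarrow> (\<lambda>x. r * u x + s * v x) \<in> V"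
    and zero: "(\<lambda>_. 0) \<in> V"
begin

lemma add: "u \<in> V \<Longrightarrow> v \<in> V \<Longrightarrow> (\<lambda>x. u x + v x) \<in> V"
  using lin [of u v 1 1] by simp

lemma diff: "u \<in> V \<Longrightarrow> v \<in> V \<Longrightarrow> (\<lambda>x. u x - v x) \<in> V"
  using lin [of u v 1 "-1"] by simp

lemma scale: "u \<in> V \<Longrightarrow> (\<lambda>x. r * u x) \<in> V"
  using lin [of u u r 0] by simp

lemma sum: "(\<And>k. k \<in> K \<Longrightarrow> w k \<in> V) \<Longrightarrow> (\<lambda>x. \<Sum>k\<in>K. c k * w k x) \<in> V"
proof (induction K rule: infinite_finite_induct)
  case (insert k K)
  then have "(\<lambda>x. c k * w k x + (\<Sum>k\<in>K. c k * w k x)) \<in> V" by (intro add scale) auto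
  then show ?case using insert by simp
qed (auto intro: zero)

end

locale bilinear_on = function_space V for V :: "('a \<Rightarrow> real) set" +
  fixes F :: "('a \<Rightarrow> real) \<Rightarrow> ('a \<Rightarrow> real) \<Rightarrow> real"
  assumes lin_left: "\<And>u v w r s. u \<in> V \<Longrightarrow> v \<in> V \<Longrightarrow> w \<in> V \<Longrightarrow>
      F (\<lambda>x. r * u x + s * v x) w = r * F u w + s * F v w"
    and lin_right: "\<And>u v w r s. u \<in> V \<Longrightarrow> v \<in> V \<Longrightarrow> w \<in> V \<Longrightarrow>
      F w (\<lambda>x. r * u x + s * v x) = r * F w u + s * F w v"
begin

lemma zero_left: "w \<in> V \<Longrightarrow> F (\<lambda>_. 0) w = 0"
  using lin_left [of w w w 0 0] by simp

lemma zero_right: "w \<in> V \<Longrightarrow> F w (\<lambda>_. 0) = 0"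
  using lin_right [of w w w 0 0] by simp

lemma add_left: "u \<in> V \<Longrightarrow> v \<in> V \<Longrightarrow> w \<in> V \<Longrightarrow> F (\<lambda>x. u x + v x) w = F u w + F v w"
  using lin_left [of u v w 1 1] by simp

lemma add_right: "u \<in> V \<Longrightarrow> v \<in> V \<Longrightarrow> w \<in> V \<Longrightarrow> F w (\<lambda>x. u x + v x) = F w u + F w v"
  using lin_right [of u v w 1 1] by simp

lemma diff_left: "u \<in> V \<Longrightarrow> v \<in> V \<Longrightarrow> w \<in> V \<Longrightarrow> F (\<lambda>x. u x - v x) w = F u w - F v w"
  using lin_left [of u v w 1 "-1"] by simp

lemma diff_right: "u \<in> V \<Longrightarrow> v \<in> V \<Longrightarrow> w \<in> V \<Longrightarrow> F w (\<lambda>x. u x - v x) = F w u - F w v"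
  using lin_right [of u v w 1 "-1"] by simp

lemma scale_left: "u \<in> V \<Longrightarrow> w \<in> V \<Longrightarrow> F (\<lambda>x. r * u x) w = r * F u w"
  using lin_left [of u u w r 0] by simp

lemma scale_right: "u \<in> V \<Longrightarrow> w \<in> V \<Longrightarrow> F w (\<lambda>x. r * u x) = r * F w u"
  using lin_right [of u u w r 0] by simp

lemma sum_left:
  assumes "w \<in> V" "\<And>k. k \<in> K \<Longrightarrow> u k \<in> V"
  shows "F (\<lambda>x. \<Sum>k\<in>K. c k * u k x) w = (\<Sum>k\<in>K. c k * F (u k) w)"
  using assms(2)
proof (induction K rule: infinite_finite_induct)
  case (insert k K)
  have "F (\<lambda>x. c k * u k x + (\<Sum>k\<in>K. c k * u k x)) w = c k * F (u k) w + F (\<lambda>x. \<Sum>k\<in>K. c k * u k x) w"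
    using insert.prems assms(1) by (simp add: add_left scale sum scale_left)
  then show ?case using insert by simp
qed (auto simp: zero_left assms)

lemma sum_right:
  assumes "w \<in> V" "\<And>k. k \<in> K \<Longrightarrow> u k \<in> V"
  shows "F w (\<lambda>x. \<Sum>k\<in>K. c k * u k x) = (\<Sum>k\<in>K. c k * F w (u k))"
  using assms(2)
proof (induction K rule: infinite_finite_induct)
  case (insert k K)
  have "F w (\<lambda>x. c k * u k x + (\<Sum>k\<in>K. c k * u k x)) = c k * F w (u k) + F w (\<lambda>x. \<Sum>k\<in>K. c k * u k x)"
    using insert.prems assms(1) by (simp add: add_right scale sum scale_right)
  then show ?case using insert by simp
qed (auto simp: zero_right assms)

end

text \<open>Only semidefinite: functions that vanish almost everywhere can have norm 0 without being
  the zero function.\<close>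

locale semi_inner_on = bilinear_on V F for V :: "('a \<Rightarrow> real) set" and F +
  assumes sym: "\<And>u v. u \<in> V \<Longrightarrow> v \<in> V \<Longrightarrow> F u v = F v u"
    and nonneg: "\<And>u. u \<in> V \<Longrightarrow> 0 \<le> F u u"
begin

abbreviation nrm :: "('a \<Rightarrow> real) \<Rightarrow> real"
  where "nrm u \<equiv> sqrt (F u u)"

lemma nrm_nonneg: "u \<in> V \<Longrightarrow> 0 \<le> nrm u"
  by (simp add: nonneg)

lemma form_lin: "u \<in> V \<Longrightarrow> v \<in> V \<Longrightarrow>
  F (\<lambda>x. r * u x + s * v x) (\<lambda>x. r * u x + s * v x) = r\<^sup>2 * F u u + 2 * r * s * F u v + s\<^sup>2 * F v v"
  using sym [of u v] by (simp add: lin_left lin_right lin power2_eq_square algebra_simps)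

lemma Cauchy_Schwarz:
  assumes u: "u \<in> V" and v: "v \<in> V"
  shows "\<bar>F u v\<bar> \<le> nrm u * nrm v"
proof -
  have ge: "0 \<le> r\<^sup>2 * F u u + 2 * r * s * F u v + s\<^sup>2 * F v v" for r s
    using nonneg [OF lin [OF u v, of r s]] form_lin [OF u v, of r s] by simp
  have "(F u v)\<^sup>2 \<le> F u u * F v v"
  proof (cases "F v v = 0")
    case True
    have "F u v = 0"
    proof (rule ccontr)
      assume "F u v \<noteq> 0"
      \<comment> \<open>For \<open>F v v = 0\<close> the quadratic is affine in \<open>s\<close>,
        and this \<open>s\<close> gives it the value -1.\<close>
      then show False using ge [of 1 "- (F u u + 1) / (2 * F u v)"] True by (simp add: field_simps)
    qed
    then show ?thesis using True by simp
  next
    case False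
    then have pos: "0 < F v v" using nonneg [OF v] by simp
    have "0 \<le> F v v * (F v v * F u u - (F u v)\<^sup>2)"
      using ge [of "F v v" "- F u v"] by (simp add: power2_eq_square algebra_simps)
    then show ?thesis using pos by (simp add: zero_le_mult_iff mult.commute)
  qed
  then have "sqrt ((F u v)\<^sup>2) \<le> sqrt (F u u * F v v)" by (rule real_sqrt_le_mono)
  then show ?thesis by (simp add: real_sqrt_mult)
qed

lemma nrm_lin_le:
  assumes u: "u \<in> V" and v: "v \<in> V"
  shows "nrm (\<lambda>x. r * u x + s * v x) \<le> \<bar>r\<bar> * nrm u + \<bar>s\<bar> * nrm v"
proof (rule real_le_lsqrt)
  show "0 \<le> \<bar>r\<bar> * nrm u + \<bar>s\<bar> * nrm v" using nonneg u v by simp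
  have "r * s * F u v \<le> \<bar>r\<bar> * \<bar>s\<bar> * \<bar>F u v\<bar>" by (metis abs_ge_self abs_mult)
  also have "\<dots> \<le> \<bar>r\<bar> * \<bar>s\<bar> * (nrm u * nrm v)"
    using Cauchy_Schwarz [OF u v] by (intro mult_left_mono) auto
  finally have "r * s * F u v \<le> \<bar>r\<bar> * \<bar>s\<bar> * (nrm u * nrm v)" .
  moreover have "(\<bar>r\<bar> * nrm u + \<bar>s\<bar> * nrm v)\<^sup>2
      = r\<^sup>2 * F u u + 2 * (\<bar>r\<bar> * \<bar>s\<bar> * (nrm u * nrm v)) + s\<^sup>2 * F v v"
    using nonneg [OF u] nonneg [OF v] by (simp add: power2_sum power_mult_distrib)
  ultimately show "F (\<lambda>x. r * u x + s * v x) (\<lambda>x. r * u x + s * v x) \<le> (\<bar>r\<bar> * nrm u + \<bar>s\<bar> * nrm v)\<^sup>2"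
    using form_lin [OF u v, of r s] by simp
qed

lemma nrm_triangle: "u \<in> V \<Longrightarrow> v \<in> V \<Longrightarrow> nrm (\<lambda>x. u x + v x) \<le> nrm u + nrm v"
  using nrm_lin_le [of u v 1 1] by simp

lemma nrm_diff_triangle:
  assumes "u \<in> V" "v \<in> V" "w \<in> V"
  shows "nrm (\<lambda>x. u x - w x) \<le> nrm (\<lambda>x. u x - v x) + nrm (\<lambda>x. v x - w x)"
  using nrm_triangle [OF diff [OF assms(1,2)] diff [OF assms(2,3)]] by simp

lemma nrm_diff_commute:
  assumes "u \<in> V" "v \<in> V"
  shows "nrm (\<lambda>x. u x - v x) = nrm (\<lambda>x. v x - u x)"
proof -
  have "F (\<lambda>x. v x - u x) (\<lambda>x. v x - u x) = F (\<lambda>x. u x - v x) (\<lambda>x. u x - v x)"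
    using assms by (simp add: diff_left diff_right diff)
  then show ?thesis by simp
qed

end


section \<open>Generalized quasi-orthogonality of Galerkin approximations\<close>

locale elliptic_forms = a: semi_inner_on X a + b: bilinear_on X b
  for X :: "('a \<Rightarrow> real) set" and a b +
  fixes \<alpha> L :: real
  assumes \<alpha>: "0 < \<alpha>" "\<alpha> \<le> L"
    and elliptic: "\<And>u. u \<in> X \<Longrightarrow> \<alpha> * (a.nrm u)\<^sup>2 \<le> b u u"
    and continuous: "\<And>u v. u \<in> X \<Longrightarrow> v \<in> X \<Longrightarrow> \<bar>b u v\<bar> \<le> L * a.nrm u * a.nrm v"
begin

abbreviation "C \<equiv> L / \<alpha>"

lemma C_ge_1: "1 \<le> C"
  using \<alpha> by simp

text \<open>Galerkin orthogonality allows \<open>v - p\<close> to be exchanged in the second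
  argument of \<open>b\<close>. The lemma is used with the exact solution as \<open>u\<close>, and
  inside a finite sequence of spaces with the last Galerkin solution in that role.\<close>

lemma Cea:
  assumes V: "function_space V" "V \<subseteq> X" and u: "u \<in> X" and p: "p \<in> V" and v: "v \<in> V"
    and gal: "\<And>w. w \<in> V \<Longrightarrow> b p w = b u w"
  shows "a.nrm (\<lambda>x. u x - p x) \<le> C * a.nrm (\<lambda>x. u x - v x)"
proof -
  let ?e = "\<lambda>x. u x - p x" and ?f = "\<lambda>x. u x - v x" and ?w = "\<lambda>x. v x - p x"
  have w: "?w \<in> V" using function_space.diff [OF V(1) v p] .
  have X: "?e \<in> X" "?f \<in> X" "?w \<in> X" "p \<in> X" using u p v w V(2) by (auto intro: a.diff)
  have "b ?e ?w = 0" using gal [OF w] X u by (simp add: b.diff_left)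
  then have "b ?e ?f = b ?e ?e"
    using b.add_right [OF X(2) X(3) X(1)] b.add_right [of ?f ?w ?e] b.diff_right [of ?e ?w ?e] X by simp
  then have "\<alpha> * (a.nrm ?e)\<^sup>2 \<le> L * a.nrm ?e * a.nrm ?f"
    using elliptic [OF X(1)] continuous [OF X(1,2)] by linarith
  then have le: "a.nrm ?e * (\<alpha> * a.nrm ?e) \<le> a.nrm ?e * (L * a.nrm ?f)"
    by (simp only: power2_eq_square mult_ac)
  show ?thesis
  proof (cases "a.nrm ?e = 0")
    case True
    then show ?thesis using a.nrm_nonneg [OF X(2)] \<alpha> by simp
  next
    case False
    then have "0 < a.nrm ?e" using a.nrm_nonneg [OF X(1)] by linarith
    then have "\<alpha> * a.nrm ?e \<le> L * a.nrm ?f" using le by (simp only: mult_le_cancel_left_pos)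
    then show ?thesis using \<alpha> by (simp add: field_simps)
  qed
qed

end

text \<open>The last Galerkin solution \<open>p n\<close> takes the role of the exact one, so only
  finitely many levels enter and the error \<open>e n\<close> vanishes.\<close>

locale galerkin_sequence = elliptic_forms X a b \<alpha> L
  for X :: "('a \<Rightarrow> real) set" and a b \<alpha> L +
  fixes V :: "nat \<Rightarrow> ('a \<Rightarrow> real) set" and p :: "nat \<Rightarrow> 'a \<Rightarrow> real" and n :: nat
  assumes n: "1 \<le> n"
    and V: "\<And>k. k \<le> n \<Longrightarrow> function_space (V k)" "\<And>k. k \<le> n \<Longrightarrow> V k \<subseteq> X"
    and mono: "\<And>k. k < n \<Longrightarrow> V k \<subseteq> V (Suc k)"
    and p: "\<And>k. k \<le> n \<Longrightarrow> p k \<in> V k"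
    and gal: "\<And>k v. k \<le> n \<Longrightarrow> v \<in> V k \<Longrightarrow> b (p k) v = b (p n) v"
begin

definition d :: "nat \<Rightarrow> 'a \<Rightarrow> real"
  where "d k = (\<lambda>x. p (Suc k) x - p k x)"

definition e :: "nat \<Rightarrow> 'a \<Rightarrow> real"
  where "e k = (\<lambda>x. p n x - p k x)"

definition W :: "(nat \<Rightarrow> real) \<Rightarrow> 'a \<Rightarrow> real"
  where "W c = (\<lambda>x. \<Sum>k<n. c k * d k x)"

lemma nested: "i \<le> j \<Longrightarrow> j \<le> n \<Longrightarrow> V i \<subseteq> V j"
  by (induction j rule: dec_induct) (use mono in \<open>auto dest: Suc_le_lessD\<close>)

lemma pX: "k \<le> n \<Longrightarrow> p k \<in> X"
  using p V by blast

lemma dV: "k < n \<Longrightarrow> d k \<in> V (Suc k)"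
  unfolding d_def using p [of k] p [of "Suc k"] mono [of k] V(1) [of "Suc k"]
  by (intro function_space.diff) auto

lemma dX: "k < n \<Longrightarrow> d k \<in> X"
  using dV [of k] V(2) [of "Suc k"] by auto

lemma eX: "k \<le> n \<Longrightarrow> e k \<in> X"
  unfolding e_def by (intro a.diff pX) auto

lemma WX: "W c \<in> X"
  unfolding W_def using dX by (intro a.sum) auto

text \<open>Both Galerkin solutions in \<open>d k\<close> agree with \<open>p n\<close> when tested
  in \<open>V k\<close>, and the earlier increment \<open>d j\<close> lies in \<open>V k\<close>.
  The transposed products carry no such orthogonality.\<close>

lemma triangular: "j < k \<Longrightarrow> k < n \<Longrightarrow> b (d k) (d j) = 0"
proof -
  assume jk: "j < k" "k < n"
  have dj: "d j \<in> V k" "d j \<in> V (Suc k)"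
    using dV [of j] nested [of "Suc j" k] nested [of "Suc j" "Suc k"] jk by auto
  have "b (d k) (d j) = b (p (Suc k)) (d j) - b (p k) (d j)"
    unfolding d_def [of k] using jk by (intro b.diff_left pX dX) auto
  then show ?thesis using gal [of "Suc k" "d j"] gal [of k "d j"] dj jk by simp
qed

lemma e_bound: "k \<le> n \<Longrightarrow> a.nrm (e k) \<le> C * a.nrm (e 0)"
  unfolding e_def
  by (rule Cea [of "V k"]) (use V pX p gal nested [of 0 k] in auto)

lemma b_W: "b (W c) (W c') = (\<Sum>k<n. \<Sum>j<n. c k * c' j * b (d k) (d j))"
proof -
  have "b (W c) (W c') = (\<Sum>k<n. c k * b (d k) (W c'))"
    unfolding W_def [of c] using dX WX by (intro b.sum_left) auto
  also have "\<dots> = (\<Sum>k<n. c k * (\<Sum>j<n. c' j * b (d k) (d j)))"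
    unfolding W_def using dX by (intro sum.cong refl arg_cong2 [where f = "(*)"] b.sum_right) auto
  finally show ?thesis by (simp add: sum_distrib_left mult.assoc)
qed

lemma sum_triangular:
  "(\<Sum>k<n. \<Sum>j<n. f k j * b (d k) (d j)) = (\<Sum>k<n. \<Sum>j\<in>{k..<n}. f k j * b (d k) (d j))"
proof (rule sum.cong [OF refl])
  fix k assume "k \<in> {..<n}"
  then show "(\<Sum>j<n. f k j * b (d k) (d j)) = (\<Sum>j\<in>{k..<n}. f k j * b (d k) (d j))"
    using triangular [of _ k] by (intro sum.mono_neutral_right) auto
qed

text \<open>Summation by parts: the \<open>e k\<close> are bounded by Cea's lemma, so only the variation of \<open>c\<close> enters.\<close>

lemma W_bound:
  "a.nrm (W c) \<le> C * a.nrm (e 0) * (\<bar>c 0\<bar> + (\<Sum>k<n. \<bar>c (Suc k) - c k\<bar>))"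
proof -
  let ?K = "C * a.nrm (e 0)"
  \<comment> \<open>An interpolation between \<open>c 0 * e 0\<close> for \<open>m = 0\<close> and
    \<open>W c\<close> for \<open>m = n\<close>, where \<open>e n\<close> is 0. One step adds only
    \<open>(c (Suc m) - c m) * e (Suc m)\<close>.\<close>
  define S where "S m = (\<lambda>x. (\<Sum>k<m. c k * d k x) + c m * e m x)" for m
  have SX: "S m \<in> X" if "m \<le> n" for m
    unfolding S_def using that dX eX by (intro a.add a.sum a.scale) auto
  have "a.nrm (S m) \<le> ?K * (\<bar>c 0\<bar> + (\<Sum>k<m. \<bar>c (Suc k) - c k\<bar>))" if "m \<le> n" for m
    using that
  proof (induction m)
    case 0
    have "a.nrm (S 0) \<le> \<bar>c 0\<bar> * a.nrm (e 0)"
      using a.nrm_lin_le [OF eX eX, of 0 0 "c 0" 0] by (simp add: S_def)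
    also have "\<dots> \<le> \<bar>c 0\<bar> * ?K" using e_bound [of 0] by (intro mult_left_mono) auto
    finally show ?case by (simp add: mult.commute)
  next
    case (Suc m)
    have "S (Suc m) = (\<lambda>x. 1 * S m x + (c (Suc m) - c m) * e (Suc m) x)"
      by (auto simp: S_def d_def e_def algebra_simps)
    then have "a.nrm (S (Suc m)) \<le> 1 * a.nrm (S m) + \<bar>c (Suc m) - c m\<bar> * a.nrm (e (Suc m))"
      using a.nrm_lin_le [OF SX [of m] eX [of "Suc m"], of 1 "c (Suc m) - c m"] Suc.prems by simp
    also have "\<dots> \<le> ?K * (\<bar>c 0\<bar> + (\<Sum>k<m. \<bar>c (Suc k) - c k\<bar>)) + \<bar>c (Suc m) - c m\<bar> * ?K"
      using Suc e_bound [of "Suc m"] by (intro add_mono mult_left_mono) auto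
    finally show ?case by (simp add: algebra_simps)
  qed
  moreover have "S n = W c" by (simp add: S_def W_def e_def)
  ultimately show ?thesis by force
qed

text \<open>The generating function of the products \<open>b (d k) (d j)\<close>; its value at 0 is the sum of the
  diagonal terms. On the unit circle it takes values in the numerical range of \<open>b\<close>, which is contained
  in a sector.\<close>

definition h :: "complex \<Rightarrow> complex"
  where "h z = (\<Sum>k<n. \<Sum>j\<in>{k..<n}. of_real (b (d k) (d j)) * z ^ (j - k))"

lemma h_0: "h 0 = of_real (\<Sum>k<n. b (d k) (d k))"
proof -
  have "(\<Sum>j\<in>{k..<n}. of_real (b (d k) (d j)) * 0 ^ (j - k)) = complex_of_real (b (d k) (d k))"
    if "k < n" for k
  proof -
    have "(\<Sum>j\<in>{k..<n}. of_real (b (d k) (d j)) * 0 ^ (j - k))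
        = (\<Sum>j\<in>{k}. complex_of_real (b (d k) (d j)) * 0 ^ (j - k))"
      using that by (intro sum.mono_neutral_right) auto
    then show ?thesis by simp
  qed
  then show ?thesis by (simp add: h_def)
qed

text \<open>Inside the disc the weights of the two arguments are reciprocal instead of conjugate, so
  the value leaves the numerical range but is still a single product, which continuity bounds. The
  entries with \<open>j < k\<close> vanish, hence the full double sum may be taken.\<close>

lemma h_real:
  assumes "0 < r"
  shows "h (of_real r) = of_real (b (W (\<lambda>k. (1 / r) ^ k)) (W (\<lambda>j. r ^ j)))"
proof -
  have "b (W (\<lambda>k. (1 / r) ^ k)) (W (\<lambda>j. r ^ j))
      = (\<Sum>k<n. \<Sum>j\<in>{k..<n}. (1 / r) ^ k * r ^ j * b (d k) (d j))"
    unfolding b_W by (rule sum_triangular)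
  also have "\<dots> = (\<Sum>k<n. \<Sum>j\<in>{k..<n}. b (d k) (d j) * r ^ (j - k))"
    using assms by (intro sum.cong refl) (simp add: power_diff power_one_over field_simps)
  finally show ?thesis by (simp add: h_def)
qed

text \<open>On the circle \<open>z ^ (j - k)\<close> is \<open>z ^ j\<close> times the conjugate of
  \<open>z ^ k\<close>. Thus \<open>h z\<close> is the complexified form at one complex element,
  with the cosine and sine combinations \<open>W\<close> as its real and imaginary parts.\<close>

lemma h_circle:
  assumes "norm z = 1"
  shows "\<bar>Im (h z)\<bar> \<le> C * Re (h z)" "0 \<le> Re (h z)"
proof -
  obtain t where t: "z = cis t"
    using assms by (metis cis_Arg norm_eq_zero sgn_eq div_by_1 of_real_1 zero_neq_one)
  let ?c = "\<lambda>k. cos (real k * t)" and ?s = "\<lambda>k. sin (real k * t)"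
  have zp: "z ^ (j - k) = Complex (?c k * ?c j + ?s k * ?s j) (?c k * ?s j - ?s k * ?c j)" if "k \<le> j" for k j
  proof -
    have "z ^ (j - k) = cis (real j * t - real k * t)"
      unfolding t Complex.DeMoivre using that by (simp add: of_nat_diff left_diff_distrib)
    then show ?thesis by (simp add: complex_eq_iff cos_diff sin_diff mult.commute)
  qed
  have "Re (h z) = (\<Sum>k<n. \<Sum>j\<in>{k..<n}. (?c k * ?c j + ?s k * ?s j) * b (d k) (d j))"
    unfolding h_def Re_sum by (intro sum.cong refl) (simp add: zp mult.commute)
  also have "\<dots> = (\<Sum>k<n. \<Sum>j<n. (?c k * ?c j + ?s k * ?s j) * b (d k) (d j))"
    by (rule sum_triangular [symmetric])
  also have "\<dots> = b (W ?c) (W ?c) + b (W ?s) (W ?s)"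
    unfolding b_W by (simp add: sum.distrib distrib_right)
  finally have Re: "Re (h z) = b (W ?c) (W ?c) + b (W ?s) (W ?s)" .
  have "Im (h z) = (\<Sum>k<n. \<Sum>j\<in>{k..<n}. (?c k * ?s j - ?s k * ?c j) * b (d k) (d j))"
    unfolding h_def Im_sum by (intro sum.cong refl) (simp add: zp mult.commute)
  also have "\<dots> = (\<Sum>k<n. \<Sum>j<n. (?c k * ?s j - ?s k * ?c j) * b (d k) (d j))"
    by (rule sum_triangular [symmetric])
  also have "\<dots> = b (W ?c) (W ?s) - b (W ?s) (W ?c)"
    unfolding b_W by (simp add: sum_subtractf left_diff_distrib)
  finally have Im: "Im (h z) = b (W ?c) (W ?s) - b (W ?s) (W ?c)" .
  let ?x = "a.nrm (W ?c)" and ?y = "a.nrm (W ?s)"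
  have ell: "\<alpha> * (?x\<^sup>2 + ?y\<^sup>2) \<le> Re (h z)"
    unfolding Re distrib_left by (intro add_mono elliptic WX)
  moreover have "0 \<le> \<alpha> * (?x\<^sup>2 + ?y\<^sup>2)" using \<alpha> by simp
  ultimately show "0 \<le> Re (h z)" by linarith
  have "\<bar>Im (h z)\<bar> \<le> L * ?x * ?y + L * ?y * ?x"
    unfolding Im using continuous [OF WX WX, of ?c ?s] continuous [OF WX WX, of ?s ?c] by linarith
  also have "\<dots> = L * (2 * ?x * ?y)" by simp
  also have "\<dots> \<le> L * (?x\<^sup>2 + ?y\<^sup>2)"
    using \<alpha> sum_squares_bound [of ?x ?y] by (intro mult_left_mono) auto
  also have "\<dots> = C * (\<alpha> * (?x\<^sup>2 + ?y\<^sup>2))" using \<alpha> by simp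
  also have "\<dots> \<le> C * Re (h z)" using ell \<alpha> by (intro mult_left_mono) auto
  finally show "\<bar>Im (h z)\<bar> \<le> C * Re (h z)" .
qed

theorem quasi_orthogonality:
  "(\<Sum>k<n. (a.nrm (d k))\<^sup>2)
    \<le> 4 * C ^ 3 * 4 powr sector_exponent C * real n powr sector_exponent C * (a.nrm (e 0))\<^sup>2"
proof -
  let ?\<gamma> = "sector_exponent C"
  have \<gamma>: "0 < ?\<gamma>" using sector_exponent_bounds [of C] C_ge_1 by simp
  \<comment> \<open>The distance \<open>1 / (2n)\<close> to the circle balances two demands: the
    Harnack factor is at most \<open>4n\<close>, and \<open>r ^ n \<ge> 1/2\<close>, by Bernoulli's
    inequality, bounds the variation of both weights by a constant.\<close>
  define r where "r = 1 - 1 / (2 * real n)"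
  have r: "0 < r" "r < 1" "1 / 2 \<le> r" using n by (auto simp: r_def field_simps)
  have rn: "1 / 2 \<le> r ^ n"
    using Bernoulli_inequality [of "- (1 / (2 * real n))" n] n by (simp add: r_def field_simps)
  let ?D = "\<Sum>k<n. b (d k) (d k)"
  have "?D \<le> ((1 + r) / (1 - r)) powr ?\<gamma> * norm (h (of_real r))"
  proof (rule Harnack_sector)
    show "h holomorphic_on UNIV" unfolding h_def by (intro holomorphic_intros)
    show "0 \<le> C" using C_ge_1 by simp
  qed (use h_circle h_0 r in auto)
  also have "\<dots> \<le> (4 * real n) powr ?\<gamma> * norm (h (of_real r))"
  proof (intro mult_right_mono powr_mono2)
    show "(1 + r) / (1 - r) \<le> 4 * real n"
      using n by (simp add: r_def field_simps)
  qed (use \<gamma> r in auto)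
  also have "norm (h (of_real r)) \<le> L * (2 * (C * a.nrm (e 0))) * (2 * (C * a.nrm (e 0)))"
  proof -
    let ?K = "C * a.nrm (e 0)"
    have K: "0 \<le> ?K" using C_ge_1 a.nrm_nonneg [OF eX [of 0]] by (intro mult_nonneg_nonneg) linarith+
    have "a.nrm (W (\<lambda>k. (1 / r) ^ k)) \<le> ?K * (\<bar>(1 / r) ^ 0\<bar> + (\<Sum>k<n. \<bar>(1 / r) ^ Suc k - (1 / r) ^ k\<bar>))"
      by (rule W_bound)
    also have "(\<Sum>k<n. \<bar>(1 / r) ^ Suc k - (1 / r) ^ k\<bar>) = (\<Sum>k<n. (1 / r) ^ Suc k - (1 / r) ^ k)"
    proof (intro sum.cong refl abs_of_nonneg)
      fix k
      have "(1 / r) ^ k \<le> (1 / r) ^ Suc k" using r by (intro power_increasing) auto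
      then show "0 \<le> (1 / r) ^ Suc k - (1 / r) ^ k" by linarith
    qed
    also have "\<dots> = (1 / r) ^ n - 1" by (simp only: sum_lessThan_telescope power_0)
    also have "\<bar>(1 / r) ^ 0\<bar> + ((1 / r) ^ n - 1) = 1 / r ^ n" by (simp add: power_one_over)
    also have "?K * (1 / r ^ n) \<le> ?K * 2"
      using rn K r by (intro mult_left_mono) (auto simp: field_simps)
    finally have 1: "a.nrm (W (\<lambda>k. (1 / r) ^ k)) \<le> 2 * ?K" by (simp only: mult.commute [of _ 2])
    have "a.nrm (W (\<lambda>k. r ^ k)) \<le> ?K * (\<bar>r ^ 0\<bar> + (\<Sum>k<n. \<bar>r ^ Suc k - r ^ k\<bar>))"
      by (rule W_bound)
    also have "(\<Sum>k<n. \<bar>r ^ Suc k - r ^ k\<bar>) = (\<Sum>k<n. r ^ k - r ^ Suc k)"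
    proof (intro sum.cong refl)
      fix k
      have "r ^ Suc k \<le> r ^ k" using r by (intro power_decreasing) auto
      then show "\<bar>r ^ Suc k - r ^ k\<bar> = r ^ k - r ^ Suc k" by linarith
    qed
    also have "\<dots> = 1 - r ^ n" by (simp only: sum_lessThan_telescope' power_0)
    also have "?K * (\<bar>r ^ 0\<bar> + (1 - r ^ n)) \<le> ?K * 2"
      using K r by (intro mult_left_mono) auto
    finally have 2: "a.nrm (W (\<lambda>k. r ^ k)) \<le> 2 * ?K" by (simp only: mult.commute [of _ 2])
    have "norm (h (of_real r)) \<le> L * a.nrm (W (\<lambda>k. (1 / r) ^ k)) * a.nrm (W (\<lambda>j. r ^ j))"
      unfolding h_real [OF r(1)] norm_of_real by (rule continuous [OF WX WX])
    also have "\<dots> \<le> L * (2 * ?K) * (2 * ?K)"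
      using \<alpha> K by (intro mult_mono 1 2 order.refl a.nrm_nonneg WX mult_nonneg_nonneg [of L "2 * (C * a.nrm (e 0))"]) linarith+
    finally show ?thesis .
  qed
  also have "(4 * real n) powr ?\<gamma> = 4 powr ?\<gamma> * real n powr ?\<gamma>" by (rule powr_mult)
  finally have D: "?D \<le> 4 powr ?\<gamma> * real n powr ?\<gamma> * (L * (2 * (C * a.nrm (e 0))) * (2 * (C * a.nrm (e 0))))"
    by (simp add: mult_left_mono)
  have "\<alpha> * (\<Sum>k<n. (a.nrm (d k))\<^sup>2) \<le> ?D"
    unfolding sum_distrib_left using elliptic dX by (intro sum_mono) auto
  also note D
  also have "4 powr ?\<gamma> * real n powr ?\<gamma> * (L * (2 * (C * a.nrm (e 0))) * (2 * (C * a.nrm (e 0))))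
      = \<alpha> * (4 * C ^ 3 * 4 powr ?\<gamma> * real n powr ?\<gamma> * (a.nrm (e 0))\<^sup>2)"
  proof -
    have "L = \<alpha> * C" using \<alpha> by simp
    then have "x * y * (L * (2 * (C * z)) * (2 * (C * z))) = \<alpha> * (4 * C ^ 3 * x * y * z\<^sup>2)" for x y z
      by (simp add: power2_eq_square power3_eq_cube)
    then show ?thesis .
  qed
  finally show ?thesis using \<alpha>(1) by (simp only: mult_le_cancel_left_pos)
qed

end


section \<open>The spaces \<open>H\<^sup>1\<close> and \<open>H\<^sup>1\<^sub>0\<close>\<close>

definition h1ip :: "nat \<Rightarrow> pt set \<Rightarrow> fn \<Rightarrow> fn \<Rightarrow> real"
  where "h1ip d \<Omega> u v =
    (\<integral>x. u x * v x \<partial>vol d \<Omega>) + (\<Sum>i<d. \<integral>x. grad d \<Omega> u i x * grad d \<Omega> v i x \<partial>vol d \<Omega>)"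

lemma h1norm_eq: "h1norm d \<Omega> u = sqrt (h1ip d \<Omega> u u)"
  by (simp add: h1norm_def h1ip_def power2_eq_square)

text \<open>Gradients are linear only almost everywhere; bilinearity of all the forms below passes
  through this lemma.\<close>

lemma integral_AE_lin:
  assumes "f \<in> L2 d \<Omega>" "g \<in> L2 d \<Omega>" "h \<in> L2 d \<Omega>" "w \<in> L2 d \<Omega>"
    and "AE x in vol d \<Omega>. f x = r * g x + s * h x"
  shows "(\<integral>x. f x * w x \<partial>vol d \<Omega>) = r * (\<integral>x. g x * w x \<partial>vol d \<Omega>) + s * (\<integral>x. h x * w x \<partial>vol d \<Omega>)"
proof -
  note int = L2_mult_integrable [OF assms(2,4)] L2_mult_integrable [OF assms(3,4)]
  have "(\<integral>x. f x * w x \<partial>vol d \<Omega>) = (\<integral>x. r * (g x * w x) + s * (h x * w x) \<partial>vol d \<Omega>)"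
  proof (rule integral_cong_AE)
    show "(\<lambda>x. f x * w x) \<in> borel_measurable (vol d \<Omega>)"
      using L2_mult_integrable [OF assms(1,4)] by simp
    show "(\<lambda>x. r * (g x * w x) + s * (h x * w x)) \<in> borel_measurable (vol d \<Omega>)"
      by (rule borel_measurable_integrable) (use int in simp)
    show "AE x in vol d \<Omega>. f x * w x = r * (g x * w x) + s * (h x * w x)"
      using assms(5) by eventually_elim (simp add: distrib_right)
  qed
  then show ?thesis using int by simp
qed

context open_bounded
begin

lemma grad_lin_component:
  assumes "u \<in> H1 d \<Omega>" "v \<in> H1 d \<Omega>" "i < d"
  shows "AE x in vol d \<Omega>. grad d \<Omega> (\<lambda>x. r * u x + s * v x) i x = r * grad d \<Omega> u i x + s * grad d \<Omega> v i x"
  using grad_lin [OF assms(1,2), of r s] by (rule AE_mp) (use assms(3) in simp)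

lemma h1ip_sym: "h1ip d \<Omega> u v = h1ip d \<Omega> v u"
  by (simp add: h1ip_def mult.commute)

lemma h1ip_lin_left:
  assumes "u \<in> H1 d \<Omega>" "v \<in> H1 d \<Omega>" "w \<in> H1 d \<Omega>"
  shows "h1ip d \<Omega> (\<lambda>x. r * u x + s * v x) w = r * h1ip d \<Omega> u w + s * h1ip d \<Omega> v w"
proof -
  have "(\<integral>x. (r * u x + s * v x) * w x \<partial>vol d \<Omega>) = r * (\<integral>x. u x * w x \<partial>vol d \<Omega>) + s * (\<integral>x. v x * w x \<partial>vol d \<Omega>)"
    using assms by (intro integral_AE_lin H1_L2 H1_lin) auto
  moreover have "(\<integral>x. grad d \<Omega> (\<lambda>x. r * u x + s * v x) i x * grad d \<Omega> w i x \<partial>vol d \<Omega>)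
      = r * (\<integral>x. grad d \<Omega> u i x * grad d \<Omega> w i x \<partial>vol d \<Omega>) + s * (\<integral>x. grad d \<Omega> v i x * grad d \<Omega> w i x \<partial>vol d \<Omega>)"
    if "i < d" for i
    using assms that by (intro integral_AE_lin grad_L2 H1_lin grad_lin_component)
  ultimately show ?thesis
    by (simp add: h1ip_def sum.distrib sum_distrib_left algebra_simps)
qed

lemma H1_zero: "(\<lambda>_. 0) \<in> H1 d \<Omega>"
  by (rule test_H1 [OF test_functions_zero])

lemma h1_semi_inner: "semi_inner_on (H1 d \<Omega>) (h1ip d \<Omega>)"
proof
  show "h1ip d \<Omega> w (\<lambda>x. r * u x + s * v x) = r * h1ip d \<Omega> w u + s * h1ip d \<Omega> w v"
    if "u \<in> H1 d \<Omega>" "v \<in> H1 d \<Omega>" "w \<in> H1 d \<Omega>" for u v w r s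
    using h1ip_lin_left [OF that] by (simp add: h1ip_sym)
  show "0 \<le> h1ip d \<Omega> u u" for u
    unfolding h1ip_def by (intro add_nonneg_nonneg sum_nonneg Bochner_Integration.integral_nonneg) auto
  show "h1ip d \<Omega> u v = h1ip d \<Omega> v u" for u v by (rule h1ip_sym)
qed (auto intro: H1_lin H1_zero h1ip_lin_left)

lemma H10_H1: "u \<in> H10 d \<Omega> \<Longrightarrow> u \<in> H1 d \<Omega>"
  by (simp add: H10_def)

text \<open>Approximating test functions are combined linearly. The triangle inequality for
  \<open>h1norm\<close> is available because test functions lie in \<open>H1\<close>.\<close>

lemma H10_function_space: "function_space (H10 d \<Omega>)"
proof
  interpret h1: semi_inner_on "H1 d \<Omega>" "h1ip d \<Omega>" by (rule h1_semi_inner)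
  show "(\<lambda>_. 0) \<in> H10 d \<Omega>"
    unfolding H10_def using H1_zero h1.zero_left [OF H1_zero]
    by (auto intro!: exI [of _ "\<lambda>_ _. 0"] simp: test_functions_zero h1norm_eq)
  fix u v r s assume u: "u \<in> H10 d \<Omega>" and v: "v \<in> H10 d \<Omega>"
  obtain \<phi> where \<phi>: "\<And>n::nat. \<phi> n \<in> test_functions d \<Omega>" "(\<lambda>n. h1norm d \<Omega> (\<lambda>x. u x - \<phi> n x)) \<longlonglongrightarrow> 0"
    using u by (auto simp: H10_def)
  obtain \<psi> where \<psi>: "\<And>n::nat. \<psi> n \<in> test_functions d \<Omega>" "(\<lambda>n. h1norm d \<Omega> (\<lambda>x. v x - \<psi> n x)) \<longlonglongrightarrow> 0"
    using v by (auto simp: H10_def)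
  note uv = H10_H1 [OF u] H10_H1 [OF v]
  show "(\<lambda>x. r * u x + s * v x) \<in> H10 d \<Omega>"
    unfolding H10_def
  proof (intro CollectI conjI H1_lin uv exI allI)
    show "(\<lambda>x. r * \<phi> n x + s * \<psi> n x) \<in> test_functions d \<Omega>" for n
      by (intro test_functions_lin \<phi> \<psi>)
    have lim: "(\<lambda>n. \<bar>r\<bar> * h1norm d \<Omega> (\<lambda>x. u x - \<phi> n x) + \<bar>s\<bar> * h1norm d \<Omega> (\<lambda>x. v x - \<psi> n x)) \<longlonglongrightarrow> 0"
      using tendsto_add [OF tendsto_mult_left [OF \<phi>(2), of "\<bar>r\<bar>"] tendsto_mult_left [OF \<psi>(2), of "\<bar>s\<bar>"]] by simp
    show "(\<lambda>n. h1norm d \<Omega> (\<lambda>x. (r * u x + s * v x) - (r * \<phi> n x + s * \<psi> n x))) \<longlonglongrightarrow> 0"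
    proof (rule Lim_null_comparison [OF _ lim], rule always_eventually, intro allI)
      fix n
      have mem: "(\<lambda>x. u x - \<phi> n x) \<in> H1 d \<Omega>" "(\<lambda>x. v x - \<psi> n x) \<in> H1 d \<Omega>"
        by (intro h1.diff uv test_H1 \<phi> \<psi>)+
      have eq: "(\<lambda>x. (r * u x + s * v x) - (r * \<phi> n x + s * \<psi> n x)) = (\<lambda>x. r * (u x - \<phi> n x) + s * (v x - \<psi> n x))"
        by (simp add: algebra_simps)
      have "0 \<le> h1norm d \<Omega> (\<lambda>x. r * (u x - \<phi> n x) + s * (v x - \<psi> n x))"
        unfolding h1norm_eq using mem by (intro h1.nrm_nonneg h1.lin)
      moreover have "h1norm d \<Omega> (\<lambda>x. r * (u x - \<phi> n x) + s * (v x - \<psi> n x))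
          \<le> \<bar>r\<bar> * h1norm d \<Omega> (\<lambda>x. u x - \<phi> n x) + \<bar>s\<bar> * h1norm d \<Omega> (\<lambda>x. v x - \<psi> n x)"
        unfolding h1norm_eq by (rule h1.nrm_lin_le [OF mem])
      ultimately show "norm (h1norm d \<Omega> (\<lambda>x. (r * u x + s * v x) - (r * \<phi> n x + s * \<psi> n x)))
          \<le> \<bar>r\<bar> * h1norm d \<Omega> (\<lambda>x. u x - \<phi> n x) + \<bar>s\<bar> * h1norm d \<Omega> (\<lambda>x. v x - \<psi> n x)"
        unfolding eq by simp
    qed
  qed
qed

end


section \<open>The model problem\<close>

locale elliptic_problem =
  fixes P :: bvp and \<alpha> L :: real and ustar :: fn
  assumes data: "problem_data P" and energy: "energy_constants P \<alpha> L" and exact: "exact_solution P ustar"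
begin

sublocale open_bounded "dm P" "omega P"
  using data unfolding problem_data_def polyhedral_lipschitz_domain_def by unfold_locales auto

lemma coeff_Linf: "i < dm P \<Longrightarrow> j < dm P \<Longrightarrow> cA P i j \<in> Linf (dm P) (omega P)"
  "i < dm P \<Longrightarrow> cb P i \<in> Linf (dm P) (omega P)" "cc P \<in> Linf (dm P) (omega P)"
  using data by (auto simp: problem_data_def)

definition flux :: "fn \<Rightarrow> nat \<Rightarrow> fn"
  where "flux u i = (\<lambda>x. \<Sum>j<dm P. cA P i j x * gr P u j x)"

lemma flux_L2: "u \<in> H1 (dm P) (omega P) \<Longrightarrow> i < dm P \<Longrightarrow> flux u i \<in> L2 (dm P) (omega P)"
  unfolding flux_def by (intro L2_sum L2_Linf_mult grad_L2 coeff_Linf) auto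

lemma flux_lin:
  assumes "u \<in> H1 (dm P) (omega P)" "v \<in> H1 (dm P) (omega P)"
  shows "AE x in vo P. flux (\<lambda>x. r * u x + s * v x) i x = r * flux u i x + s * flux v i x"
  using grad_lin [OF assms, of r s]
proof eventually_elim
  case (elim x)
  then show ?case by (simp add: flux_def sum_distrib_left sum.distrib [symmetric] algebra_simps)
qed

lemma aform_flux:
  assumes "u \<in> H1 (dm P) (omega P)" "v \<in> H1 (dm P) (omega P)"
  shows "aform P u v = (\<Sum>i<dm P. \<integral>x. flux u i x * gr P v i x \<partial>vo P)"
proof -
  have "aform P u v = (\<integral>x. (\<Sum>i<dm P. flux u i x * gr P v i x) \<partial>vo P)" by (simp add: aform_def flux_def)
  also have "\<dots> = (\<Sum>i<dm P. \<integral>x. flux u i x * gr P v i x \<partial>vo P)"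
    using assms by (intro Bochner_Integration.integral_sum L2_mult_integrable flux_L2 grad_L2) auto
  finally show ?thesis .
qed

text \<open>In entrywise form, symmetry of \<open>aform\<close> is symmetry of the coefficients plus
  an exchange of the two sums.\<close>

lemma aform_entries:
  assumes "u \<in> H1 (dm P) (omega P)" "v \<in> H1 (dm P) (omega P)"
  shows "aform P u v = (\<Sum>i<dm P. \<Sum>j<dm P. \<integral>x. cA P i j x * gr P u j x * gr P v i x \<partial>vo P)"
  unfolding aform_flux [OF assms]
proof (intro sum.cong refl)
  fix i assume "i \<in> {..<dm P}"
  then have "(\<integral>x. (\<Sum>j<dm P. cA P i j x * gr P u j x * gr P v i x) \<partial>vo P)
      = (\<Sum>j<dm P. \<integral>x. cA P i j x * gr P u j x * gr P v i x \<partial>vo P)"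
    using assms by (intro Bochner_Integration.integral_sum L2_mult_integrable L2_Linf_mult grad_L2 coeff_Linf) auto
  then show "(\<integral>x. flux u i x * gr P v i x \<partial>vo P) = (\<Sum>j<dm P. \<integral>x. cA P i j x * gr P u j x * gr P v i x \<partial>vo P)"
    by (simp add: flux_def sum_distrib_right)
qed

lemma aform_sym:
  assumes "u \<in> H1 (dm P) (omega P)" "v \<in> H1 (dm P) (omega P)"
  shows "aform P u v = aform P v u"
proof -
  have sym: "AE x in vo P. \<forall>i<dm P. \<forall>j<dm P. cA P i j x = cA P j i x"
    using data by (simp add: problem_data_def)
  have "(\<integral>x. cA P i j x * gr P u j x * gr P v i x \<partial>vo P) = (\<integral>x. cA P j i x * gr P v i x * gr P u j x \<partial>vo P)"
    if "i < dm P" "j < dm P" for i j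
  proof (rule integral_cong_AE)
    have "integrable (vo P) (\<lambda>x. cA P i j x * gr P u j x * gr P v i x)"
      using assms that by (intro L2_mult_integrable L2_Linf_mult grad_L2 coeff_Linf)
    then show "(\<lambda>x. cA P i j x * gr P u j x * gr P v i x) \<in> borel_measurable (vo P)" by simp
    have "integrable (vo P) (\<lambda>x. cA P j i x * gr P v i x * gr P u j x)"
      using assms that by (intro L2_mult_integrable L2_Linf_mult grad_L2 coeff_Linf)
    then show "(\<lambda>x. cA P j i x * gr P v i x * gr P u j x) \<in> borel_measurable (vo P)" by simp
    show "AE x in vo P. cA P i j x * gr P u j x * gr P v i x = cA P j i x * gr P v i x * gr P u j x"
      using sym by eventually_elim (use that in simp)
  qed
  then have "aform P u v = (\<Sum>i<dm P. \<Sum>j<dm P. \<integral>x. cA P j i x * gr P v i x * gr P u j x \<partial>vo P)"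
    unfolding aform_entries [OF assms] by (intro sum.cong refl) auto
  also have "\<dots> = aform P v u"
    unfolding aform_entries [OF assms(2,1)] by (rule sum.swap)
  finally show ?thesis .
qed

lemma aform_lin_left:
  assumes "u \<in> H1 (dm P) (omega P)" "v \<in> H1 (dm P) (omega P)" "w \<in> H1 (dm P) (omega P)"
  shows "aform P (\<lambda>x. r * u x + s * v x) w = r * aform P u w + s * aform P v w"
proof -
  have "(\<integral>x. flux (\<lambda>x. r * u x + s * v x) i x * gr P w i x \<partial>vo P)
      = r * (\<integral>x. flux u i x * gr P w i x \<partial>vo P) + s * (\<integral>x. flux v i x * gr P w i x \<partial>vo P)" if "i < dm P" for i
    using assms that by (intro integral_AE_lin flux_L2 grad_L2 flux_lin H1_lin)
  then show ?thesis
    using assms by (simp add: aform_flux H1_lin sum.distrib sum_distrib_left)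
qed

definition lower_order :: "fn \<Rightarrow> fn"
  where "lower_order u = (\<lambda>x. (\<Sum>i<dm P. cb P i x * gr P u i x) + cc P x * u x)"

lemma lower_order_L2: "u \<in> H1 (dm P) (omega P) \<Longrightarrow> lower_order u \<in> L2 (dm P) (omega P)"
  unfolding lower_order_def by (intro L2_add L2_sum L2_Linf_mult grad_L2 coeff_Linf H1_L2) auto

lemma lower_order_lin:
  assumes "u \<in> H1 (dm P) (omega P)" "v \<in> H1 (dm P) (omega P)"
  shows "AE x in vo P. lower_order (\<lambda>x. r * u x + s * v x) x = r * lower_order u x + s * lower_order v x"
  using grad_lin [OF assms, of r s]
proof eventually_elim
  case (elim x)
  then show ?case by (simp add: lower_order_def sum_distrib_left sum.distrib [symmetric] algebra_simps)
qed

lemma Kform_lower_order: "Kform P u v = (\<integral>x. lower_order u x * v x \<partial>vo P)"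
  by (simp add: Kform_def lower_order_def)

lemma Kform_lin_left:
  assumes "u \<in> H1 (dm P) (omega P)" "v \<in> H1 (dm P) (omega P)" "w \<in> H1 (dm P) (omega P)"
  shows "Kform P (\<lambda>x. r * u x + s * v x) w = r * Kform P u w + s * Kform P v w"
  unfolding Kform_lower_order using assms
  by (intro integral_AE_lin lower_order_L2 lower_order_lin H1_lin H1_L2)

lemma Kform_lin_right:
  assumes "u \<in> H1 (dm P) (omega P)" "v \<in> H1 (dm P) (omega P)" "w \<in> H1 (dm P) (omega P)"
  shows "Kform P w (\<lambda>x. r * u x + s * v x) = r * Kform P w u + s * Kform P w v"
proof -
  have "(\<integral>x. (r * u x + s * v x) * lower_order w x \<partial>vo P)
      = r * (\<integral>x. u x * lower_order w x \<partial>vo P) + s * (\<integral>x. v x * lower_order w x \<partial>vo P)"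
    using assms by (intro integral_AE_lin lower_order_L2 H1_L2 H1_lin) auto
  then show ?thesis by (simp add: Kform_lower_order mult.commute)
qed

lemma XX_H1: "u \<in> XX P \<Longrightarrow> u \<in> H1 (dm P) (omega P)"
  by (rule H10_H1)

text \<open>\<open>sqrt\<close> is odd, so bounding \<open>enorm\<close> from below by a nonnegative
  number forces the form under the root to be nonnegative.\<close>

lemma enorm_nonneg_form:
  assumes "u \<in> XX P"
  shows "0 \<le> aform P u u"
proof -
  obtain c where "0 < c" "c * h1norm (dm P) (omega P) u \<le> enorm P u"
    using energy assms by (auto simp: energy_constants_def)
  moreover have "0 \<le> h1norm (dm P) (omega P) u"
    unfolding h1norm_eq by (rule semi_inner_on.nrm_nonneg [OF h1_semi_inner XX_H1 [OF assms]])
  ultimately have "0 \<le> enorm P u" by (meson mult_nonneg_nonneg less_imp_le order_trans)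
  then show ?thesis by (simp add: enorm_def)
qed

sublocale forms: elliptic_forms "XX P" "aform P" "bform P" \<alpha> L
proof -
  interpret X: function_space "XX P" by (rule H10_function_space)
  have lin_left: "aform P (\<lambda>x. r * u x + s * v x) w = r * aform P u w + s * aform P v w"
    if "u \<in> XX P" "v \<in> XX P" "w \<in> XX P" for u v w r s
    using that by (intro aform_lin_left XX_H1)
  have sym: "aform P u v = aform P v u" if "u \<in> XX P" "v \<in> XX P" for u v
    using that by (intro aform_sym XX_H1)
  have lin_right: "aform P w (\<lambda>x. r * u x + s * v x) = r * aform P w u + s * aform P w v"
    if "u \<in> XX P" "v \<in> XX P" "w \<in> XX P" for u v w r s
    using lin_left [OF that, of r s] sym [OF that(3) X.lin [OF that(1,2), of r s]] sym [OF that(3,1)] sym [OF that(3,2)]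
    by simp
  show "elliptic_forms (XX P) (aform P) (bform P) \<alpha> L"
  proof (unfold_locales, goal_cases)
    case (1 u v w r s)
    then show ?case by (rule lin_left)
  next
    case (2 u v w r s)
    then show ?case by (rule lin_right)
  next
    case (3 u v)
    then show ?case by (rule sym)
  next
    case (4 u)
    then show ?case by (rule enorm_nonneg_form)
  next
    case (5 u v w r s)
    then show ?case
      using lin_left [of u v w r s] Kform_lin_left [of u v w r s] by (simp add: bform_def XX_H1 algebra_simps)
  next
    case (6 u v w r s)
    then show ?case
      using lin_right [of u v w r s] Kform_lin_right [of u v w r s] by (simp add: bform_def XX_H1 algebra_simps)
  qed (use energy in \<open>auto simp: energy_constants_def enorm_def\<close>)
qed

lemma edst_nrm: "edst P u v = forms.a.nrm (\<lambda>x. u x - v x)"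
  by (simp add: edst_def enorm_def)

lemma edst_nonneg: "u \<in> XX P \<Longrightarrow> v \<in> XX P \<Longrightarrow> 0 \<le> edst P u v"
  unfolding edst_nrm by (intro forms.a.nrm_nonneg forms.a.diff)

lemma edst_triangle: "u \<in> XX P \<Longrightarrow> v \<in> XX P \<Longrightarrow> w \<in> XX P \<Longrightarrow> edst P u w \<le> edst P u v + edst P v w"
  unfolding edst_nrm by (rule forms.a.nrm_diff_triangle)

lemma edst_commute: "u \<in> XX P \<Longrightarrow> v \<in> XX P \<Longrightarrow> edst P u v = edst P v u"
  unfolding edst_nrm by (rule forms.a.nrm_diff_commute)

lemma edst_self: "edst P u u = 0"
  using forms.a.zero_left [OF forms.a.zero] by (simp add: edst_nrm)

lemma ustar_mem: "ustar \<in> XX P"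
  using exact by (simp add: exact_solution_def)

lemma Ffun_eq: "v \<in> XX P \<Longrightarrow> Ffun P v = bform P ustar v"
  using exact by (simp add: exact_solution_def)

text \<open>Since the load functional coincides with \<open>bform P ustar\<close>, it inherits linearity and boundedness.\<close>

lemma Gfun_dual:
  assumes w: "w \<in> XX P"
  shows "Gfun P \<delta> w \<in> dual P"
proof -
  have G: "Gfun P \<delta> w v = aform P w v + \<delta> * (bform P ustar v - bform P w v)" if "v \<in> XX P" for v
    using that by (simp add: Gfun_def Ffun_eq)
  have "Gfun P \<delta> w (\<lambda>x. r * u x + s * v x) = r * Gfun P \<delta> w u + s * Gfun P \<delta> w v"
    if "u \<in> XX P" "v \<in> XX P" for u v r s
    using that w ustar_mem
    by (simp add: G forms.a.lin forms.a.lin_right forms.b.lin_right algebra_simps)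
  moreover have "\<exists>K. \<forall>v\<in>XX P. \<bar>Gfun P \<delta> w v\<bar> \<le> K * h1norm (dm P) (omega P) v"
  proof -
    obtain C where C: "0 < C" "\<And>v. v \<in> XX P \<Longrightarrow> enorm P v \<le> C * h1norm (dm P) (omega P) v"
      using energy by (auto simp: energy_constants_def)
    let ?K = "enorm P w + \<bar>\<delta>\<bar> * (L * enorm P ustar + L * enorm P w)"
    have K: "0 \<le> ?K"
      using forms.\<alpha> forms.a.nrm_nonneg [OF w] forms.a.nrm_nonneg [OF ustar_mem] by (simp add: enorm_def)
    have "\<bar>Gfun P \<delta> w v\<bar> \<le> ?K * C * h1norm (dm P) (omega P) v" if v: "v \<in> XX P" for v
    proof -
      have "\<bar>bform P ustar v - bform P w v\<bar> \<le> L * enorm P ustar * enorm P v + L * enorm P w * enorm P v"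
        using forms.continuous [OF ustar_mem v] forms.continuous [OF w v] unfolding enorm_def by linarith
      then have "\<bar>\<delta>\<bar> * \<bar>bform P ustar v - bform P w v\<bar>
          \<le> \<bar>\<delta>\<bar> * (L * enorm P ustar * enorm P v + L * enorm P w * enorm P v)"
        by (rule mult_left_mono) simp
      then have "\<bar>Gfun P \<delta> w v\<bar>
          \<le> enorm P w * enorm P v + \<bar>\<delta>\<bar> * (L * enorm P ustar * enorm P v + L * enorm P w * enorm P v)"
        unfolding G [OF v] using forms.a.Cauchy_Schwarz [OF w v]
        by (intro order_trans [OF abs_triangle_ineq] add_mono) (simp_all add: abs_mult enorm_def)
      also have "\<dots> = ?K * enorm P v" by (simp add: algebra_simps)
      also have "\<dots> \<le> ?K * (C * h1norm (dm P) (omega P) v)" using C(2) [OF v] K by (rule mult_left_mono)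
      finally show ?thesis by (simp add: mult.assoc)
    qed
    then show ?thesis by blast
  qed
  ultimately show ?thesis by (simp add: dual_def)
qed

end


section \<open>Nested discrete spaces\<close>

lemma polynomial_fun_lin:
  assumes "polynomial_fun d m p" "polynomial_fun d m q"
  shows "polynomial_fun d m (\<lambda>x. r * p x + s * q x)"
proof -
  let ?I = "{\<beta> \<in> {..<d} \<rightarrow>\<^sub>E {..m}. (\<Sum>i<d. \<beta> i) \<le> m}"
  obtain c where c: "\<And>x. x \<in> Rd d \<Longrightarrow> p x = (\<Sum>\<beta>\<in>?I. c \<beta> * (\<Prod>i<d. x i ^ \<beta> i))"
    using assms(1) unfolding polynomial_fun_def by blast
  obtain e where e: "\<And>x. x \<in> Rd d \<Longrightarrow> q x = (\<Sum>\<beta>\<in>?I. e \<beta> * (\<Prod>i<d. x i ^ \<beta> i))"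
    using assms(2) unfolding polynomial_fun_def by blast
  have "r * p x + s * q x = (\<Sum>\<beta>\<in>?I. (r * c \<beta> + s * e \<beta>) * (\<Prod>i<d. x i ^ \<beta> i))" if "x \<in> Rd d" for x
    unfolding c [OF that] e [OF that] by (simp add: sum_distrib_left sum.distrib distrib_right mult.assoc)
  then show ?thesis unfolding polynomial_fun_def by (intro exI [of _ "\<lambda>\<beta>. r * c \<beta> + s * e \<beta>"] ballI)
qed

lemma polynomial_fun_zero: "polynomial_fun d m (\<lambda>_. 0)"
  unfolding polynomial_fun_def by (rule exI [of _ "\<lambda>_. 0"]) simp

lemma (in elliptic_problem) VH_function_space: "function_space (VH P m \<T>)"
proof
  show "(\<lambda>_. 0) \<in> VH P m \<T>"
    unfolding VH_def using forms.a.zero polynomial_fun_zero by auto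
  fix u v r s assume u: "u \<in> VH P m \<T>" and v: "v \<in> VH P m \<T>"
  have "\<exists>p. polynomial_fun (dm P) m p \<and> (AE x in vo P. x \<in> body (dm P) t \<longrightarrow> r * u x + s * v x = p x)"
    if t: "t \<in> \<T>" for t
  proof -
    obtain p where p: "polynomial_fun (dm P) m p" "AE x in vo P. x \<in> body (dm P) t \<longrightarrow> u x = p x"
      using u t by (auto simp: VH_def)
    obtain q where q: "polynomial_fun (dm P) m q" "AE x in vo P. x \<in> body (dm P) t \<longrightarrow> v x = q x"
      using v t by (auto simp: VH_def)
    have "AE x in vo P. x \<in> body (dm P) t \<longrightarrow> r * u x + s * v x = r * p x + s * q x"
      using p(2) q(2) by eventually_elim simp
    then show ?thesis using polynomial_fun_lin [OF p(1) q(1)] by blast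
  qed
  then show "(\<lambda>x. r * u x + s * v x) \<in> VH P m \<T>"
    using u v by (simp add: VH_def forms.a.lin)
qed

lemma VH_subset: "VH P m \<T> \<subseteq> XX P"
  by (auto simp: VH_def)

lemma chull_subset:
  assumes "\<And>z. z \<in> S' \<Longrightarrow> \<exists>c. (\<forall>y\<in>S. 0 \<le> c y) \<and> (\<Sum>y\<in>S. c y) = (1::real) \<and> (\<forall>i<d. z i = (\<Sum>y\<in>S. c y * y i))"
  shows "chull d S' \<subseteq> chull d S"
proof
  obtain c where c: "\<And>z y. z \<in> S' \<Longrightarrow> y \<in> S \<Longrightarrow> 0 \<le> c z y" "\<And>z. z \<in> S' \<Longrightarrow> (\<Sum>y\<in>S. c z y) = (1::real)"
    "\<And>z i. z \<in> S' \<Longrightarrow> i < d \<Longrightarrow> z i = (\<Sum>y\<in>S. c z y * y i)"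
  proof -
    have "\<forall>z\<in>S'. \<exists>c. (\<forall>y\<in>S. 0 \<le> c y) \<and> (\<Sum>y\<in>S. c y) = (1::real) \<and> (\<forall>i<d. z i = (\<Sum>y\<in>S. c y * y i))"
      using assms by (intro ballI)
    from bchoice [OF this] show ?thesis using that by blast
  qed
  fix x assume "x \<in> chull d S'"
  then obtain e where e: "\<And>z. z \<in> S' \<Longrightarrow> 0 \<le> e z" "(\<Sum>z\<in>S'. e z) = 1"
    and x: "x = (\<lambda>i\<in>{..<d}. \<Sum>z\<in>S'. e z * z i)"
    unfolding chull_def by blast
  define w where "w y = (\<Sum>z\<in>S'. e z * c z y)" for y
  have "(\<Sum>z\<in>S'. e z * z i) = (\<Sum>y\<in>S. w y * y i)" if "i < d" for i
  proof -
    have "(\<Sum>z\<in>S'. e z * z i) = (\<Sum>z\<in>S'. \<Sum>y\<in>S. e z * c z y * y i)"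
    proof (rule sum.cong [OF refl])
      fix z assume "z \<in> S'"
      from c(3) [OF this that] show "e z * z i = (\<Sum>y\<in>S. e z * c z y * y i)"
        by (simp only: sum_distrib_left mult.assoc)
    qed
    also have "\<dots> = (\<Sum>y\<in>S. \<Sum>z\<in>S'. e z * c z y * y i)" by (rule sum.swap)
    finally show ?thesis by (simp add: w_def sum_distrib_right)
  qed
  then have "x = (\<lambda>i\<in>{..<d}. \<Sum>y\<in>S. w y * y i)" unfolding x by (intro restrict_ext) simp
  moreover have "\<forall>y\<in>S. 0 \<le> w y" unfolding w_def using c(1) e(1) by (auto intro!: sum_nonneg)
  moreover have "(\<Sum>y\<in>S. w y) = 1"
  proof -
    have "(\<Sum>y\<in>S. w y) = (\<Sum>z\<in>S'. \<Sum>y\<in>S. e z * c z y)" unfolding w_def by (rule sum.swap)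
    also have "\<dots> = (\<Sum>z\<in>S'. e z)" using c(2) by (intro sum.cong refl) (simp add: sum_distrib_left [symmetric])
    finally show ?thesis using e(2) by simp
  qed
  ultimately show "x \<in> chull d S" unfolding chull_def by blast
qed

lemma child_body:
  assumes t: "fst t \<noteq> []" and s: "s \<in> children d t"
  shows "body d s \<subseteq> body d t" "fst s \<noteq> []"
proof -
  let ?m = "midpt d (hd (fst t)) (last (fst t))" and ?inner = "butlast (tl (fst t))"
  have s_cases: "s = (hd (fst t) # ?m # ?inner, Suc (snd t) mod d)
      \<or> s = (last (fst t) # ?m # take (snd t) ?inner @ rev (drop (snd t) ?inner), Suc (snd t) mod d)"
    using s by (auto simp: children_def Let_def)
  then show "fst s \<noteq> []" by auto
  have inner: "set ?inner \<subseteq> verts t"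
    using t by (metis in_set_butlastD list.set_sel(2) subsetI)
  have ends: "hd (fst t) \<in> verts t" "last (fst t) \<in> verts t" using t by auto
  have "verts s \<subseteq> verts t \<union> {?m}"
  proof -
    have "set (take (snd t) ?inner) \<subseteq> verts t" "set (drop (snd t) ?inner) \<subseteq> verts t"
      using inner set_take_subset [of "snd t" ?inner] set_drop_subset [of "snd t" ?inner] by blast+
    then show ?thesis using s_cases inner ends by (elim disjE) (simp_all, blast+)
  qed
  moreover have "\<exists>c. (\<forall>y\<in>verts t. 0 \<le> c y) \<and> (\<Sum>y\<in>verts t. c y) = (1::real) \<and> (\<forall>i<d. z i = (\<Sum>y\<in>verts t. c y * y i))"
    if z: "z \<in> verts t \<union> {?m}" for z
  proof (cases "z \<in> verts t")
    case True
    then show ?thesis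
      by (intro exI [of _ "\<lambda>y. if y = z then 1 else 0"]) (auto simp: if_distrib [of "\<lambda>a. a * _"] cong: if_cong)
  next
    case False
    then have "z = ?m" using z by simp
    then show ?thesis
      using ends
      \<comment> \<open>The two halves are added instead of distinguished by cases, which also
        covers a vertex list whose first and last entries coincide.\<close>
      by (intro exI [of _ "\<lambda>y. (if y = hd (fst t) then 1 / 2 else 0) + (if y = last (fst t) then 1 / 2 else 0)"])
        (auto simp: midpt_def sum.distrib distrib_right if_distrib [of "\<lambda>a. a * _"] cong: if_cong)
  qed
  ultimately show "body d s \<subseteq> body d t"
    unfolding body_def by (intro chull_subset) blast
qed

text \<open>What bisection visibly preserves: finiteness, needed to split estimator sums, and
  nonempty vertex lists, which make \<open>hd\<close> and \<open>last\<close> vertices.\<close>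

definition proper_mesh :: "mesh \<Rightarrow> bool"
  where "proper_mesh \<T> \<longleftrightarrow> finite \<T> \<and> (\<forall>t\<in>\<T>. fst t \<noteq> [])"

lemma nvb_proper:
  assumes "nvb d \<T> \<S>" "proper_mesh \<T>"
  shows "proper_mesh \<S> \<and> (\<forall>s\<in>\<S>. \<exists>t\<in>\<T>. body d s \<subseteq> body d t)"
  using assms
proof (induction rule: nvb.induct)
  case (nvb_bisect \<S> t)
  then have \<S>: "proper_mesh \<S>" "\<forall>s\<in>\<S>. \<exists>t\<in>\<T>. body d s \<subseteq> body d t" by auto
  then have t: "fst t \<noteq> []" using nvb_bisect by (auto simp: proper_mesh_def)
  obtain t0 where t0: "t0 \<in> \<T>" "body d t \<subseteq> body d t0" using \<S>(2) nvb_bisect by blast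
  have "finite (children d t)" by (simp add: children_def Let_def)
  then have "proper_mesh (\<S> - {t} \<union> children d t)"
    using \<S>(1) child_body(2) [OF t] by (auto simp: proper_mesh_def)
  moreover have "\<exists>t\<in>\<T>. body d s \<subseteq> body d t" if "s \<in> \<S> - {t} \<union> children d t" for s
    using that \<S>(2) child_body(1) [OF t, of s d] t0 by blast
  ultimately show ?case by blast
qed auto

text \<open>Every refined element lies in an element of the coarser mesh, whose polynomial serves
  again.\<close>

lemma VH_mono:
  assumes "nvb (dm P) \<T> \<S>" "proper_mesh \<T>"
  shows "VH P m \<T> \<subseteq> VH P m \<S>"
proof
  fix v assume v: "v \<in> VH P m \<T>"
  have "\<exists>p. polynomial_fun (dm P) m p \<and> (AE x in vo P. x \<in> body (dm P) s \<longrightarrow> v x = p x)" if s: "s \<in> \<S>" for s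
  proof -
    obtain t where t: "t \<in> \<T>" "body (dm P) s \<subseteq> body (dm P) t" using nvb_proper [OF assms] s by blast
    obtain p where p: "polynomial_fun (dm P) m p" "AE x in vo P. x \<in> body (dm P) t \<longrightarrow> v x = p x"
      using v t by (auto simp: VH_def)
    have "AE x in vo P. x \<in> body (dm P) s \<longrightarrow> v x = p x"
      using p(2) by eventually_elim (use t(2) in blast)
    then show ?thesis using p(1) by blast
  qed
  then show "v \<in> VH P m \<S>" using v by (simp add: VH_def)
qed

lemma initial_mesh_proper: "initial_mesh d \<Omega> \<T> \<Longrightarrow> proper_mesh \<T>"
  by (auto simp: initial_mesh_def triangulation_def tagged_simplex_def proper_mesh_def)


section \<open>The order of computation\<close>

abbreviation lex3 :: "((nat \<times> nat \<times> nat) \<times> (nat \<times> nat \<times> nat)) set"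
  where "lex3 \<equiv> less_than <*lex*> less_than <*lex*> less_than"

lemma trans_lex3: "trans lex3"
  by (intro trans_lex_prod trans_less_than)

lemma irrefl_lex3: "(p, p) \<notin> lex3"
  by (cases p) auto

locale aisfem_loop =
  fixes P :: bvp and \<eta> :: estimator and lamsym lamalg :: real and R :: run
begin

abbreviation "Q \<equiv> QQ P \<eta> lamsym lamalg R"
abbreviation "jf \<equiv> j_final P \<eta> lamsym lamalg R"
abbreviation "kf \<equiv> k_final P \<eta> lamsym lamalg R"

lemma kf_jf: "kf l k j \<Longrightarrow> jf l k j"
  by (simp add: k_final_def)

lemma kf_pos: "kf l k j \<Longrightarrow> 1 \<le> k"
  by (simp add: k_final_def)

lemma Q_alg_inv: "(l, k, Suc j) \<in> Q \<Longrightarrow> (l, k, j) \<in> Q \<and> \<not> jf l k j"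
  by (erule QQ.cases) auto

lemma Q_sym_inv: "(l, Suc k, 0) \<in> Q \<Longrightarrow> \<exists>j. (l, k, j) \<in> Q \<and> jf l k j \<and> \<not> kf l k j"
  by (erule QQ.cases) auto

lemma Q_mesh_inv: "(Suc l, 0, 0) \<in> Q \<Longrightarrow> \<exists>k j. (l, k, j) \<in> Q \<and> kf l k j"
  by (erule QQ.cases) auto

lemma Q_row:
  assumes "(l, k, j) \<in> Q" "i \<le> j"
  shows "(l, k, i) \<in> Q" "i < j \<Longrightarrow> \<not> jf l k i"
proof -
  have "(l, k, i) \<in> Q \<and> (i < j \<longrightarrow> \<not> jf l k i)"
    using assms(2,1)
  proof (induction j rule: dec_induct)
    case (step j)
    then show ?case using Q_alg_inv [of l k j] by (metis less_antisym)
  qed auto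
  then show "(l, k, i) \<in> Q" "i < j \<Longrightarrow> \<not> jf l k i" by auto
qed

lemma Q_row_start: "(l, k, j) \<in> Q \<Longrightarrow> (l, k, 0) \<in> Q"
  by (rule Q_row(1)) auto

lemma Q_k0: "(l, 0, j) \<in> Q \<Longrightarrow> j = 0"
  using Q_row(2) [of l 0 j 0] by (auto simp: j_final_def)

lemma Q_column:
  assumes "(l, k, j) \<in> Q" "i \<le> k"
  shows "(l, i, 0) \<in> Q"
  using assms(2,1)
proof (induction k arbitrary: j rule: dec_induct)
  case base
  then show ?case by (rule Q_row_start)
next
  case (step k)
  then show ?case using Q_sym_inv Q_row_start by blast
qed

lemma Q_level:
  assumes "(l, k, j) \<in> Q" "i \<le> l"
  shows "(i, 0, 0) \<in> Q"
  using assms(2,1)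
proof (induction l arbitrary: k j rule: dec_induct)
  case base
  then show ?case by (rule Q_column) simp
next
  case (step l)
  have "(Suc l, 0, 0) \<in> Q" using step.prems by (rule Q_column) simp
  then show ?case using Q_mesh_inv step.IH by blast
qed

lemma jf_last:
  assumes "(l, k, j) \<in> Q" "jf l k j" "(l, k, i) \<in> Q"
  shows "i \<le> j"
  using Q_row(2) [OF assms(3), of j] assms(2) by (meson leI less_imp_le)

lemma kf_last:
  assumes "(l, k, j) \<in> Q" "kf l k j" "(l, k', j') \<in> Q"
  shows "k' \<le> k"
proof (rule ccontr)
  assume "\<not> k' \<le> k"
  then have "(l, Suc k, 0) \<in> Q" using Q_column [OF assms(3), of "Suc k"] by simp
  then obtain i where i: "(l, k, i) \<in> Q" "jf l k i" "\<not> kf l k i" using Q_sym_inv by blast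
  then have "i = j" using jf_last assms kf_jf by (meson le_antisym)
  then show False using i assms by simp
qed

text \<open>The successor in the order of computation. It is always defined, and behind an infinite
  loop no later level is reached, so \<open>Q\<close> has order type omega.\<close>

fun nxt :: "nat \<times> nat \<times> nat \<Rightarrow> nat \<times> nat \<times> nat"
  where "nxt (l, k, j) =
    (if \<not> jf l k j then (l, k, Suc j) else if \<not> kf l k j then (l, Suc k, 0) else (Suc l, 0, 0))"

definition enum_Q :: "nat \<Rightarrow> nat \<times> nat \<times> nat"
  where "enum_Q n = (nxt ^^ n) (0, 0, 0)"

lemma enum_Q_Suc: "enum_Q (Suc n) = nxt (enum_Q n)"
  by (simp add: enum_Q_def)

lemma range_enum_Q: "range enum_Q = Q"
proof (intro equalityI subsetI)
  fix p assume "p \<in> range enum_Q"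
  then obtain n where "p = enum_Q n" by blast
  moreover have "enum_Q n \<in> Q" for n
  proof (induction n)
    case 0
    then show ?case by (simp add: enum_Q_def QQ_start)
  next
    case (Suc n)
    obtain l k j where "enum_Q n = (l, k, j)" by (metis prod_cases3)
    then show ?case using Suc by (auto simp: enum_Q_Suc intro: QQ.intros)
  qed
  ultimately show "p \<in> Q" by simp
next
  fix p assume p: "p \<in> Q"
  obtain l k j where lkj: "p = (l, k, j)" by (metis prod_cases3)
  have "(l, k, j) \<in> range enum_Q"
    using p unfolding lkj
  proof (induction rule: QQ.induct)
    case QQ_start
    have "enum_Q 0 = (0, 0, 0)" by (simp add: enum_Q_def)
    then show ?case by (metis rangeI)
  next
    case (QQ_alg l k j)
    then obtain n where "(l, k, j) = enum_Q n" by blast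
    then have "enum_Q (Suc n) = (l, k, Suc j)" using QQ_alg.hyps by (metis enum_Q_Suc nxt.simps)
    then show ?case by (metis rangeI)
  next
    case (QQ_sym l k j)
    then obtain n where "(l, k, j) = enum_Q n" by blast
    then have "enum_Q (Suc n) = (l, Suc k, 0)" using QQ_sym.hyps by (metis enum_Q_Suc nxt.simps)
    then show ?case by (metis rangeI)
  next
    case (QQ_mesh l k j)
    then obtain n where "(l, k, j) = enum_Q n" by blast
    then have "enum_Q (Suc n) = (Suc l, 0, 0)" using QQ_mesh.hyps kf_jf by (metis enum_Q_Suc nxt.simps)
    then show ?case by (metis rangeI)
  qed
  then show "p \<in> range enum_Q" by (simp only: lkj)
qed

lemma enum_Q_less: "m < n \<Longrightarrow> (enum_Q m, enum_Q n) \<in> lex3"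
proof (induction n)
  case (Suc n)
  have "(enum_Q n, enum_Q (Suc n)) \<in> lex3"
    by (cases "enum_Q n") (auto simp: enum_Q_Suc)
  then show ?case
    using Suc trans_lex3 by (metis less_antisym transD)
qed simp

lemma inj_enum_Q: "inj enum_Q"
proof (rule injI)
  fix m n assume "enum_Q m = enum_Q n"
  then show "m = n" using enum_Q_less [of m n] enum_Q_less [of n m] irrefl_lex3 by (metis nat_neq_iff)
qed

text \<open>Turns differences of positions into differences of natural numbers; the count includes
  the element itself, hence \<open>Suc\<close>.\<close>

lemma pos_enum_Q: "pos Q (enum_Q n) = Suc n"
proof -
  have "{q \<in> Q. q = enum_Q n \<or> (q, enum_Q n) \<in> lex3} = enum_Q ` {..n}"
  proof (intro equalityI subsetI)
    fix q assume q: "q \<in> {q \<in> Q. q = enum_Q n \<or> (q, enum_Q n) \<in> lex3}"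
    then have "q \<in> range enum_Q" using range_enum_Q by blast
    then obtain m where m: "q = enum_Q m" by blast
    have "\<not> n < m"
    proof
      assume "n < m"
      then have "(enum_Q n, q) \<in> lex3" unfolding m by (rule enum_Q_less)
      then show False using q irrefl_lex3 transD [OF trans_lex3] by blast
    qed
    then show "q \<in> enum_Q ` {..n}" using m by auto
  next
    fix q assume "q \<in> enum_Q ` {..n}"
    then obtain m where m: "q = enum_Q m" "m \<le> n" by blast
    moreover have "enum_Q m \<in> Q" using range_enum_Q by blast
    ultimately show "q \<in> {q \<in> Q. q = enum_Q n \<or> (q, enum_Q n) \<in> lex3}"
      using enum_Q_less [of m n] by (cases "m = n") auto
  qed
  moreover have "card (enum_Q ` {..n}) = Suc n"
    by (subst card_image [OF inj_on_subset [OF inj_enum_Q]]) auto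
  ultimately show ?thesis by (simp add: pos_def)
qed

end


section \<open>Summation along the order of computation\<close>

text \<open>A geometric weight that starts at \<open>a\<close>. The zeros before \<open>a\<close>
  allow a sum over later indices to be enlarged to a full cube.\<close>

definition geo :: "real \<Rightarrow> nat \<Rightarrow> nat \<Rightarrow> real"
  where "geo r a i = (if a \<le> i then r ^ (i - a) else 0)"

lemma geo_nonneg: "0 \<le> r \<Longrightarrow> 0 \<le> geo r a i"
  by (simp add: geo_def)

lemma sum_geo_le:
  assumes "0 \<le> r" "r < 1"
  shows "(\<Sum>i\<le>N. geo r a i) \<le> 1 / (1 - r)"
proof -
  have "(\<Sum>i\<le>N. geo r a i) = (\<Sum>i\<in>{a..N}. r ^ (i - a))"
    unfolding geo_def by (intro sum.mono_neutral_cong_right) auto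
  also have "\<dots> = (\<Sum>i\<in>(\<lambda>i. i - a) ` {a..N}. r ^ i)"
    by (subst sum.reindex) (auto simp: inj_on_def)
  also have "\<dots> \<le> (\<Sum>i. r ^ i)"
    using assms by (intro sum_le_suminf summable_geometric) auto
  also have "\<dots> = 1 / (1 - r)" using assms by (intro suminf_geometric) simp
  finally show ?thesis .
qed

lemma sum_triple_product:
  fixes f g h :: "nat \<Rightarrow> real"
  shows "(\<Sum>(l, k, j)\<in>A \<times> B \<times> C. f l * g k * h j) = sum f A * sum g B * sum h C"
proof -
  have "(\<Sum>(l, k, j)\<in>A \<times> B \<times> C. f l * g k * h j) = (\<Sum>l\<in>A. \<Sum>k\<in>B. \<Sum>j\<in>C. f l * g k * h j)"
    by (simp add: sum.cartesian_product)
  also have "\<dots> = (\<Sum>l\<in>A. \<Sum>k\<in>B. f l * g k * sum h C)"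
    by (simp add: sum_distrib_left)
  also have "\<dots> = (\<Sum>l\<in>A. \<Sum>k\<in>B. f l * g k) * sum h C"
    by (simp add: sum_distrib_right)
  finally show ?thesis by (simp only: sum_product)
qed

text \<open>The three cases are a later step of the same inner loop, a later inner loop on the same level,
  and a later level.\<close>

lemma sum_lex_decay:
  fixes D :: "nat \<times> nat \<times> nat \<Rightarrow> real"
  assumes r: "0 < r" "r < 1" and M: "0 \<le> M" and fin: "finite F" and Dp: "0 \<le> D (l, k, j)"
    and ge: "\<And>q. q \<in> F \<Longrightarrow> q = (l, k, j) \<or> ((l, k, j), q) \<in> lex3"
    and row: "\<And>j'. (l, k, j') \<in> F \<Longrightarrow> j \<le> j' \<Longrightarrow> D (l, k, j') \<le> M * r ^ (j' - j) * D (l, k, j)"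
    and column: "\<And>k' j'. (l, k', j') \<in> F \<Longrightarrow> k < k' \<Longrightarrow>
        D (l, k', j') \<le> M * (r ^ (k' - Suc k) * r ^ j') * D (l, k, j)"
    and level: "\<And>l' k' j'. (l', k', j') \<in> F \<Longrightarrow> l < l' \<Longrightarrow>
        D (l', k', j') \<le> M * (r ^ (l' - Suc l) * r ^ k' * r ^ j') * D (l, k, j)"
  shows "(\<Sum>q\<in>F. D q) \<le> M * (1 / (1 - r) + (1 / (1 - r))\<^sup>2 + (1 / (1 - r)) ^ 3) * D (l, k, j)"
proof -
  let ?I = "\<lambda>a i. if i = a then 1 else 0 :: real"
  \<comment> \<open>Each weight is a product of functions of one index, so its sum over the
    enclosing cube factorises.\<close>
  define w1 where "w1 = (\<lambda>(l', k', j'). ?I l l' * ?I k k' * geo r j j')"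
  define w2 where "w2 = (\<lambda>(l', k', j'). ?I l l' * geo r (Suc k) k' * geo r 0 j')"
  define w3 where "w3 = (\<lambda>(l', k', j'). geo r (Suc l) l' * geo r 0 k' * geo r 0 j')"
  have nn: "0 \<le> w1 q" "0 \<le> w2 q" "0 \<le> w3 q" for q
    using r by (auto simp: w1_def w2_def w3_def geo_nonneg split: prod.splits)
  define N where "N = Max (insert 0 ((\<lambda>(a, b, c). max a (max b c)) ` F))"
  have sub: "F \<subseteq> {..N} \<times> {..N} \<times> {..N}"
  proof
    fix q assume q: "q \<in> F"
    obtain a b c where abc: "q = (a, b, c)" by (metis prod_cases3)
    have "max a (max b c) \<le> N"
      unfolding N_def using q fin abc by (intro Max_ge) (auto intro!: rev_image_eqI)
    then show "q \<in> {..N} \<times> {..N} \<times> {..N}" by (simp add: abc)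
  qed
  have Dle: "D q \<le> M * D (l, k, j) * (w1 q + w2 q + w3 q)" if q: "q \<in> F" for q
  proof -
    obtain l' k' j' where lkj: "q = (l', k', j')" by (metis prod_cases3)
    have MD: "0 \<le> M * D (l, k, j)" using M Dp by simp
    consider "l' = l" "k' = k" "j \<le> j'" | "l' = l" "k < k'" | "l < l'"
      using ge [OF q] lkj by auto
    then show ?thesis
    proof cases
      case 1
      then have "D q \<le> M * D (l, k, j) * w1 q"
        using row [of j'] q lkj by (simp add: w1_def geo_def mult_ac)
      also have "\<dots> \<le> M * D (l, k, j) * (w1 q + w2 q + w3 q)"
        using nn [of q] MD by (intro mult_left_mono) auto
      finally show ?thesis .
    next
      case 2
      then have "D q \<le> M * D (l, k, j) * w2 q"
        using column [of k' j'] q lkj by (simp add: w2_def geo_def mult_ac)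
      also have "\<dots> \<le> M * D (l, k, j) * (w1 q + w2 q + w3 q)"
        using nn [of q] MD by (intro mult_left_mono) auto
      finally show ?thesis .
    next
      case 3
      then have "D q \<le> M * D (l, k, j) * w3 q"
        using level [of l' k' j'] q lkj by (simp add: w3_def geo_def mult_ac)
      also have "\<dots> \<le> M * D (l, k, j) * (w1 q + w2 q + w3 q)"
        using nn [of q] MD by (intro mult_left_mono) auto
      finally show ?thesis .
    qed
  qed
  let ?B = "{..N} \<times> {..N} \<times> {..N}" and ?G = "1 / (1 - r)"
  have G: "(\<Sum>i\<le>N. geo r a i) \<le> ?G" "0 \<le> (\<Sum>i\<le>N. geo r a i)" for a
    using r by (auto intro!: sum_geo_le sum_nonneg geo_nonneg)
  have I: "(\<Sum>i\<le>N. ?I a i) \<le> 1" "0 \<le> (\<Sum>i\<le>N. ?I a i)" for a by auto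
  have G0: "0 \<le> ?G" using r by simp
  have "(\<Sum>q\<in>F. D q) \<le> (\<Sum>q\<in>F. M * D (l, k, j) * (w1 q + w2 q + w3 q))"
    using Dle by (rule sum_mono)
  also have "\<dots> \<le> (\<Sum>q\<in>?B. M * D (l, k, j) * (w1 q + w2 q + w3 q))"
    using sub nn M Dp by (intro sum_mono2) (auto intro!: mult_nonneg_nonneg add_nonneg_nonneg)
  also have "\<dots> = M * D (l, k, j) * (sum w1 ?B + sum w2 ?B + sum w3 ?B)"
    by (simp add: sum_distrib_left [symmetric] sum.distrib)
  also have "\<dots> \<le> M * D (l, k, j) * (1 * 1 * ?G + 1 * ?G * ?G + ?G * ?G * ?G)"
    unfolding w1_def w2_def w3_def sum_triple_product
    using M Dp by (intro mult_left_mono add_mono mult_mono G I G0 mult_nonneg_nonneg) auto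
  finally show ?thesis by (simp add: power2_eq_square power3_eq_cube mult_ac)
qed


section \<open>Contraction constants\<close>

locale aisfem_constants =
  fixes C Cstab Crel qred qsym qalg \<theta> lamsym lamalg :: real
  assumes C: "1 \<le> C" and Cstab: "0 < Cstab" and Crel: "0 < Crel" and qred: "0 < qred" "qred < 1"
    and qsym: "0 < qsym" "qsym < 1" and qalg: "0 < qalg" "qalg < 1"
    and \<theta>: "0 < \<theta>" "\<theta> \<le> 1" and lamsym: "0 < lamsym" "lamsym \<le> 1" and lamalg: "0 < lamalg"
begin

text \<open>All constants in this list depend on the locale parameters, and some on the decay data
  \<open>A\<close> and \<open>\<rho>\<close>, but never on a problem or a run. The quantity
  \<open>\<kappa>\<close> measures the inexactness of the solver.\<close>

definition "\<kappa> = 2 * (qalg / (1 - qalg)) * lamalg"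
definition "qbar = (qsym + \<kappa>) / (1 - \<kappa>)"
text \<open>Reduction factor of the estimator under refinement with Doerfler marking.\<close>

definition "q\<theta> = sqrt (1 - (1 - qred\<^sup>2) * \<theta>)"
text \<open>Weight of the estimator in the quasi-error \<open>H\<close>. It makes
  \<open>g * Cstab\<close> equal to \<open>(1 - qsym) / 8\<close>, small enough for the stability
  term not to destroy the contraction of the error.\<close>

definition "g = (1 - qsym) / (8 * Cstab)"
definition "qH = max ((3 + qsym) / 4) ((1 + q\<theta>) / 2)"
definition "C1 = 3 + 2 * Cstab"
definition "C2 = (1 + Crel * Cstab) * ((1 + 2 / lamalg) / (1 - qsym) + 1) + 1 + (1 + Crel) * (2 / (lamalg * lamsym))"
definition "Crow = C1 * C2 / qalg\<^sup>2"
definition "Ccol = (1 + 2 / lamsym) / qbar\<^sup>2"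
definition "Cstart = Crel * Cstab + Crel + 4"
definition "Cerr = Crel * (Cstab + 1 / g)"
text \<open>Bounds distances between later Galerkin solutions by \<open>H\<close>: the triangle
  inequality and Cea's lemma give \<open>2 * C\<close>, reliability gives
  \<open>Cerr\<close>.\<close>

definition "K = 2 * C * Cerr"
definition "Cnext = K + 1 + 1 / g"
definition "Cfin = C + 1 + g"
text \<open>The factors record a chain, read from the right: finish the current inner loop, restart,
  run along the outer loop, enter the target inner loop. \<open>Cup\<close> inserts a passage
  through levels.\<close>

definition "Csame = Crow * Cstart * Ccol * (C + 1) * Crow"
definition "Cup A = Crow * Cstart * Ccol * Cnext * A * Cfin * Csame" for A :: real
definition "rate \<rho> = max \<rho> (max qbar qalg)"
definition "Csum A \<rho> = 1 + (Csame + Cup A) * (1 / (1 - rate \<rho>) + (1 / (1 - rate \<rho>))\<^sup>2 + (1 / (1 - rate \<rho>)) ^ 3)"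

lemma \<kappa>_pos: "0 < \<kappa>"
  using qalg lamalg by (simp add: \<kappa>_def)

lemma q\<theta>: "0 \<le> q\<theta>" "q\<theta> < 1" "q\<theta>\<^sup>2 = 1 - (1 - qred\<^sup>2) * \<theta>"
proof -
  have "0 < 1 - qred\<^sup>2" "1 - qred\<^sup>2 < 1" using qred by (simp_all add: abs_square_less_1)
  then have "0 < (1 - qred\<^sup>2) * \<theta>" "(1 - qred\<^sup>2) * \<theta> \<le> 1" using \<theta> by (auto intro: mult_le_one)
  then show "0 \<le> q\<theta>" "q\<theta> < 1" "q\<theta>\<^sup>2 = 1 - (1 - qred\<^sup>2) * \<theta>" by (auto simp: q\<theta>_def)
qed

lemma g_pos: "0 < g"
  using qsym Cstab by (simp add: g_def)

lemma qH: "0 < qH" "qH < 1"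
  using qsym q\<theta> by (auto simp: qH_def less_max_iff_disj)

lemma C1_ge: "1 \<le> C1"
  using Cstab by (simp add: C1_def)

lemma C2_ge: "1 \<le> C2"
proof -
  have "0 \<le> (1 + Crel * Cstab) * ((1 + 2 / lamalg) / (1 - qsym) + 1)" "0 \<le> (1 + Crel) * (2 / (lamalg * lamsym))"
    using Crel Cstab lamalg lamsym qsym by auto
  then show ?thesis by (simp add: C2_def)
qed

lemma Crow_ge: "1 \<le> Crow"
proof -
  have "qalg\<^sup>2 \<le> 1" using qalg by (simp add: power_le_one)
  also have "1 \<le> C1 * C2" using C1_ge C2_ge by (rule mult_ge1_I)
  finally show ?thesis using qalg by (simp add: Crow_def)
qed

lemma Cstart_ge: "1 \<le> Cstart"
  using Crel Cstab by (simp add: Cstart_def)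

lemma Cerr_pos: "0 < Cerr"
  using Crel Cstab g_pos by (simp add: Cerr_def add_pos_pos)

lemma K_pos: "0 < K"
  using Cerr_pos C by (simp add: K_def)

lemma Cnext_ge: "1 \<le> Cnext"
  using K_pos g_pos by (simp add: Cnext_def)

lemma Cfin_ge: "1 \<le> Cfin"
  using C g_pos by (simp add: Cfin_def)

end

text \<open>The first condition makes \<open>qbar\<close> smaller than 1, the other two absorb the inexactness of the
  final iterate into the contraction of the weighted quasi-error.\<close>

locale aisfem_small = aisfem_constants +
  assumes small_sym: "qsym + \<kappa> < 1 - \<kappa>"
    and small_stab: "\<kappa> * Cstab \<le> (1 - qsym) / 4"
    and small_red: "\<kappa> \<le> g * (1 - q\<theta>) / 8"
begin

lemma \<kappa>_less: "\<kappa> < 1"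
  using small_sym \<kappa>_pos qsym by linarith

lemma qbar: "0 < qbar" "qbar < 1"
  using small_sym \<kappa>_pos \<kappa>_less qsym by (auto simp: qbar_def)

lemma Ccol_ge: "1 \<le> Ccol"
proof -
  have "qbar\<^sup>2 \<le> 1" using qbar by (simp add: power_le_one)
  also have "1 \<le> 1 + 2 / lamsym" using lamsym by simp
  finally show ?thesis using qbar by (simp add: Ccol_def)
qed

lemma Csame_ge: "Crow \<le> Csame" "1 \<le> Csame"
proof -
  have "1 \<le> Crow * Cstart * Ccol * (C + 1)"
    using Crow_ge Cstart_ge Ccol_ge C by (intro mult_ge1_I) auto
  then have "1 * Crow \<le> Csame" unfolding Csame_def using Crow_ge by (intro mult_right_mono) auto
  then show "Crow \<le> Csame" "1 \<le> Csame" using Crow_ge by auto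
qed

text \<open>The bounds for \<open>E'\<close> and \<open>N'\<close> refer to each other. Inserting
  the second into the first and absorbing \<open>\<kappa> * Cstab * E'\<close> frees
  \<open>E'\<close> from \<open>N'\<close>; the weight \<open>g\<close> then controls the stability
  term. What is left of \<open>\<kappa>\<close> consumes at most half of the gap between
  \<open>q\<theta>\<close> and 1.\<close>

lemma weighted_contraction:
  assumes nn: "0 \<le> x" "0 \<le> N"
    and E: "E' \<le> qsym * x + \<kappa> * N'" and N: "N' \<le> q\<theta> * N + Cstab * (E' + x)"
  shows "E' + g * N' \<le> qH * (x + g * N)"
proof -
  define t where "t = \<kappa> * Cstab"
  define s where "s = g * Cstab"
  have t: "0 < t" "t \<le> (1 - qsym) / 4" using \<kappa>_pos Cstab small_stab by (auto simp: t_def)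
  have s: "s = (1 - qsym) / 8" using Cstab by (simp add: s_def g_def)
  have "E' \<le> qsym * x + \<kappa> * (q\<theta> * N + Cstab * (E' + x))"
    using E mult_left_mono [OF N, of \<kappa>] \<kappa>_pos by linarith
  then have "(1 - t) * E' \<le> (qsym + t) * x + \<kappa> * q\<theta> * N" by (simp add: t_def algebra_simps)
  also have "(qsym + t) * x \<le> ((1 - t) * ((1 + qsym) / 2)) * x"
  proof (rule mult_right_mono [OF _ nn(1)])
    have "t * (3 + qsym) \<le> (1 - qsym) / 4 * (3 + qsym)" using t qsym by (intro mult_right_mono) auto
    also have "\<dots> \<le> (1 - qsym) / 4 * 4" using qsym by (intro mult_left_mono) auto
    finally show "qsym + t \<le> (1 - t) * ((1 + qsym) / 2)" by (simp add: algebra_simps)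
  qed
  also have "\<kappa> * q\<theta> * N \<le> (1 - t) * (2 * \<kappa> * q\<theta>) * N"
  proof (rule mult_right_mono [OF _ nn(2)])
    have "1 \<le> (1 - t) * 2" using t qsym by simp
    then have "1 * (\<kappa> * q\<theta>) \<le> (1 - t) * 2 * (\<kappa> * q\<theta>)"
      using \<kappa>_pos q\<theta> by (intro mult_right_mono) auto
    then show "\<kappa> * q\<theta> \<le> (1 - t) * (2 * \<kappa> * q\<theta>)" by (simp only: mult_1_left mult_ac)
  qed
  finally have "(1 - t) * E' \<le> (1 - t) * ((1 + qsym) / 2 * x + 2 * \<kappa> * q\<theta> * N)"
    by (simp only: distrib_left mult.assoc)
  moreover have "0 < 1 - t" using t qsym by simp
  ultimately have E2: "E' \<le> (1 + qsym) / 2 * x + 2 * \<kappa> * q\<theta> * N" by (simp only: mult_le_cancel_left_pos)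
  have "E' + g * N' \<le> (1 + s) * E' + s * x + g * q\<theta> * N"
    using mult_left_mono [OF N, of g] g_pos by (simp add: s_def algebra_simps)
  also have "(1 + s) * E' \<le> (1 + s) * ((1 + qsym) / 2 * x + 2 * \<kappa> * q\<theta> * N)"
    using E2 s qsym by (intro mult_left_mono) auto
  also have "(1 + s) * ((1 + qsym) / 2 * x + 2 * \<kappa> * q\<theta> * N) + s * x + g * q\<theta> * N
      = ((1 + s) * ((1 + qsym) / 2) + s) * x + ((1 + s) * (2 * \<kappa> * q\<theta>) + g * q\<theta>) * N"
    by (simp add: algebra_simps)
  also have "\<dots> \<le> qH * x + qH * g * N"
  proof (intro add_mono mult_right_mono nn)
    have "s * ((1 + qsym) / 2) \<le> s * 1" using s qsym by (intro mult_left_mono) auto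
    moreover have "(1 + s) * ((1 + qsym) / 2) = (1 + qsym) / 2 + s * ((1 + qsym) / 2)"
      by (simp only: distrib_right mult_1_left)
    ultimately have "(1 + s) * ((1 + qsym) / 2) + s \<le> (1 + qsym) / 2 + 2 * s" by linarith
    also have "\<dots> = (3 + qsym) / 4" by (simp add: s field_simps)
    also have "\<dots> \<le> qH" by (simp add: qH_def)
    finally show "(1 + s) * ((1 + qsym) / 2) + s \<le> qH" .
    have "(1 + s) * (2 * \<kappa> * q\<theta>) \<le> 2 * (2 * \<kappa> * q\<theta>)"
      using s qsym \<kappa>_pos q\<theta> by (intro mult_right_mono) auto
    also have "\<dots> = 4 * q\<theta> * \<kappa>" by simp
    also have "\<dots> \<le> 4 * q\<theta> * (g * (1 - q\<theta>) / 8)" using small_red q\<theta> by (intro mult_left_mono) auto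
    also have "\<dots> = q\<theta> * (g * (1 - q\<theta>) / 2)" by simp
    also have "\<dots> \<le> 1 * (g * (1 - q\<theta>) / 2)" using q\<theta> g_pos by (intro mult_right_mono) auto
    finally have "(1 + s) * (2 * \<kappa> * q\<theta>) + g * q\<theta> \<le> (1 + q\<theta>) / 2 * g" by (simp add: field_simps)
    also have "\<dots> \<le> qH * g" using g_pos by (intro mult_right_mono) (auto simp: qH_def)
    finally show "(1 + s) * (2 * \<kappa> * q\<theta>) + g * q\<theta> \<le> qH * g" .
  qed
  finally show ?thesis by (simp add: distrib_left mult.assoc)
qed

end


section \<open>Linear convergence of the algorithm\<close>

locale aisfem = elliptic_problem P \<alpha> L ustar + aisfem_loop P \<eta> lamsym lamalg R
    + aisfem_small C Cstab Crel qred qsym qalg \<theta> lamsym lamalg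
  for P \<alpha> L ustar \<eta> lamsym lamalg R C Cstab Crel qred qsym qalg \<theta> +
  fixes m :: nat and \<T>0 :: mesh and uG :: "mesh \<Rightarrow> fn" and \<delta> :: real and \<Phi> :: "mesh \<Rightarrow> fn \<Rightarrow> fn"
    and \<Psi> :: "mesh \<Rightarrow> (fn \<Rightarrow> real) \<Rightarrow> fn \<Rightarrow> fn" and Cmark :: real
  assumes C_eq: "L / \<alpha> = C"
    and mesh0: "initial_mesh (dm P) (omega P) \<T>0"
    and gal: "galerkin_solutions P m \<T>0 uG"
    and stab: "stability P m \<T>0 \<eta> Cstab" and red: "reduction P m \<T>0 \<eta> qred"
    and rel: "reliability P \<T>0 \<eta> ustar uG Crel"
    and zar: "zarantonello_map P m \<T>0 \<delta> \<Phi>" and contr: "zarantonello_contraction P m \<T>0 \<Phi> qsym"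
    and solver: "algebraic_solver P m \<T>0 \<Psi> qalg"
    and run: "aisfem_run P \<T>0 \<eta> \<delta> \<Phi> \<Psi> \<theta> Cmark lamsym lamalg R"
begin

abbreviation "T \<equiv> msh R"
abbreviation "u \<equiv> uit R"
abbreviation "z \<equiv> uex R"
abbreviation "V l \<equiv> VH P m (T l)"
abbreviation "U l \<equiv> uG (T l)"
abbreviation "dst \<equiv> edst P"
abbreviation "est l v \<equiv> eta_set \<eta> (T l) (T l) v"
abbreviation "\<Delta> l k j \<equiv> quasi_error P \<eta> ustar R (l, k, j)"
text \<open>At the start of an inner loop the algebraic error is bounded by the distance to the
  Galerkin solution, so these two terms control the quasi-error there. They are what decays along
  the outer loop.\<close>

abbreviation "B l k \<equiv> dst (U l) (u l k 0) + est l (u l k 0)"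

section \<open>Invariants of a run and estimates on a single mesh\<close>

lemma est_nonneg: "0 \<le> eta_set \<eta> S S' v"
  by (simp add: eta_set_def sum_nonneg)

lemma run_alg: "(l, k, j) \<in> Q \<Longrightarrow> \<not> jf l k j \<Longrightarrow> u l k (Suc j) = \<Psi> (T l) (Gfun P \<delta> (u l k 0)) (u l k j)"
  using run unfolding aisfem_run_def by blast

lemma run_sym: "(l, k, j) \<in> Q \<Longrightarrow> jf l k j \<Longrightarrow> \<not> kf l k j \<Longrightarrow>
    u l (Suc k) 0 = u l k j \<and> z l (Suc k) = \<Phi> (T l) (u l k j)"
  using run unfolding aisfem_run_def by blast

lemma run_mesh: "(l, k, j) \<in> Q \<Longrightarrow> kf l k j \<Longrightarrow>
    marking \<eta> \<theta> Cmark (T l) (u l k j) (mrk R l) \<and> is_refine (dm P) (T l) (mrk R l) (T (Suc l)) \<and>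
    u (Suc l) 0 0 = u l k j \<and> z (Suc l) 0 = u l k j"
  using run unfolding aisfem_run_def by blast

lemma run_init: "T 0 = \<T>0" "u 0 0 0 = (\<lambda>_. 0)" "z 0 0 = (\<lambda>_. 0)"
  using run unfolding aisfem_run_def by blast+

lemma VX: "v \<in> V l \<Longrightarrow> v \<in> XX P"
  using VH_subset by blast

text \<open>The start \<open>u l k 0\<close> is carried along because the functional handed to the
  solver is built from it and has to lie in the dual.\<close>

lemma invariants:
  assumes "(l, k, j) \<in> Q"
  shows "T l \<in> refinements (dm P) \<T>0 \<and> proper_mesh (T l) \<and> u l k j \<in> V l \<and> u l k 0 \<in> V l"
  using assms
proof (induction rule: QQ.induct)
  case QQ_start
  then show ?case
    using initial_mesh_proper [OF mesh0] function_space.zero [OF VH_function_space]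
    by (simp add: run_init refinements_self)
next
  case (QQ_alg l k j)
  have "Gfun P \<delta> (u l k 0) \<in> dual P" using QQ_alg.IH by (intro Gfun_dual VX) auto
  then show ?case using QQ_alg run_alg solver by (simp add: algebraic_solver_def)
next
  case (QQ_sym l k j)
  then show ?case using run_sym by simp
next
  case (QQ_mesh l k j)
  then have r: "is_refine (dm P) (T l) (mrk R l) (T (Suc l))" and nv: "nvb (dm P) (T l) (T (Suc l))"
    using run_mesh by (auto simp: is_refine_def)
  have "T (Suc l) \<in> refinements (dm P) \<T>0" using QQ_mesh r by (auto intro: refinements_step)
  moreover have "proper_mesh (T (Suc l))" using nvb_proper [OF nv] QQ_mesh by blast
  moreover have "u l k j \<in> V (Suc l)" using VH_mono [OF nv] QQ_mesh by blast
  ultimately show ?case using run_mesh [OF QQ_mesh.hyps] by simp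
qed

lemma T_mem: "(l, k, j) \<in> Q \<Longrightarrow> T l \<in> refinements (dm P) \<T>0"
  and T_proper: "(l, k, j) \<in> Q \<Longrightarrow> proper_mesh (T l)"
  and uV: "(l, k, j) \<in> Q \<Longrightarrow> u l k j \<in> V l"
  using invariants by blast+

lemma uX: "(l, k, j) \<in> Q \<Longrightarrow> u l k j \<in> XX P"
  using uV VX by blast

lemma UV: "(l, k, j) \<in> Q \<Longrightarrow> U l \<in> V l"
  using T_mem gal unfolding galerkin_solutions_def by blast

lemma UX: "(l, k, j) \<in> Q \<Longrightarrow> U l \<in> XX P"
  using UV VX by blast

lemma U_galerkin:
  assumes "(l, k, j) \<in> Q" "v \<in> V l"
  shows "bform P (U l) v = bform P ustar v"
proof -
  have "bform P (U l) v = Ffun P v" using assms T_mem gal unfolding galerkin_solutions_def by blast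
  then show ?thesis using Ffun_eq [OF VX [OF assms(2)]] by simp
qed

lemma Cea_bound:
  assumes "(l, k, j) \<in> Q" "v \<in> V l"
  shows "dst ustar (U l) \<le> C * dst ustar v"
  unfolding edst_nrm C_eq [symmetric]
  by (rule forms.Cea [OF VH_function_space VH_subset ustar_mem UV [OF assms(1)] assms(2) U_galerkin [OF assms(1)]])

lemma est_stable:
  assumes "(l, k, j) \<in> Q" "v \<in> V l" "w \<in> V l"
  shows "est l v \<le> est l w + Cstab * dst v w"
proof -
  have "\<bar>est l v - est l w\<bar> \<le> Cstab * dst v w"
    using stab T_mem [OF assms(1)] assms(2,3) refinements_self [of "T l" "dm P"]
    unfolding stability_def by blast
  then show ?thesis by linarith
qed

lemma reliable:
  assumes "(l, k, j) \<in> Q" "v \<in> V l"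
  shows "dst ustar (U l) \<le> Crel * (est l v + Cstab * dst (U l) v)"
proof -
  have "dst ustar (U l) \<le> Crel * est l (U l)"
    using rel T_mem [OF assms(1)] unfolding reliability_def by blast
  also have "\<dots> \<le> Crel * (est l v + Cstab * dst (U l) v)"
    using est_stable [OF assms(1) UV [OF assms(1)] assms(2)] Crel by (intro mult_left_mono) auto
  finally show ?thesis .
qed

lemma start_exact:
  assumes "(l, Suc k, 0) \<in> Q"
  shows "z l (Suc k) = \<Phi> (T l) (u l (Suc k) 0)" "z l (Suc k) \<in> V l"
proof -
  obtain j where "(l, k, j) \<in> Q" "jf l k j" "\<not> kf l k j" using Q_sym_inv [OF assms] by blast
  then show z: "z l (Suc k) = \<Phi> (T l) (u l (Suc k) 0)" using run_sym by simp
  show "z l (Suc k) \<in> V l"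
    unfolding z using zar T_mem [OF assms] uV [OF assms] by (simp add: zarantonello_map_def)
qed

lemma start_exact_0:
  assumes "(l, 0, 0) \<in> Q"
  shows "z l 0 = u l 0 0"
proof (cases l)
  case 0
  then show ?thesis by (simp add: run_init)
next
  case (Suc n)
  then show ?thesis using Q_mesh_inv [of n] run_mesh assms by metis
qed

lemma zV: "(l, k, j) \<in> Q \<Longrightarrow> z l k \<in> V l"
proof (cases k)
  case 0
  assume "(l, k, j) \<in> Q"
  then have "(l, 0, 0) \<in> Q" using 0 Q_row_start by blast
  then show ?thesis using start_exact_0 uV 0 by simp
next
  case (Suc n)
  assume "(l, k, j) \<in> Q"
  then show ?thesis using Suc start_exact(2) Q_row_start by blast
qed

lemma zX: "(l, k, j) \<in> Q \<Longrightarrow> z l k \<in> XX P"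
  using zV VX by blast

text \<open>The Galerkin solution is a fixed point of the Zarantonello mapping, up to a null function.\<close>

lemma exact_contraction:
  assumes q: "(l, Suc k, 0) \<in> Q"
  shows "dst (U l) (z l (Suc k)) \<le> qsym * dst (U l) (u l (Suc k) 0)"
proof -
  have W: "\<Phi> (T l) (U l) \<in> V l" "\<And>v. v \<in> V l \<Longrightarrow> aform P (\<Phi> (T l) (U l)) v = Gfun P \<delta> (U l) v"
    using zar T_mem [OF q] UV [OF q] by (auto simp: zarantonello_map_def)
  let ?d = "\<lambda>x. U l x - \<Phi> (T l) (U l) x"
  have d: "?d \<in> V l" using UV [OF q] W(1) by (intro function_space.diff VH_function_space)
  have "aform P (\<Phi> (T l) (U l)) ?d = aform P (U l) ?d"
    using W(2) [OF d] U_galerkin [OF q d] Ffun_eq [OF VX [OF d]] by (simp add: Gfun_def)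
  then have "aform P ?d ?d = 0"
    using forms.a.diff_left [OF UX [OF q] VX [OF W(1)] VX [OF d]] by simp
  then have "dst (U l) (\<Phi> (T l) (U l)) = 0" by (simp add: edst_nrm)
  moreover have "dst (\<Phi> (T l) (U l)) (z l (Suc k)) \<le> qsym * dst (U l) (u l (Suc k) 0)"
    unfolding start_exact(1) [OF q]
    using contr T_mem [OF q] UV [OF q] uV [OF q] by (simp add: zarantonello_contraction_def)
  ultimately show ?thesis
    using edst_triangle [OF UX [OF q] VX [OF W(1)] zX [OF q]] by linarith
qed

text \<open>\<open>z l k\<close> solves exactly the linear system that the solver is given, with
  right-hand side \<open>Gfun P \<delta> (u l k 0)\<close>.\<close>

lemma solver_contraction:
  assumes q: "(l, k, Suc j) \<in> Q"
  shows "dst (z l k) (u l k (Suc j)) \<le> qalg * dst (z l k) (u l k j)"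
proof -
  have q': "(l, k, j) \<in> Q" "\<not> jf l k j" using Q_alg_inv [OF q] by auto
  note q0 = Q_row_start [OF q]
  obtain n where k: "k = Suc n" using Q_k0 [of l "Suc j"] q by (cases k) auto
  have "aform P (z l k) v = Gfun P \<delta> (u l k 0) v" if "v \<in> V l" for v
    unfolding k start_exact(1) [OF q0 [unfolded k]]
    using zar T_mem [OF q] uV [OF q0] that by (simp add: zarantonello_map_def k)
  moreover have "Gfun P \<delta> (u l k 0) \<in> dual P" by (rule Gfun_dual [OF uX [OF q0]])
  ultimately have "dst (z l k) (\<Psi> (T l) (Gfun P \<delta> (u l k 0)) (u l k j)) \<le> qalg * dst (z l k) (u l k j)"
    using solver T_mem [OF q] zV [OF q] uV [OF q'(1)] by (simp add: algebraic_solver_def)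
  then show ?thesis using run_alg [OF q'] by simp
qed

section \<open>Decay within an inner loop\<close>

lemma quasi_error_eq: "\<Delta> l k j = dst ustar (u l k j) + dst (z l k) (u l k j) + est l (u l k j)"
  by (simp add: quasi_error_def)

lemma parts_nonneg:
  assumes "(l, k, j) \<in> Q"
  shows "0 \<le> dst ustar (u l k j)" "0 \<le> dst (z l k) (u l k j)" "0 \<le> est l (u l k j)" "0 \<le> dst (U l) (u l k j)"
  using assms by (auto intro!: edst_nonneg est_nonneg ustar_mem uX zX UX)

lemma quasi_error_nonneg: "(l, k, j) \<in> Q \<Longrightarrow> 0 \<le> \<Delta> l k j"
  using parts_nonneg [of l k j] by (simp add: quasi_error_eq)

lemma solver_power:
  assumes "(l, k, j) \<in> Q" "i \<le> j"
  shows "dst (z l k) (u l k j) \<le> qalg ^ (j - i) * dst (z l k) (u l k i)"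
  using assms(2,1)
proof (induction j rule: dec_induct)
  case (step n)
  have "dst (z l k) (u l k (Suc n)) \<le> qalg * dst (z l k) (u l k n)"
    using step.prems by (rule solver_contraction)
  also have "\<dots> \<le> qalg * (qalg ^ (n - i) * dst (z l k) (u l k i))"
    using step Q_alg_inv qalg by (intro mult_left_mono) auto
  finally show ?case using step.hyps by (simp add: Suc_diff_le)
qed simp

text \<open>A solver step moves by at most twice the algebraic error. This covers the last step of
  an inner loop, where no failed criterion is at hand.\<close>

lemma row_step:
  assumes q: "(l, k, Suc j) \<in> Q"
  shows "\<Delta> l k (Suc j) \<le> C1 * \<Delta> l k j"
proof -
  have q': "(l, k, j) \<in> Q" using Q_alg_inv [OF q] by blast
  let ?x = "u l k j" and ?y = "u l k (Suc j)" and ?z = "z l k"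
  note X = uX [OF q'] uX [OF q] zX [OF q]
  have 1: "dst ?z ?y \<le> dst ?z ?x"
    using solver_contraction [OF q] qalg parts_nonneg(2) [OF q'] mult_right_le_one_le [of "dst ?z ?x" qalg]
    by (simp add: mult.commute)
  have 2: "dst ?y ?x \<le> 2 * dst ?z ?x"
    using edst_triangle [OF X(2,3,1)] edst_commute [OF X(2,3)] 1 by linarith
  have 3: "dst ustar ?y \<le> dst ustar ?x + 2 * dst ?z ?x"
    using edst_triangle [OF ustar_mem X(1,2)] edst_commute [OF X(1,2)] 2 by linarith
  have "Cstab * dst ?y ?x \<le> Cstab * (2 * dst ?z ?x)" using 2 Cstab by (intro mult_left_mono) auto
  then have 4: "est l ?y \<le> est l ?x + 2 * Cstab * dst ?z ?x"
    using est_stable [OF q uV [OF q] uV [OF q']] by linarith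
  have "\<Delta> l k (Suc j) \<le> \<Delta> l k j + (2 + 2 * Cstab) * dst ?z ?x"
    unfolding quasi_error_eq using 1 3 4 by (simp add: algebra_simps)
  also have "(2 + 2 * Cstab) * dst ?z ?x \<le> (2 + 2 * Cstab) * \<Delta> l k j"
    unfolding quasi_error_eq using parts_nonneg [OF q'] Cstab by (intro mult_left_mono) auto
  finally show ?thesis by (simp add: C1_def algebra_simps)
qed

text \<open>As long as the inner loop continues, its stopping criterion fails, so that the algebraic error
  dominates the quasi-error.\<close>

lemma row_bound:
  assumes q: "(l, k, Suc (Suc j)) \<in> Q"
  shows "\<Delta> l k (Suc j) \<le> C2 * dst (z l k) (u l k j)"
proof -
  \<comment> \<open>The existence of step \<open>Suc (Suc j)\<close> is what says that the criterion
    failed at \<open>Suc j\<close>.\<close>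
  have qy: "(l, k, Suc j) \<in> Q" "\<not> jf l k (Suc j)" using Q_alg_inv [OF q] by auto
  have qx: "(l, k, j) \<in> Q" using Q_alg_inv [OF qy(1)] by blast
  note q0 = Q_row_start [OF q]
  obtain n where k: "k = Suc n" using Q_k0 [of l "Suc j"] qy(1) by (cases k) auto
  let ?x = "u l k j" and ?y = "u l k (Suc j)" and ?w = "u l k 0" and ?z = "z l k"
  let ?\<zeta> = "dst ?z ?x"
  note X = uX [OF qx] uX [OF qy(1)] uX [OF q0] zX [OF q] UX [OF q]
  have zy: "dst ?z ?y \<le> ?\<zeta>"
    using solver_contraction [OF qy(1)] qalg parts_nonneg(2) [OF qx] mult_right_le_one_le [of ?\<zeta> qalg]
    by (simp add: mult.commute)
  have yx: "dst ?y ?x \<le> 2 * ?\<zeta>"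
    using edst_triangle [OF X(2,4,1)] edst_commute [OF X(2,4)] zy by linarith
  have "lamalg * (lamsym * est l ?y + dst ?y ?w) < dst ?y ?x"
    using qy(2) k by (simp add: j_final_def)
  then have st: "lamalg * (lamsym * est l ?y) + lamalg * dst ?y ?w \<le> 2 * ?\<zeta>"
    using yx by (simp add: distrib_left)
  have yw0: "0 \<le> dst ?y ?w" using X by (intro edst_nonneg)
  have "lamalg * (lamsym * est l ?y) \<le> 2 * ?\<zeta>"
    using st mult_nonneg_nonneg [OF less_imp_le [OF lamalg] yw0] by linarith
  then have ey: "est l ?y \<le> 2 / (lamalg * lamsym) * ?\<zeta>"
    using lamalg lamsym by (simp add: field_simps)
  have "0 \<le> lamalg * (lamsym * est l ?y)" using lamalg lamsym parts_nonneg(3) [OF qy(1)] by simp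
  then have "lamalg * dst ?y ?w \<le> 2 * ?\<zeta>" using st by linarith
  then have yw: "dst ?y ?w \<le> 2 / lamalg * ?\<zeta>" using lamalg by (simp add: field_simps)
  have zw: "dst ?z ?w \<le> (1 + 2 / lamalg) * ?\<zeta>"
    using edst_triangle [OF X(4,2,3)] zy yw by (simp add: distrib_right)
  \<comment> \<open>The distance from the Galerkin solution to \<open>?z\<close> reappears on the
    right with the factor \<open>qsym < 1\<close> and is absorbed; what remains is controlled by the
    algebraic error.\<close>
  have "dst (U l) ?z \<le> qsym * dst (U l) ?w"
    using exact_contraction [OF q0 [unfolded k]] by (simp add: k)
  also have "\<dots> \<le> qsym * (dst (U l) ?z + dst ?z ?w)"
    using edst_triangle [OF X(5,4,3)] qsym by (intro mult_left_mono) auto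
  also have "\<dots> \<le> qsym * dst (U l) ?z + 1 * dst ?z ?w"
    using qsym edst_nonneg [OF X(4,3)] mult_right_mono [of qsym 1 "dst ?z ?w"] by (simp add: distrib_left)
  finally have "(1 - qsym) * dst (U l) ?z \<le> (1 + 2 / lamalg) * ?\<zeta>"
    using zw by (simp add: left_diff_distrib)
  then have "dst (U l) ?z \<le> (1 + 2 / lamalg) / (1 - qsym) * ?\<zeta>" using qsym by (simp add: field_simps)
  then have Uy: "dst (U l) ?y \<le> ((1 + 2 / lamalg) / (1 - qsym) + 1) * ?\<zeta>"
    using edst_triangle [OF X(5,4,2)] zy by (simp add: distrib_right)
  have "dst ustar ?y \<le> dst ustar (U l) + dst (U l) ?y" by (rule edst_triangle [OF ustar_mem X(5,2)])
  also have "\<dots> \<le> Crel * (est l ?y + Cstab * dst (U l) ?y) + dst (U l) ?y"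
    using reliable [OF qy(1) uV [OF qy(1)]] by simp
  finally have "\<Delta> l k (Suc j) \<le> (1 + Crel * Cstab) * dst (U l) ?y + dst ?z ?y + (1 + Crel) * est l ?y"
    unfolding quasi_error_eq by (simp add: algebra_simps)
  also have "\<dots> \<le> (1 + Crel * Cstab) * (((1 + 2 / lamalg) / (1 - qsym) + 1) * ?\<zeta>) + ?\<zeta>
      + (1 + Crel) * (2 / (lamalg * lamsym) * ?\<zeta>)"
    using Uy zy ey Crel Cstab by (intro add_mono mult_left_mono) auto
  also have "\<dots> = C2 * ?\<zeta>"
  proof -
    have "a * (b * x) + x + c * (e * x) = (a * b + 1 + c * e) * x" for a b c e x :: real
      by (simp add: algebra_simps)
    then show ?thesis by (simp only: C2_def)
  qed
  finally show ?thesis .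
qed

lemma row_decay:
  assumes q: "(l, k, j) \<in> Q" and ij: "i \<le> j"
  shows "\<Delta> l k j \<le> Crow * qalg ^ (j - i) * \<Delta> l k i"
  unfolding Crow_def
proof (rule geometric_decay_final [OF qalg C1_ge C2_ge])
  have qi: "(l, k, n) \<in> Q" if "n \<le> j" for n using q that by (rule Q_row)
  show "0 \<le> \<Delta> l k i" by (rule quasi_error_nonneg [OF qi [OF ij]])
  show "\<Delta> l k (Suc n) \<le> C1 * \<Delta> l k n" if "n < j" for n
    using that by (intro row_step qi) auto
  show "\<Delta> l k (Suc n) \<le> C2 * qalg ^ (n - i) * \<Delta> l k i" if "i \<le> n" "Suc n < j" for n
  proof -
    have "\<Delta> l k (Suc n) \<le> C2 * dst (z l k) (u l k n)" using that by (intro row_bound qi) auto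
    also have "\<dots> \<le> C2 * (qalg ^ (n - i) * dst (z l k) (u l k i))"
      using solver_power [OF qi that(1)] that C2_ge by (intro mult_left_mono) auto
    also have "\<dots> \<le> C2 * (qalg ^ (n - i) * \<Delta> l k i)"
      using parts_nonneg [OF qi [OF ij]] C2_ge qalg
      by (intro mult_left_mono) (auto simp: quasi_error_eq)
    finally show ?thesis by (simp add: mult.assoc)
  qed
qed (rule ij)

text \<open>The quantity \<open>qalg / (1 - qalg) * lamalg\<close> in \<open>\<kappa>\<close> stems from the a posteriori bound for the solver
  combined with the stopping criterion of the inner loop.\<close>

lemma final_algebraic_error:
  assumes q: "(l, Suc k, j) \<in> Q" and fin: "jf l (Suc k) j"
  shows "dst (z l (Suc k)) (u l (Suc k) j)
    \<le> \<kappa> / 2 * (lamsym * est l (u l (Suc k) j) + dst (u l (Suc k) j) (u l (Suc k) 0))"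
proof -
  obtain i where j: "j = Suc i" using fin by (cases j) (auto simp: j_final_def)
  have qi: "(l, Suc k, i) \<in> Q" using Q_alg_inv q j by blast
  let ?x = "u l (Suc k) i" and ?y = "u l (Suc k) j" and ?w = "u l (Suc k) 0" and ?z = "z l (Suc k)"
  note X = uX [OF qi] uX [OF q] zX [OF q]
  have "dst ?z ?y \<le> qalg * dst ?z ?x" using solver_contraction q j by simp
  also have "\<dots> \<le> qalg * (dst ?z ?y + dst ?y ?x)"
    using edst_triangle [OF X(3,2,1)] qalg by (intro mult_left_mono) auto
  finally have "(1 - qalg) * dst ?z ?y \<le> qalg * dst ?y ?x" by (simp add: algebra_simps)
  then have "dst ?z ?y \<le> qalg / (1 - qalg) * dst ?y ?x" using qalg by (simp add: field_simps)
  also have "\<dots> \<le> qalg / (1 - qalg) * (lamalg * (lamsym * est l ?y + dst ?y ?w))"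
    using fin j qalg by (intro mult_left_mono) (auto simp: j_final_def)
  also have "\<dots> = \<kappa> / 2 * (lamsym * est l ?y + dst ?y ?w)"
  proof -
    have "a * (b * x) = 2 * a * b / 2 * x" for a b x :: real by simp
    then show ?thesis unfolding \<kappa>_def .
  qed
  finally show ?thesis .
qed

section \<open>Decay along the outer loop on a fixed level\<close>

text \<open>This start exists only if the inner loop for \<open>Suc k\<close> ended without stopping
  the outer loop. The failed criterion bounds the estimator by the last increment, so the algebraic
  error is at most \<open>\<kappa>\<close> times the sum of the old and the new distance to the
  Galerkin solution; absorbing the new one yields \<open>qbar\<close>.\<close>

lemma inexact_contraction:
  assumes q: "(l, Suc (Suc k), 0) \<in> Q"
  shows "dst (U l) (u l (Suc (Suc k)) 0) \<le> qbar * dst (U l) (u l (Suc k) 0)"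
    and "est l (u l (Suc (Suc k)) 0) \<le> 2 / lamsym * dst (U l) (u l (Suc k) 0)"
proof -
  obtain j where j: "(l, Suc k, j) \<in> Q" "jf l (Suc k) j" "\<not> kf l (Suc k) j" using Q_sym_inv [OF q] by blast
  have eq: "u l (Suc (Suc k)) 0 = u l (Suc k) j" using run_sym [OF j] by blast
  note q0 = Q_row_start [OF j(1)]
  let ?y = "u l (Suc k) j" and ?w = "u l (Suc k) 0" and ?z = "z l (Suc k)"
  note X = uX [OF j(1)] uX [OF q0] zX [OF q0] UX [OF q0]
  have lt: "lamsym * est l ?y \<le> dst ?y ?w" using j by (simp add: k_final_def)
  have yw: "dst ?y ?w \<le> dst (U l) ?y + dst (U l) ?w"
    using edst_triangle [OF X(1,4,2)] edst_commute [OF X(1,4)] by simp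
  have "dst ?z ?y \<le> \<kappa> / 2 * (lamsym * est l ?y + dst ?y ?w)"
    by (rule final_algebraic_error [OF j(1,2)])
  also have "\<dots> \<le> \<kappa> / 2 * (2 * (dst (U l) ?y + dst (U l) ?w))"
    using lt yw \<kappa>_pos by (intro mult_left_mono) auto
  also have "\<dots> = \<kappa> * (dst (U l) ?y + dst (U l) ?w)" by simp
  finally have zy: "dst ?z ?y \<le> \<kappa> * (dst (U l) ?y + dst (U l) ?w)" .
  have "dst (U l) ?y \<le> qsym * dst (U l) ?w + \<kappa> * (dst (U l) ?y + dst (U l) ?w)"
    using edst_triangle [OF X(4,3,1)] exact_contraction [OF q0] zy by linarith
  then have "(1 - \<kappa>) * dst (U l) ?y \<le> (qsym + \<kappa>) * dst (U l) ?w" by (simp add: algebra_simps)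
  then have le: "dst (U l) ?y \<le> qbar * dst (U l) ?w"
    using \<kappa>_less by (simp add: qbar_def field_simps)
  then show "dst (U l) (u l (Suc (Suc k)) 0) \<le> qbar * dst (U l) ?w" by (simp add: eq)
  have "qbar * dst (U l) ?w \<le> 1 * dst (U l) ?w"
    using qbar parts_nonneg(4) [OF q0] by (intro mult_right_mono) auto
  then have "lamsym * est l ?y \<le> 2 * dst (U l) ?w" using lt yw le by linarith
  then show "est l (u l (Suc (Suc k)) 0) \<le> 2 / lamsym * dst (U l) ?w"
    using lamsym by (simp add: eq field_simps)
qed

lemma first_start:
  assumes "(l, Suc 0, 0) \<in> Q"
  shows "u l (Suc 0) 0 = u l 0 0"
proof -
  obtain j where "(l, 0, j) \<in> Q" "jf l 0 j" "\<not> kf l 0 j" using Q_sym_inv [OF assms] by blast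
  then show ?thesis using run_sym Q_k0 by metis
qed

text \<open>The index \<open>k = 0\<close> only holds the initial value, which \<open>k = 1\<close>
  inherits, so the first step cannot contract.\<close>

lemma column_error_step:
  assumes "(l, Suc k, 0) \<in> Q"
  shows "dst (U l) (u l (Suc k) 0) \<le> (if k = 0 then 1 else qbar) * dst (U l) (u l k 0)"
proof (cases k)
  case 0
  then show ?thesis using first_start assms by simp
next
  case (Suc n)
  then show ?thesis using inexact_contraction(1) assms by simp
qed

text \<open>The division by \<open>qbar\<close> pays for the idle step from 0 to 1; starting from
  \<open>i \<ge> 1\<close> avoids it.\<close>

lemma column_error:
  assumes "(l, k, 0) \<in> Q" "i \<le> k"
  shows "dst (U l) (u l k 0) \<le> qbar ^ (k - i) / qbar * dst (U l) (u l i 0)"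
    and "1 \<le> i \<Longrightarrow> dst (U l) (u l k 0) \<le> qbar ^ (k - i) * dst (U l) (u l i 0)"
proof -
  have *: "dst (U l) (u l k 0) \<le> qbar ^ (k - i) * dst (U l) (u l i 0)"
    if "i \<le> k" "(l, k, 0) \<in> Q" "1 \<le> i" for i k
    using that
  proof (induction k rule: dec_induct)
    case (step n)
    have "dst (U l) (u l (Suc n) 0) \<le> qbar * dst (U l) (u l n 0)"
      using column_error_step [OF step.prems(1)] step by simp
    also have "\<dots> \<le> qbar * (qbar ^ (n - i) * dst (U l) (u l i 0))"
      using step Q_column [OF step.prems(1), of n] qbar by (intro mult_left_mono) auto
    finally show ?case using step.hyps by (simp add: Suc_diff_le)
  qed simp
  show "1 \<le> i \<Longrightarrow> dst (U l) (u l k 0) \<le> qbar ^ (k - i) * dst (U l) (u l i 0)"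
    using * assms by blast
  have nn: "0 \<le> dst (U l) (u l i 0)" using parts_nonneg(4) Q_column assms by blast
  have big: "x \<le> x / qbar" if "0 \<le> x" for x
    using qbar that mult_left_le [of qbar x] by (simp add: pos_le_divide_eq)
  show "dst (U l) (u l k 0) \<le> qbar ^ (k - i) / qbar * dst (U l) (u l i 0)"
  proof (cases "1 \<le> i \<or> k = i")
    case True
    then have "dst (U l) (u l k 0) \<le> qbar ^ (k - i) * dst (U l) (u l i 0)" using * [of i k] assms by auto
    also have "\<dots> \<le> qbar ^ (k - i) * dst (U l) (u l i 0) / qbar"
      using nn qbar by (intro big) auto
    finally show ?thesis by simp
  next
    case False
    then have i0: "i = 0" and k1: "1 \<le> k" using assms by auto
    have q1: "(l, Suc 0, 0) \<in> Q" using Q_column [OF assms(1), of "Suc 0"] k1 by simp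
    have "dst (U l) (u l k 0) \<le> qbar ^ (k - 1) * dst (U l) (u l (Suc 0) 0)"
      using * [of "Suc 0" k] k1 assms by simp
    also have "qbar ^ (k - 1) = qbar ^ k / qbar" using k1 qbar by (cases k) auto
    finally show ?thesis using first_start [OF q1] i0 by simp
  qed
qed

text \<open>The failed outer criterion bounds the estimator by the error one step earlier. This
  shift and the idle step from 0 to 1 account for \<open>qbar\<^sup>2\<close> in
  \<open>Ccol\<close>.\<close>

lemma column_decay:
  assumes q: "(l, k, 0) \<in> Q" and ik: "i \<le> k"
  shows "B l k \<le> Ccol * qbar ^ (k - i) * B l i"
proof -
  note qi = Q_column [OF q ik]
  have Bi: "0 \<le> B l i" "dst (U l) (u l i 0) \<le> B l i" using parts_nonneg [OF qi] by auto
  have c3: "1 \<le> 1 + 2 / lamsym" using lamsym by simp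
  have q2: "qbar\<^sup>2 \<le> qbar" using qbar by (simp add: power2_eq_square mult_left_le)
  have small: "B l i \<le> Ccol * qbar ^ n * B l i" if "n \<le> 1" for n
  proof -
    have "qbar\<^sup>2 \<le> qbar ^ n" using qbar that by (intro power_decreasing) auto
    also have "\<dots> \<le> (1 + 2 / lamsym) * qbar ^ n" using c3 qbar mult_right_mono [OF c3, of "qbar ^ n"] by simp
    finally have "1 \<le> Ccol * qbar ^ n" using qbar by (simp add: Ccol_def)
    then show ?thesis using Bi mult_right_mono [of 1 "Ccol * qbar ^ n" "B l i"] by simp
  qed
  consider "k = i" | "k = Suc 0" "i = 0" | n where "k = Suc (Suc n)" "i \<le> Suc n"
    using ik by (metis One_nat_def Suc_leI le_Suc_eq le_zero_eq not0_implies_Suc)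
  then show ?thesis
  proof cases
    case 1
    then show ?thesis using small [of 0] by simp
  next
    case 2
    then show ?thesis using small [of 1] first_start q by simp
  next
    case 3
    note q' = q [unfolded 3]
    have qn: "(l, Suc n, 0) \<in> Q" using Q_column [OF q'] by simp
    have "qbar * dst (U l) (u l (Suc n) 0) \<le> 1 * dst (U l) (u l (Suc n) 0)"
      using qbar parts_nonneg(4) [OF qn] by (intro mult_right_mono) auto
    then have "B l k \<le> (1 + 2 / lamsym) * dst (U l) (u l (Suc n) 0)"
      using inexact_contraction [OF q'] 3 by (simp add: distrib_right)
    also have "\<dots> \<le> (1 + 2 / lamsym) * (qbar ^ (Suc n - i) / qbar * dst (U l) (u l i 0))"
      using column_error(1) [OF qn 3(2)] c3 by (intro mult_left_mono) auto
    also have "\<dots> \<le> (1 + 2 / lamsym) * (qbar ^ (Suc n - i) / qbar * B l i)"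
      using Bi c3 qbar by (intro mult_left_mono) auto
    also have "\<dots> = Ccol * qbar ^ (k - i) * B l i"
    proof -
      have "k - i = Suc (Suc n - i)" using 3 by simp
      then show ?thesis using qbar by (simp add: Ccol_def power2_eq_square)
    qed
    finally show ?thesis .
  qed
qed

lemma start_bound:
  assumes q: "(l, k, 0) \<in> Q"
  shows "\<Delta> l k 0 \<le> Cstart * B l k"
proof -
  let ?w = "u l k 0"
  note nn = parts_nonneg [OF q]
  have 1: "dst ustar ?w \<le> Crel * (est l ?w + Cstab * dst (U l) ?w) + dst (U l) ?w"
    using edst_triangle [OF ustar_mem UX [OF q] uX [OF q]] reliable [OF q uV [OF q]] by linarith
  have 2: "dst (z l k) ?w \<le> 2 * dst (U l) ?w"
  proof (cases k)
    case 0
    then show ?thesis using start_exact_0 q nn edst_self by simp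
  next
    case (Suc n)
    have "dst (U l) (z l k) \<le> qsym * dst (U l) ?w" using exact_contraction q Suc by simp
    also have "\<dots> \<le> 1 * dst (U l) ?w" using qsym nn by (intro mult_right_mono) auto
    finally show ?thesis
      using edst_triangle [OF zX [OF q] UX [OF q] uX [OF q]] edst_commute [OF zX [OF q] UX [OF q]] by linarith
  qed
  have "\<Delta> l k 0 \<le> (Crel * Cstab + 3) * dst (U l) ?w + (Crel + 1) * est l ?w"
    unfolding quasi_error_eq using 1 2 by (simp add: algebra_simps)
  also have "\<dots> \<le> Cstart * dst (U l) ?w + Cstart * est l ?w"
    using nn Crel Cstab by (intro add_mono mult_right_mono) (auto simp: Cstart_def)
  finally show ?thesis by (simp add: distrib_left)
qed

text \<open>Returns from the exact error in the quasi-error to the Galerkin error in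
  \<open>B\<close> and \<open>H\<close>, with the iterate itself as competitor in Cea's
  lemma.\<close>

lemma galerkin_error_bound:
  assumes q: "(l, k, j) \<in> Q"
  shows "dst (U l) (u l k j) \<le> (C + 1) * dst ustar (u l k j)"
  using edst_triangle [OF UX [OF q] ustar_mem uX [OF q]] edst_commute [OF UX [OF q] ustar_mem]
    Cea_bound [OF q uV [OF q]] by (simp add: distrib_right)

lemma restart_bound:
  assumes q: "(l, k, j) \<in> Q" "jf l k j" "\<not> kf l k j"
  shows "B l (Suc k) \<le> (C + 1) * \<Delta> l k j"
proof -
  note nn = parts_nonneg [OF q(1)]
  have "B l (Suc k) = dst (U l) (u l k j) + est l (u l k j)" using run_sym [OF q] by simp
  also have "\<dots> \<le> (C + 1) * dst ustar (u l k j) + (C + 1) * est l (u l k j)"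
    using galerkin_error_bound [OF q(1)] nn C mult_right_mono [of 1 "C + 1" "est l (u l k j)"]
    by (intro add_mono) auto
  also have "\<dots> \<le> (C + 1) * \<Delta> l k j"
    unfolding quasi_error_eq distrib_left [symmetric] using nn C by (intro mult_left_mono) auto
  finally show ?thesis .
qed

text \<open>The rest of the inner loop for \<open>k\<close> contributes a bounded factor only, so
  outer decay is counted from \<open>Suc k\<close>; from there it runs along the outer loop to
  \<open>k'\<close> and then along its inner loop.\<close>

lemma same_level_decay:
  assumes q: "(l, k, j) \<in> Q" and q': "(l, k', j') \<in> Q" and kk: "k < k'"
  shows "\<Delta> l k' j' \<le> Csame * (qbar ^ (k' - Suc k) * qalg ^ j') * \<Delta> l k j"
proof -
  have qs: "(l, Suc k, 0) \<in> Q" using Q_column [OF q'] kk by simp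
  obtain i where i: "(l, k, i) \<in> Q" "jf l k i" "\<not> kf l k i" using Q_sym_inv [OF qs] by blast
  have ji: "j \<le> i" by (rule jf_last [OF i(1,2) q])
  note q0' = Q_row_start [OF q']
  have "\<Delta> l k i \<le> Crow * qalg ^ (i - j) * \<Delta> l k j" by (rule row_decay [OF i(1) ji])
  also have "\<dots> \<le> Crow * 1 * \<Delta> l k j"
    using qalg Crow_ge quasi_error_nonneg [OF q]
    by (intro mult_right_mono mult_left_mono power_le_one) auto
  finally have 1: "\<Delta> l k i \<le> Crow * \<Delta> l k j" by simp
  have "\<Delta> l k' j' \<le> Crow * qalg ^ (j' - 0) * \<Delta> l k' 0" by (rule row_decay [OF q']) simp
  also have "\<dots> \<le> Crow * qalg ^ (j' - 0) * (Cstart * (Ccol * qbar ^ (k' - Suc k) * ((C + 1) * (Crow * \<Delta> l k j))))"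
  proof (intro mult_left_mono order_trans [OF start_bound [OF q0']])
    show "B l k' \<le> Ccol * qbar ^ (k' - Suc k) * ((C + 1) * (Crow * \<Delta> l k j))"
    proof (rule order_trans [OF column_decay [OF q0']])
      show "Suc k \<le> k'" using kk by simp
      show "Ccol * qbar ^ (k' - Suc k) * B l (Suc k) \<le> Ccol * qbar ^ (k' - Suc k) * ((C + 1) * (Crow * \<Delta> l k j))"
      proof (intro mult_left_mono order_trans [OF restart_bound [OF i]])
        show "\<Delta> l k i \<le> Crow * \<Delta> l k j" by (rule 1)
      qed (use C Ccol_ge qbar in auto)
    qed
  qed (use Crow_ge Cstart_ge qalg in auto)
  also have "\<dots> = Csame * (qbar ^ (k' - Suc k) * qalg ^ j') * \<Delta> l k j"
    by (simp add: Csame_def mult_ac)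
  finally show ?thesis .
qed

lemma same_level_bound:
  assumes q: "(l, k, j) \<in> Q" and q': "(l, k', j') \<in> Q" and le: "k < k' \<or> k = k' \<and> j \<le> j'"
  shows "\<Delta> l k' j' \<le> Csame * \<Delta> l k j"
  using le
proof
  assume kk: "k < k'"
  have "qbar ^ (k' - Suc k) * qalg ^ j' \<le> 1"
    using qbar qalg by (intro mult_le_one power_le_one) auto
  then have "Csame * (qbar ^ (k' - Suc k) * qalg ^ j') * \<Delta> l k j \<le> Csame * 1 * \<Delta> l k j"
    using quasi_error_nonneg [OF q] Csame_ge by (intro mult_right_mono mult_left_mono) auto
  then show ?thesis using same_level_decay [OF q q' kk] by simp
next
  assume e: "k = k' \<and> j \<le> j'"
  then have "\<Delta> l k' j' \<le> Crow * qalg ^ (j' - j) * \<Delta> l k j" using row_decay [OF q'] by simp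
  also have "\<dots> \<le> Csame * 1 * \<Delta> l k j"
    using quasi_error_nonneg [OF q] Csame_ge qalg Crow_ge
    by (intro mult_right_mono mult_mono power_le_one) auto
  finally show ?thesis by simp
qed

section \<open>Contraction across levels\<close>

text \<open>The weighted quasi-error of the final iterate of level \<open>l\<close>. That iterate is
  read off as the start of level \<open>Suc l\<close>, so the value is meaningful only if this level
  is reached.\<close>

definition H :: "nat \<Rightarrow> real"
  where "H l = dst (U l) (u (Suc l) 0 0) + g * est l (u (Suc l) 0 0)"

lemma level_final:
  assumes "(Suc l, 0, 0) \<in> Q"
  obtains k j where "(l, Suc k, j) \<in> Q" "kf l (Suc k) j" "u (Suc l) 0 0 = u l (Suc k) j"
    "u l (Suc k) j \<in> V (Suc l)" "nvb (dm P) (T l) (T (Suc l))"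
    "marking \<eta> \<theta> Cmark (T l) (u l (Suc k) j) (mrk R l)" "is_refine (dm P) (T l) (mrk R l) (T (Suc l))"
proof -
  obtain k j where kj: "(l, k, j) \<in> Q" "kf l k j" using Q_mesh_inv [OF assms] by blast
  then obtain n where n: "k = Suc n" using kf_pos by (cases k) fastforce+
  note r = run_mesh [OF kj]
  then have nv: "nvb (dm P) (T l) (T (Suc l))" by (auto simp: is_refine_def)
  have "u l k j \<in> V (Suc l)" using VH_mono [OF nv T_proper [OF kj(1)]] uV [OF kj(1)] by blast
  then show ?thesis using that [of n j] kj r nv n by simp
qed

lemma level_start: "(Suc l, 0, 0) \<in> Q \<Longrightarrow> (l, 0, 0) \<in> Q"
  by (rule Q_level) auto

lemma H_parts:
  assumes "(Suc l, 0, 0) \<in> Q"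
  shows "u (Suc l) 0 0 \<in> V l" "0 \<le> dst (U l) (u (Suc l) 0 0)" "0 \<le> est l (u (Suc l) 0 0)" "0 \<le> H l"
    "dst (U l) (u (Suc l) 0 0) \<le> H l" "est l (u (Suc l) 0 0) \<le> 1 / g * H l"
proof -
  show mem: "u (Suc l) 0 0 \<in> V l" using level_final [OF assms] uV by metis
  show 1: "0 \<le> dst (U l) (u (Suc l) 0 0)" using UX [OF level_start [OF assms]] VX [OF mem] by (rule edst_nonneg)
  show 2: "0 \<le> est l (u (Suc l) 0 0)" by (rule est_nonneg)
  have "0 \<le> g * est l (u (Suc l) 0 0)" using 2 g_pos by simp
  then show "0 \<le> H l" "dst (U l) (u (Suc l) 0 0) \<le> H l" using 1 by (auto simp: H_def)
  show "est l (u (Suc l) 0 0) \<le> 1 / g * H l" using 1 g_pos by (simp add: H_def field_simps)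
qed

text \<open>Every completed level makes at least one Zarantonello step; the last one contributes
  \<open>qsym\<close>, the earlier ones do not increase the error. The satisfied outer criterion
  bounds the last increment by the estimator, hence the algebraic error by \<open>\<kappa>\<close>
  times the estimator.\<close>

lemma final_error:
  assumes q: "(Suc l, 0, 0) \<in> Q"
  shows "dst (U l) (u (Suc l) 0 0) \<le> qsym * dst (U l) (u l 0 0) + \<kappa> * est l (u (Suc l) 0 0)"
proof -
  obtain k j where kj: "(l, Suc k, j) \<in> Q" "kf l (Suc k) j" and eq: "u (Suc l) 0 0 = u l (Suc k) j"
    using level_final [OF q] by metis
  note q0 = Q_row_start [OF kj(1)]
  let ?y = "u l (Suc k) j" and ?w = "u l (Suc k) 0" and ?z = "z l (Suc k)"
  note nn = parts_nonneg [OF kj(1)]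
  have yw: "dst ?y ?w \<le> lamsym * est l ?y" using kj(2) by (simp add: k_final_def)
  have "dst ?z ?y \<le> \<kappa> / 2 * (lamsym * est l ?y + dst ?y ?w)"
    using final_algebraic_error [OF kj(1)] kf_jf [OF kj(2)] by blast
  also have "\<dots> \<le> \<kappa> / 2 * (2 * est l ?y)"
    using yw lamsym nn mult_right_mono [of lamsym 1 "est l ?y"] \<kappa>_pos by (intro mult_left_mono) auto
  finally have zy: "dst ?z ?y \<le> \<kappa> * est l ?y" by simp
  have q1: "(l, Suc 0, 0) \<in> Q" using Q_column [OF q0, of "Suc 0"] by simp
  have "dst (U l) ?w \<le> qbar ^ (Suc k - Suc 0) * dst (U l) (u l (Suc 0) 0)"
    by (rule column_error(2) [OF q0]) auto
  also have "\<dots> \<le> 1 * dst (U l) (u l (Suc 0) 0)"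
    using qbar parts_nonneg(4) [OF q1] by (intro mult_right_mono power_le_one) auto
  finally have "dst (U l) ?w \<le> dst (U l) (u l 0 0)" using first_start [OF q1] by simp
  then have "qsym * dst (U l) ?w \<le> qsym * dst (U l) (u l 0 0)" using qsym by (intro mult_left_mono) auto
  then show ?thesis
    using edst_triangle [OF UX [OF q0] zX [OF q0] uX [OF kj(1)]] exact_contraction [OF q0] zy
    unfolding eq by linarith
qed

lemma est_square_split:
  assumes "finite S" "S' \<subseteq> S"
  shows "(eta_set \<eta> \<T> S v)\<^sup>2 = (eta_set \<eta> \<T> S' v)\<^sup>2 + (eta_set \<eta> \<T> (S - S') v)\<^sup>2"
  using assms by (simp add: eta_set_def sum_nonneg sum.subset_diff [OF assms(2,1)])

text \<open>On common elements the contributions agree, by stability with equal arguments. The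
  refined elements include the marked ones, which carry the fraction \<open>\<theta>\<close> of the
  squared estimator, and shrink by \<open>qred\<close>.\<close>

lemma est_reduction:
  assumes q: "(Suc l, 0, 0) \<in> Q"
  shows "est (Suc l) (u (Suc l) 0 0) \<le> q\<theta> * est l (u (Suc l) 0 0)"
proof -
  obtain k j where kj: "(l, Suc k, j) \<in> Q" and eq: "u (Suc l) 0 0 = u l (Suc k) j"
    and mem: "u l (Suc k) j \<in> V (Suc l)" and mark: "marking \<eta> \<theta> Cmark (T l) (u l (Suc k) j) (mrk R l)"
    and ref: "is_refine (dm P) (T l) (mrk R l) (T (Suc l))"
    using level_final [OF q] by metis
  let ?w = "u l (Suc k) j" and ?T = "T l" and ?T' = "T (Suc l)"
  have fin: "finite ?T" "finite ?T'" using T_proper [OF kj] T_proper [OF q] by (auto simp: proper_mesh_def)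
  have T': "?T' \<in> refinements (dm P) ?T" using ref by (rule refinements_step [OF refinements_self])
  have wV: "?w \<in> V l" by (rule uV [OF kj])
  have "\<bar>eta_set \<eta> ?T' (?T \<inter> ?T') ?w - eta_set \<eta> ?T (?T \<inter> ?T') ?w\<bar> \<le> Cstab * dst ?w ?w"
    using stab T_mem [OF kj] T' wV mem unfolding stability_def by blast
  then have same: "eta_set \<eta> ?T' (?T \<inter> ?T') ?w = eta_set \<eta> ?T (?T \<inter> ?T') ?w" by (simp add: edst_self)
  have new: "eta_set \<eta> ?T' (?T' - ?T) ?w \<le> qred * eta_set \<eta> ?T (?T - ?T') ?w"
    using red T_mem [OF kj] T' wV unfolding reduction_def by blast
  let ?r = "eta_set \<eta> ?T (?T - ?T') ?w"
  have "mrk R l \<subseteq> ?T - ?T'" using ref by (auto simp: is_refine_def)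
  then have "(eta_set \<eta> ?T (mrk R l) ?w)\<^sup>2 \<le> ?r\<^sup>2"
    using fin unfolding eta_set_def by (simp add: sum_nonneg sum_mono2)
  then have Doerfler: "\<theta> * (est l ?w)\<^sup>2 \<le> ?r\<^sup>2" using mark by (simp add: marking_def)
  have sub: "?T' - ?T' \<inter> ?T = ?T' - ?T" "?T - ?T \<inter> ?T' = ?T - ?T'" by auto
  have "(est (Suc l) ?w)\<^sup>2 = (eta_set \<eta> ?T' (?T' \<inter> ?T) ?w)\<^sup>2 + (eta_set \<eta> ?T' (?T' - ?T) ?w)\<^sup>2"
    using est_square_split [OF fin(2), of "?T' \<inter> ?T" ?T' ?w] sub by simp
  also have "(eta_set \<eta> ?T' (?T' - ?T) ?w)\<^sup>2 \<le> (qred * ?r)\<^sup>2" using new est_nonneg by (intro power_mono) auto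
  also have "(eta_set \<eta> ?T' (?T' \<inter> ?T) ?w)\<^sup>2 = (est l ?w)\<^sup>2 - ?r\<^sup>2"
    using est_square_split [OF fin(1), of "?T \<inter> ?T'" ?T ?w] sub same by (simp add: Int_commute)
  finally have "(est (Suc l) ?w)\<^sup>2 \<le> (est l ?w)\<^sup>2 - (1 - qred\<^sup>2) * ?r\<^sup>2"
    by (simp add: power_mult_distrib algebra_simps)
  also have "\<dots> \<le> (est l ?w)\<^sup>2 - (1 - qred\<^sup>2) * (\<theta> * (est l ?w)\<^sup>2)"
    using Doerfler qred by (intro diff_left_mono mult_left_mono) (auto simp: power_le_one)
  also have "\<dots> = (q\<theta> * est l ?w)\<^sup>2" by (simp add: power_mult_distrib q\<theta>(3) algebra_simps)
  finally have "est (Suc l) ?w \<le> q\<theta> * est l ?w"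
    by (rule power2_le_imp_le) (intro mult_nonneg_nonneg q\<theta>(1) est_nonneg)
  then show ?thesis by (simp add: eq)
qed

abbreviation "dd l \<equiv> dst (U (Suc l)) (U l)"

text \<open>Changing the level perturbs the contraction only through the increment
  \<open>dd l\<close> of the Galerkin solutions.\<close>

lemma H_recursion:
  assumes q: "(Suc (Suc l), 0, 0) \<in> Q"
  shows "H (Suc l) \<le> qH * (H l + dd l)"
proof -
  have q1: "(Suc l, 0, 0) \<in> Q" and q0: "(l, 0, 0) \<in> Q" using Q_level [OF q] by auto
  let ?W = "u (Suc l) 0 0" and ?W' = "u (Suc (Suc l)) 0 0"
  note X = UX [OF q1] UX [OF q0] uX [OF q1] uX [OF q]
  let ?x = "dst (U l) ?W + dd l" and ?N = "est l ?W" and ?E' = "dst (U (Suc l)) ?W'" and ?N' = "est (Suc l) ?W'"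
  have tri: "dst (U (Suc l)) ?W \<le> ?x" using edst_triangle [OF X(1,2,3)] by linarith
  have "qsym * dst (U (Suc l)) ?W \<le> qsym * ?x" using tri qsym by (intro mult_left_mono) auto
  then have E: "?E' \<le> qsym * ?x + \<kappa> * ?N'" using final_error [OF q] by linarith
  have "dst ?W' ?W \<le> ?E' + ?x" using edst_triangle [OF X(4,1,3)] edst_commute [OF X(4,1)] tri by linarith
  then have "Cstab * dst ?W' ?W \<le> Cstab * (?E' + ?x)" using Cstab by (intro mult_left_mono) auto
  then have N: "?N' \<le> q\<theta> * ?N + Cstab * (?E' + ?x)"
    using est_stable [OF q1 H_parts(1) [OF q] uV [OF q1]] est_reduction [OF q1] by linarith
  have "0 \<le> ?x" using H_parts(2) [OF q1] edst_nonneg [OF X(1,2)] by simp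
  then have "?E' + g * ?N' \<le> qH * (?x + g * ?N)"
    using est_nonneg E N by (rule weighted_contraction)
  then show ?thesis by (simp add: H_def add_ac)
qed

lemma U_error_H:
  assumes q: "(Suc l, 0, 0) \<in> Q"
  shows "dst ustar (U l) \<le> Cerr * H l"
proof -
  note q0 = level_start [OF q]
  note h = H_parts [OF q]
  have "dst ustar (U l) \<le> Crel * (est l (u (Suc l) 0 0) + Cstab * dst (U l) (u (Suc l) 0 0))"
    by (rule reliable [OF q0 h(1)])
  also have "\<dots> \<le> Crel * (1 / g * H l + Cstab * H l)"
    using h Crel Cstab by (intro mult_left_mono add_mono) auto
  finally show ?thesis by (simp add: Cerr_def algebra_simps)
qed

lemma V_mono:
  assumes "(l, 0, 0) \<in> Q" "i \<le> l"
  shows "V i \<subseteq> V l"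
  using assms(2,1)
proof (induction l rule: dec_induct)
  case (step n)
  have "V n \<subseteq> V (Suc n)"
    using level_final [OF step.prems] VH_mono T_proper [OF level_start [OF step.prems]] by metis
  then show ?case using step level_start by blast
qed simp

text \<open>\<open>U l\<close> is a competitor for both Galerkin solutions, so Cea's lemma compares
  each of them with it.\<close>

lemma U_increment_bound:
  assumes q: "(i, 0, 0) \<in> Q" and l: "l \<le> i" and j: "l \<le> j" "j \<le> i"
  shows "dst (U i) (U j) \<le> 2 * C * dst ustar (U l)"
proof -
  have ql: "(l, 0, 0) \<in> Q" "(j, 0, 0) \<in> Q" using Q_level [OF q] l j by auto
  have "U l \<in> V i" "U l \<in> V j" using UV [OF ql(1)] V_mono [OF q l] V_mono [OF ql(2) j(1)] by auto
  then have "dst ustar (U i) \<le> C * dst ustar (U l)" "dst ustar (U j) \<le> C * dst ustar (U l)"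
    using Cea_bound [OF q] Cea_bound [OF ql(2)] by auto
  then show ?thesis
    using edst_triangle [OF UX [OF q] ustar_mem UX [OF ql(2)]] edst_commute [OF UX [OF q] ustar_mem] by linarith
qed

lemma U_quasi_orthogonality:
  assumes q: "(l + n, 0, 0) \<in> Q" and n: "1 \<le> n"
  shows "(\<Sum>k<n. (dd (l + k))\<^sup>2)
    \<le> 4 * C ^ 3 * 4 powr sector_exponent C * real n powr sector_exponent C * (dst (U (l + n)) (U l))\<^sup>2"
proof -
  have ql: "(l + k, 0, 0) \<in> Q" if "k \<le> n" for k using Q_level [OF q] that by simp
  interpret g: galerkin_sequence "XX P" "aform P" "bform P" \<alpha> L "\<lambda>k. V (l + k)" "\<lambda>k. U (l + k)" n
  proof (intro galerkin_sequence.intro galerkin_sequence_axioms.intro forms.elliptic_forms_axioms)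
    show "1 \<le> n" by (rule n)
    fix k assume k: "k \<le> n"
    show "function_space (V (l + k))" by (rule VH_function_space)
    show "V (l + k) \<subseteq> XX P" by (rule VH_subset)
    show "U (l + k) \<in> V (l + k)" by (rule UV [OF ql [OF k]])
    fix v assume v: "v \<in> V (l + k)"
    have "v \<in> V (l + n)" using V_mono [OF q, of "l + k"] v k by auto
    then show "bform P (U (l + k)) v = bform P (U (l + n)) v"
      using U_galerkin [OF ql [OF k] v] U_galerkin [OF q] by simp
  next
    fix k assume k: "k < n"
    show "V (l + k) \<subseteq> V (l + Suc k)" using V_mono [OF ql, of "Suc k" "l + k"] k by simp
  qed
  have "dd (l + k) = forms.a.nrm (g.d k)" for k by (simp add: edst_nrm g.d_def)
  moreover have "dst (U (l + n)) (U l) = forms.a.nrm (g.e 0)" by (simp add: edst_nrm g.e_def)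
  ultimately show ?thesis using g.quasi_orthogonality by (simp add: C_eq)
qed

text \<open>The sequence lemma requires nonnegativity everywhere, hence the extension by 0 beyond the last
  completed level.\<close>

lemma H_R_linear:
  assumes A: "\<And>H d M. (\<And>l. 0 \<le> H l) \<Longrightarrow> (\<And>l. 0 \<le> d l) \<Longrightarrow>
        (\<And>l. l < M \<Longrightarrow> H (Suc l) \<le> qH * (H l + d l)) \<Longrightarrow>
        (\<And>l k. l + k < M \<Longrightarrow> d (l + k) \<le> K * H l) \<Longrightarrow>
        (\<And>l n. 1 \<le> n \<Longrightarrow> l + n \<le> M \<Longrightarrow> (\<Sum>k<n. (d (l + k))\<^sup>2)
          \<le> (4 * C ^ 3 * 4 powr sector_exponent C * K\<^sup>2) * real n powr sector_exponent C * (H l)\<^sup>2) \<Longrightarrow>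
        (\<And>l n. l + n \<le> M \<Longrightarrow> H (l + n) \<le> A * \<rho> ^ n * (H l :: real))"
    and q: "(Suc (l + n), 0, 0) \<in> Q"
  shows "H (l + n) \<le> A * \<rho> ^ n * H l"
proof -
  define M where "M = l + n"
  have qM: "(Suc i, 0, 0) \<in> Q" if "i \<le> M" for i using Q_level [OF q] that by (simp add: M_def)
  define H' where "H' i = (if i \<le> M then H i else 0)" for i
  define d' where "d' i = (if i < M then dd i else 0)" for i
  have "H' (l + n) \<le> A * \<rho> ^ n * H' l"
  proof (rule A)
    show "0 \<le> H' i" for i using H_parts(4) [OF qM] by (simp add: H'_def)
    show "0 \<le> d' i" for i
    proof (cases "i < M")
      case True
      then show ?thesis
        using edst_nonneg [OF UX [OF qM [of i]] UX [OF level_start [OF qM [of i]]]] by (simp add: d'_def)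
    qed (simp add: d'_def)
    show "H' (Suc i) \<le> qH * (H' i + d' i)" if "i < M" for i
      using H_recursion [OF qM [of "Suc i"]] that by (simp add: H'_def d'_def)
    show "d' (i + k) \<le> K * H' i" if ik: "i + k < M" for i k
    proof -
      have "dd (i + k) \<le> 2 * C * dst ustar (U i)"
        using ik by (intro U_increment_bound qM) auto
      also have "\<dots> \<le> 2 * C * (Cerr * H i)" using U_error_H [OF qM [of i]] ik C by (intro mult_left_mono) auto
      finally show ?thesis using ik by (simp add: d'_def H'_def K_def mult_ac)
    qed
    show "(\<Sum>k<n. (d' (i + k))\<^sup>2)
        \<le> (4 * C ^ 3 * 4 powr sector_exponent C * K\<^sup>2) * real n powr sector_exponent C * (H' i)\<^sup>2"
      if n: "1 \<le> n" and le: "i + n \<le> M" for i n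
    proof -
      have qin: "(i + n, 0, 0) \<in> Q" using level_start [OF qM [OF le]] .
      have iM: "i \<le> M" using le by simp
      have "dst (U (i + n)) (U i) \<le> 2 * C * dst ustar (U i)" by (intro U_increment_bound qin) auto
      also have "\<dots> \<le> 2 * C * (Cerr * H i)" using U_error_H [OF qM [OF iM]] C by (intro mult_left_mono) auto
      finally have b: "dst (U (i + n)) (U i) \<le> K * H i" by (simp add: K_def mult_ac)
      have "(\<Sum>k<n. (d' (i + k))\<^sup>2) = (\<Sum>k<n. (dd (i + k))\<^sup>2)"
        using le by (intro sum.cong refl) (simp add: d'_def)
      also have "\<dots> \<le> 4 * C ^ 3 * 4 powr sector_exponent C * real n powr sector_exponent C * (dst (U (i + n)) (U i))\<^sup>2"
        by (rule U_quasi_orthogonality [OF qin n])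
      also have "\<dots> \<le> 4 * C ^ 3 * 4 powr sector_exponent C * real n powr sector_exponent C * (K * H i)\<^sup>2"
        using b C edst_nonneg [OF UX [OF qin] UX [OF level_start [OF qM [OF iM]]]]
        by (intro mult_left_mono power_mono) auto
      finally show ?thesis using iM by (simp add: H'_def power_mult_distrib mult_ac)
    qed
    show "l + n \<le> M" by (simp add: M_def)
  qed
  then show ?thesis by (simp add: H'_def M_def)
qed

lemma next_level_bound:
  assumes q: "(Suc l, 0, 0) \<in> Q"
  shows "B (Suc l) 0 \<le> Cnext * H l"
proof -
  note h = H_parts [OF q]
  note q0 = level_start [OF q]
  have "dd l \<le> 2 * C * dst ustar (U l)" by (intro U_increment_bound q) auto
  also have "\<dots> \<le> 2 * C * (Cerr * H l)" using U_error_H [OF q] C by (intro mult_left_mono) auto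
  finally have 1: "dd l \<le> K * H l" by (simp add: K_def mult_ac)
  have "est (Suc l) (u (Suc l) 0 0) \<le> q\<theta> * est l (u (Suc l) 0 0)" by (rule est_reduction [OF q])
  also have "\<dots> \<le> 1 * est l (u (Suc l) 0 0)" using q\<theta> h by (intro mult_right_mono) auto
  finally have 2: "est (Suc l) (u (Suc l) 0 0) \<le> 1 / g * H l" using h(6) by linarith
  have "dst (U (Suc l)) (u (Suc l) 0 0) \<le> dd l + dst (U l) (u (Suc l) 0 0)"
    by (rule edst_triangle [OF UX [OF q] UX [OF q0] uX [OF q]])
  then have "B (Suc l) 0 \<le> K * H l + H l + 1 / g * H l" using 1 2 h(5) by linarith
  then show ?thesis by (simp add: Cnext_def algebra_simps)
qed

lemma H_final_bound:
  assumes q: "(Suc l, 0, 0) \<in> Q" and p: "(l, k, j) \<in> Q"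
  shows "H l \<le> Cfin * (Csame * \<Delta> l k j)"
proof -
  obtain k' j' where kj: "(l, Suc k', j') \<in> Q" "kf l (Suc k') j'" and eq: "u (Suc l) 0 0 = u l (Suc k') j'"
    using level_final [OF q] by metis
  note nn = parts_nonneg [OF kj(1)]
  have "k \<le> Suc k'" by (rule kf_last [OF kj p])
  moreover have "j \<le> j'" if "k = Suc k'" using jf_last [OF kj(1) kf_jf [OF kj(2)]] p that by simp
  ultimately have "\<Delta> l (Suc k') j' \<le> Csame * \<Delta> l k j"
    by (intro same_level_bound [OF p kj(1)]) auto
  moreover have "H l \<le> Cfin * \<Delta> l (Suc k') j'"
  proof -
    have "H l \<le> (C + 1) * dst ustar (u l (Suc k') j') + g * est l (u l (Suc k') j')"
      using galerkin_error_bound [OF kj(1)] by (simp add: H_def eq)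
    also have "\<dots> \<le> Cfin * dst ustar (u l (Suc k') j') + Cfin * est l (u l (Suc k') j')"
      using nn g_pos C by (intro add_mono mult_right_mono) (auto simp: Cfin_def)
    also have "\<dots> \<le> Cfin * \<Delta> l (Suc k') j'"
      unfolding quasi_error_eq distrib_left [symmetric] using nn Cfin_ge by (intro mult_left_mono) auto
    finally show ?thesis .
  qed
  ultimately show ?thesis using Cfin_ge by (meson mult_left_mono order_trans zero_le_one)
qed

text \<open>The chain leads from the given index to the end of level \<open>l\<close>, along
  \<open>H\<close> to the end of the level before \<open>l'\<close>, then through the outer and the
  inner loop on level \<open>l'\<close>. Hence the exponent \<open>l' - Suc l\<close>.\<close>

lemma later_level_decay:
  assumes A: "1 \<le> A" "0 < \<rho>" and lin: "\<And>l n. (Suc (l + n), 0, 0) \<in> Q \<Longrightarrow> H (l + n) \<le> A * \<rho> ^ n * H l"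
    and p: "(l, k, j) \<in> Q" and p': "(l', k', j') \<in> Q" and ll: "l < l'"
  shows "\<Delta> l' k' j' \<le> Cup A * (\<rho> ^ (l' - Suc l) * qbar ^ k' * qalg ^ j') * \<Delta> l k j"
proof -
  obtain n where n: "l' = Suc (l + n)" using ll less_imp_Suc_add by blast
  have q': "(Suc (l + n), 0, 0) \<in> Q" using Q_level [OF p'] n by simp
  have q: "(Suc l, 0, 0) \<in> Q" using Q_level [OF p'] ll by simp
  note q0' = Q_row_start [OF p']
  have "\<Delta> l' k' j' \<le> Crow * qalg ^ (j' - 0) * \<Delta> l' k' 0" by (rule row_decay [OF p']) simp
  also have "\<dots> \<le> Crow * qalg ^ (j' - 0)
      * (Cstart * (Ccol * qbar ^ (k' - 0) * (Cnext * (A * \<rho> ^ n * (Cfin * (Csame * \<Delta> l k j))))))"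
  proof (intro mult_left_mono order_trans [OF start_bound [OF q0']])
    show "B l' k' \<le> Ccol * qbar ^ (k' - 0) * (Cnext * (A * \<rho> ^ n * (Cfin * (Csame * \<Delta> l k j))))"
    proof (rule order_trans [OF column_decay [OF q0', of 0]])
      have "B l' 0 \<le> Cnext * H (l + n)" using next_level_bound [OF q'] n by simp
      also have "\<dots> \<le> Cnext * (A * \<rho> ^ n * H l)" using lin [OF q'] Cnext_ge by (intro mult_left_mono) auto
      also have "\<dots> \<le> Cnext * (A * \<rho> ^ n * (Cfin * (Csame * \<Delta> l k j)))"
        using H_final_bound [OF q p] Cnext_ge A by (intro mult_left_mono) auto
      finally show "Ccol * qbar ^ (k' - 0) * B l' 0
          \<le> Ccol * qbar ^ (k' - 0) * (Cnext * (A * \<rho> ^ n * (Cfin * (Csame * \<Delta> l k j))))"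
        using Ccol_ge qbar by (intro mult_left_mono) auto
    qed simp
  qed (use Crow_ge Cstart_ge qalg in auto)
  also have "\<dots> = Cup A * (\<rho> ^ (l' - Suc l) * qbar ^ k' * qalg ^ j') * \<Delta> l k j"
    by (simp add: Cup_def n mult_ac)
  finally show ?thesis .
qed

theorem full_linear_convergence:
  assumes A: "1 \<le> A" "0 < \<rho>" "\<rho> < 1"
    and lin: "\<And>l n. (Suc (l + n), 0, 0) \<in> Q \<Longrightarrow> H (l + n) \<le> A * \<rho> ^ n * H l"
    and p: "p \<in> Q" and p': "p' \<in> Q" and less: "pos Q p' < pos Q p"
  shows "quasi_error P \<eta> ustar R p
    \<le> Csum A \<rho> * (1 - 1 / Csum A \<rho>) ^ (pos Q p - pos Q p') * quasi_error P \<eta> ustar R p'"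
proof -
  let ?D = "quasi_error P \<eta> ustar R" and ?r = "rate \<rho>" and ?M = "Csame + Cup A"
  \<comment> \<open>A common rate for levels, outer loops and inner loops, as required by the
    summation lemma.\<close>
  have r: "0 < ?r" "?r < 1" "\<rho> \<le> ?r" "qbar \<le> ?r" "qalg \<le> ?r"
    using A qbar qalg by (auto simp: rate_def)
  have "1 \<le> Crow * Cstart * Ccol * Cnext * A * Cfin * Csame"
    using Crow_ge Cstart_ge Ccol_ge Cnext_ge A Cfin_ge Csame_ge by (intro mult_ge1_I)
  then have up: "1 \<le> Cup A" by (simp add: Cup_def)
  have M: "0 \<le> ?M" "Csame \<le> ?M" "Cup A \<le> ?M" using up Csame_ge by auto
  let ?S = "1 / (1 - ?r) + (1 / (1 - ?r))\<^sup>2 + (1 / (1 - ?r)) ^ 3"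
  have S: "0 < ?S" using r by (intro add_pos_pos zero_less_power) auto
  \<comment> \<open>The summand 1 in \<open>Csum\<close> makes it exceed 1, so that
    \<open>1 - 1 / Csum A \<rho>\<close> is a positive rate.\<close>
  have Csum: "1 < Csum A \<rho>" "?M * ?S \<le> Csum A \<rho>"
    using mult_pos_pos [of ?M, OF _ S] M up Csame_ge by (auto simp: Csum_def)
  have Q: "enum_Q n \<in> Q" for n using range_enum_Q by blast
  have Dnn: "0 \<le> ?D (enum_Q n)" for n
    using quasi_error_nonneg Q [of n] by (cases "enum_Q n") auto
  have sum: "(\<Sum>i = a..b. ?D (enum_Q i)) \<le> Csum A \<rho> * ?D (enum_Q a)" for a b
  proof -
    obtain l k j where lkj: "enum_Q a = (l, k, j)" by (metis prod_cases3)
    have q: "(l, k, j) \<in> Q" using Q [of a] lkj by simp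
    note D0 = quasi_error_nonneg [OF q]
    have "(\<Sum>i = a..b. ?D (enum_Q i)) = (\<Sum>p\<in>enum_Q ` {a..b}. ?D p)"
      by (subst sum.reindex [OF inj_on_subset [OF inj_enum_Q]]) auto
    also have "\<dots> \<le> ?M * ?S * ?D (l, k, j)"
    proof (rule sum_lex_decay [where D = ?D and M = ?M and r = ?r, OF r(1,2) M(1) _ D0])
      show "finite (enum_Q ` {a..b})" by simp
      show "p = (l, k, j) \<or> ((l, k, j), p) \<in> lex3" if "p \<in> enum_Q ` {a..b}" for p
        using that enum_Q_less [of a] unfolding lkj [symmetric] by (metis atLeastAtMost_iff imageE le_neq_implies_less)
      have mem: "p \<in> Q" if "p \<in> enum_Q ` {a..b}" for p using that Q by auto
      show "?D (l, k, j') \<le> ?M * ?r ^ (j' - j) * ?D (l, k, j)"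
        if "(l, k, j') \<in> enum_Q ` {a..b}" "j \<le> j'" for j'
      proof (rule order_trans [OF row_decay [OF mem [OF that(1)] that(2)]])
        show "Crow * qalg ^ (j' - j) * ?D (l, k, j) \<le> ?M * ?r ^ (j' - j) * ?D (l, k, j)"
          using Csame_ge M Crow_ge qalg r D0 by (intro mult_right_mono mult_mono power_mono) auto
      qed
      show "?D (l, k', j') \<le> ?M * (?r ^ (k' - Suc k) * ?r ^ j') * ?D (l, k, j)"
        if "(l, k', j') \<in> enum_Q ` {a..b}" "k < k'" for k' j'
      proof (rule order_trans [OF same_level_decay [OF q mem [OF that(1)] that(2)]])
        show "Csame * (qbar ^ (k' - Suc k) * qalg ^ j') * ?D (l, k, j)
            \<le> ?M * (?r ^ (k' - Suc k) * ?r ^ j') * ?D (l, k, j)"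
          using M qbar qalg r D0 Csame_ge by (intro mult_right_mono mult_mono power_mono) auto
      qed
      show "?D (l', k', j') \<le> ?M * (?r ^ (l' - Suc l) * ?r ^ k' * ?r ^ j') * ?D (l, k, j)"
        if "(l', k', j') \<in> enum_Q ` {a..b}" "l < l'" for l' k' j'
      proof (rule order_trans [OF later_level_decay [OF A(1,2) lin q mem [OF that(1)] that(2)]])
        show "Cup A * (\<rho> ^ (l' - Suc l) * qbar ^ k' * qalg ^ j') * ?D (l, k, j)
            \<le> ?M * (?r ^ (l' - Suc l) * ?r ^ k' * ?r ^ j') * ?D (l, k, j)"
          using M qbar qalg r D0 A up by (intro mult_right_mono mult_mono power_mono) auto
      qed
    qed
    also have "\<dots> \<le> Csum A \<rho> * ?D (l, k, j)" using Csum(2) D0 by (rule mult_right_mono)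
    finally show ?thesis by (simp add: lkj)
  qed
  obtain a b where ab: "p = enum_Q a" "p' = enum_Q b" using p p' range_enum_Q by (metis imageE)
  then have "b \<le> a" using less by (simp add: pos_enum_Q)
  then have "?D (enum_Q a) \<le> Csum A \<rho> * (1 - 1 / Csum A \<rho>) ^ (a - b) * ?D (enum_Q b)"
    using linear_convergence_if_sum_bound [OF Csum(1) Dnn sum] by blast
  then show ?thesis by (simp add: ab pos_enum_Q)
qed

end

text \<open>\<open>A\<close> and \<open>\<rho>\<close> come from the sequence lemma, whose data are
  constants of this locale; hence they are available before a problem and a run are introduced, as
  uniformity demands.\<close>

lemma (in aisfem_small) uniform_linear_convergence:
  obtains Clin qlin where "0 < Clin" "0 < qlin" "qlin < 1"
    and "\<And>P \<alpha> L ustar \<eta> R m \<T>0 uG \<delta> \<Phi> \<Psi> Cmark p p'.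
      aisfem P \<alpha> L ustar \<eta> lamsym lamalg R C Cstab Crel qred qsym qalg \<theta> m \<T>0 uG \<delta> \<Phi> \<Psi> Cmark \<Longrightarrow>
      p \<in> QQ P \<eta> lamsym lamalg R \<Longrightarrow> p' \<in> QQ P \<eta> lamsym lamalg R \<Longrightarrow>
      pos (QQ P \<eta> lamsym lamalg R) p' < pos (QQ P \<eta> lamsym lamalg R) p \<Longrightarrow>
      quasi_error P \<eta> ustar R p
        \<le> Clin * qlin ^ (pos (QQ P \<eta> lamsym lamalg R) p - pos (QQ P \<eta> lamsym lamalg R) p') *
          quasi_error P \<eta> ustar R p'"
proof -
  have C0: "0 \<le> C" "0 \<le> 4 * C ^ 3 * 4 powr sector_exponent C * K\<^sup>2" using C by auto
  show ?thesis
  proof (rule R_linear_convergence [OF less_imp_le [OF qH(1)] qH(2) less_imp_le [OF K_pos] C0(2)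
        sector_exponent_bounds [OF C0(1)]])
    fix A \<rho> :: real assume A: "1 \<le> A" "0 < \<rho>" "\<rho> < 1"
      and lin: "\<And>H d M. (\<And>l. 0 \<le> H l) \<Longrightarrow> (\<And>l. 0 \<le> d l) \<Longrightarrow>
          (\<And>l. l < M \<Longrightarrow> H (Suc l) \<le> qH * (H l + d l)) \<Longrightarrow>
          (\<And>l k. l + k < M \<Longrightarrow> d (l + k) \<le> K * H l) \<Longrightarrow>
          (\<And>l n. 1 \<le> n \<Longrightarrow> l + n \<le> M \<Longrightarrow> (\<Sum>k<n. (d (l + k))\<^sup>2)
            \<le> (4 * C ^ 3 * 4 powr sector_exponent C * K\<^sup>2) * real n powr sector_exponent C * (H l)\<^sup>2) \<Longrightarrow>
          (\<And>l n. l + n \<le> M \<Longrightarrow> H (l + n) \<le> A * \<rho> ^ n * (H l :: real))"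
    have r: "0 < rate \<rho>" "rate \<rho> < 1" using A qbar qalg by (auto simp: rate_def)
    have "1 \<le> Crow * Cstart * Ccol * Cnext * A * Cfin * Csame"
      using Crow_ge Cstart_ge Ccol_ge Cnext_ge A Cfin_ge Csame_ge by (intro mult_ge1_I)
    then have "1 \<le> Csame + Cup A" using Csame_ge by (simp add: Cup_def)
    moreover have "0 < 1 / (1 - rate \<rho>) + (1 / (1 - rate \<rho>))\<^sup>2 + (1 / (1 - rate \<rho>)) ^ 3"
      using r by (intro add_pos_pos zero_less_power) auto
    ultimately have Csum: "1 < Csum A \<rho>" by (simp add: Csum_def)
    show ?thesis
    proof (rule that [of "Csum A \<rho>" "1 - 1 / Csum A \<rho>"])
      show "0 < Csum A \<rho>" "0 < 1 - 1 / Csum A \<rho>" "1 - 1 / Csum A \<rho> < 1" using Csum by auto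
      fix P \<alpha> L ustar \<eta> R m \<T>0 uG \<delta> \<Phi> \<Psi> Cmark p p'
      assume "aisfem P \<alpha> L ustar \<eta> lamsym lamalg R C Cstab Crel qred qsym qalg \<theta> m \<T>0 uG \<delta> \<Phi> \<Psi> Cmark"
      then interpret a: aisfem P \<alpha> L ustar \<eta> lamsym lamalg R C Cstab Crel qred qsym qalg \<theta> m \<T>0 uG \<delta> \<Phi> \<Psi> Cmark .
      have Hlin: "a.H (l + n) \<le> A * \<rho> ^ n * a.H l" if "(Suc (l + n), 0, 0) \<in> QQ P \<eta> lamsym lamalg R" for l n
        using lin that by (rule a.H_R_linear)
      assume "p \<in> QQ P \<eta> lamsym lamalg R" "p' \<in> QQ P \<eta> lamsym lamalg R"
        "pos (QQ P \<eta> lamsym lamalg R) p' < pos (QQ P \<eta> lamsym lamalg R) p"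
      then show "quasi_error P \<eta> ustar R p
          \<le> Csum A \<rho> * (1 - 1 / Csum A \<rho>) ^ (pos (QQ P \<eta> lamsym lamalg R) p - pos (QQ P \<eta> lamsym lamalg R) p') *
            quasi_error P \<eta> ustar R p'"
        by (intro a.full_linear_convergence [OF A Hlin])
    qed
  qed
qed

theorem theorem4p1:
  fixes Cstab Crel qred qsym qalg Ccea lamstar \<theta> lamsym :: real
  assumes "0 < Cstab" and "0 < Crel" and "0 < qred" and "qred < 1"
    and "0 < qsym" and "qsym < 1" and "0 < qalg" and "qalg < 1"
    and "0 < lamstar" and "0 < qbar_sym qsym qalg lamstar" and "qbar_sym qsym qalg lamstar < 1"
    and "0 < \<theta>" and "\<theta> \<le> 1" and "0 < lamsym" and "lamsym \<le> 1"
  shows "\<exists>(Clin :: real \<Rightarrow> real) (qlin :: real \<Rightarrow> real) (ell0 :: real \<Rightarrow> nat).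
    \<forall>(P :: bvp) (\<alpha> :: real) (L :: real) (m :: nat) (\<T>0 :: mesh) (ustar :: fn) (uG :: mesh \<Rightarrow> fn)
      (\<eta> :: estimator) (\<delta> :: real) (\<Phi> :: mesh \<Rightarrow> fn \<Rightarrow> fn)
      (\<Psi> :: mesh \<Rightarrow> (fn \<Rightarrow> real) \<Rightarrow> fn \<Rightarrow> fn) (Cmark :: real).
      problem_data P \<and> continuous_elliptic P \<and> energy_constants P \<alpha> L \<and> L / \<alpha> = Ccea \<and>
      exact_solution P ustar \<and>
      initial_mesh (dm P) (omega P) \<T>0 \<and> 1 \<le> m \<and> galerkin_solutions P m \<T>0 uG \<and>
      estimator_nonneg P m \<T>0 \<eta> \<and> stability P m \<T>0 \<eta> Cstab \<and> reduction P m \<T>0 \<eta> qred \<and>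
      reliability P \<T>0 \<eta> ustar uG Crel \<and>
      0 < \<delta> \<and> zarantonello_map P m \<T>0 \<delta> \<Phi> \<and> zarantonello_contraction P m \<T>0 \<Phi> qsym \<and>
      algebraic_solver P m \<T>0 \<Psi> qalg \<and> 1 \<le> Cmark \<longrightarrow>
      (\<exists>lam'. 0 < lam' \<and> lam' \<le> lamstar \<and>
        (\<forall>lamalg. 0 < lamalg \<and> lamalg \<le> lam' \<longrightarrow>
          0 < Clin lamalg \<and> 0 < qlin lamalg \<and> qlin lamalg < 1 \<and>
          (\<forall>R. aisfem_run P \<T>0 \<eta> \<delta> \<Phi> \<Psi> \<theta> Cmark lamsym lamalg R \<longrightarrow>
            (let Q = QQ P \<eta> lamsym lamalg R; \<Delta> = quasi_error P \<eta> ustar R in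
              enat (ell0 lamalg) \<le> ell_sup Q \<and>
              (\<forall>l k j l' k' j'.
                (l, k, j) \<in> Q \<and> (l', k', j') \<in> Q \<and>
                pos Q (l', k', j') < pos Q (l, k, j) \<and> ell0 lamalg \<le> l' \<longrightarrow>
                \<Delta> (l, k, j)
                  \<le> Clin lamalg * qlin lamalg ^ (pos Q (l, k, j) - pos Q (l', k', j')) *
                    \<Delta> (l', k', j'))))))"
proof (cases "1 \<le> Ccea")
  case False
  \<comment> \<open>Energy constants satisfy \<open>\<alpha> \<le> L\<close>, so no problem has a
    ratio below 1.\<close>
  have "\<not> (energy_constants P \<alpha> L \<and> L / \<alpha> = Ccea)" for P \<alpha> L
    using False by (auto simp: energy_constants_def)
  then show ?thesis by blast
next
  case True
  define c where "c = qalg / (1 - qalg)"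
  define q0 where "q0 = sqrt (1 - (1 - qred\<^sup>2) * \<theta>)"
  define g0 where "g0 = (1 - qsym) / (8 * Cstab)"
  \<comment> \<open>The stability and reduction conditions of \<open>aisfem_small\<close> solved for
    \<open>lamalg\<close>, where \<open>\<kappa> = 2 * c * lamalg\<close>; the bound by
    \<open>lamstar\<close> yields its condition on \<open>qsym\<close>.\<close>
  define lam' where "lam' = min lamstar (min ((1 - qsym) / (4 * Cstab)) (g0 * (1 - q0) / 8) / (2 * c))"
  have c: "0 < c" using assms by (simp add: c_def)
  have const: "aisfem_constants Ccea Cstab Crel qred qsym qalg \<theta> lamsym lamalg" if "0 < lamalg" for lamalg
    using assms True that by unfold_locales auto
  have g0: "0 < g0" using assms by (simp add: g0_def)
  have q0: "q0 < 1"
    using aisfem_constants.q\<theta>(2) [OF const, of 1] aisfem_constants.q\<theta>_def [OF const, of 1] by (simp add: q0_def)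
  have lam': "0 < lam'" "lam' \<le> lamstar" using assms c g0 q0 by (auto simp: lam'_def)
  have star: "2 * c * lamstar < 1" "qsym + 2 * c * lamstar < 1 - 2 * c * lamstar"
  proof -
    have num: "0 < qsym + 2 * c * lamstar" using assms c by (simp add: add_pos_pos)
    have quot: "0 < (qsym + 2 * c * lamstar) / (1 - 2 * c * lamstar)" "(qsym + 2 * c * lamstar) / (1 - 2 * c * lamstar) < 1"
      using assms by (simp_all add: qbar_sym_def c_def)
    \<comment> \<open>A positive quotient with positive numerator has a positive denominator, so the
      upper bound 1 may be multiplied out.\<close>
    then have "0 < 1 - 2 * c * lamstar" using num by (simp add: zero_less_divide_iff)
    then show "2 * c * lamstar < 1" "qsym + 2 * c * lamstar < 1 - 2 * c * lamstar"
      using quot(2) by (simp_all add: divide_less_eq)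
  qed
  have small: "aisfem_small Ccea Cstab Crel qred qsym qalg \<theta> lamsym lamalg"
    if lam: "0 < lamalg" "lamalg \<le> lam'" for lamalg
  proof -
    interpret aisfem_constants Ccea Cstab Crel qred qsym qalg \<theta> lamsym lamalg by (rule const [OF lam(1)])
    have \<kappa>: "\<kappa> = 2 * c * lamalg" by (simp add: \<kappa>_def c_def)
    have *: "\<kappa> \<le> 2 * c * lamstar" unfolding \<kappa> using c lam lam' by (intro mult_left_mono) auto
    have "lamalg \<le> min ((1 - qsym) / (4 * Cstab)) (g0 * (1 - q0) / 8) / (2 * c)"
      using lam(2) unfolding lam'_def by linarith
    then have "\<kappa> \<le> min ((1 - qsym) / (4 * Cstab)) (g0 * (1 - q0) / 8)"
      using c by (simp add: \<kappa> pos_le_divide_eq mult_ac)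
    then have "\<kappa> \<le> (1 - qsym) / (4 * Cstab)" "\<kappa> \<le> g0 * (1 - q0) / 8" by auto
    with * show ?thesis
    proof unfold_locales
      show "qsym + \<kappa> < 1 - \<kappa>" using star(2) \<open>\<kappa> \<le> 2 * c * lamstar\<close> by linarith
      show "\<kappa> * Cstab \<le> (1 - qsym) / 4"
        using \<open>\<kappa> \<le> (1 - qsym) / (4 * Cstab)\<close> Cstab by (simp add: pos_le_divide_eq mult_ac)
      show "\<kappa> \<le> g * (1 - q\<theta>) / 8"
        using \<open>\<kappa> \<le> g0 * (1 - q0) / 8\<close> by (simp add: g_def g0_def q\<theta>_def q0_def)
    qed
  qed
  \<comment> \<open>Bundles the uniform estimate, so that a single choice yields \<open>Clin\<close>
    and \<open>qlin\<close> as functions of \<open>lamalg\<close> alone.\<close>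
  define S where "S lamalg Clin qlin \<longleftrightarrow> 0 < Clin \<and> 0 < qlin \<and> qlin < 1 \<and>
      (\<forall>P \<alpha> L ustar \<eta> R m \<T>0 uG \<delta> \<Phi> \<Psi> Cmark p p'.
        aisfem P \<alpha> L ustar \<eta> lamsym lamalg R Ccea Cstab Crel qred qsym qalg \<theta> m \<T>0 uG \<delta> \<Phi> \<Psi> Cmark \<longrightarrow>
        p \<in> QQ P \<eta> lamsym lamalg R \<longrightarrow> p' \<in> QQ P \<eta> lamsym lamalg R \<longrightarrow>
        pos (QQ P \<eta> lamsym lamalg R) p' < pos (QQ P \<eta> lamsym lamalg R) p \<longrightarrow>
        quasi_error P \<eta> ustar R p
          \<le> Clin * qlin ^ (pos (QQ P \<eta> lamsym lamalg R) p - pos (QQ P \<eta> lamsym lamalg R) p') *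
            quasi_error P \<eta> ustar R p')" for lamalg Clin qlin
  have "\<exists>Clin qlin. S lamalg Clin qlin" if "0 < lamalg \<and> lamalg \<le> lam'" for lamalg
  proof -
    have sm: "aisfem_small Ccea Cstab Crel qred qsym qalg \<theta> lamsym lamalg" using small that by blast
    show ?thesis
    proof (rule aisfem_small.uniform_linear_convergence [OF sm])
      fix Clin qlin
      assume *: "0 < Clin" "0 < qlin" "qlin < 1" and lin: "\<And>P \<alpha> L ustar \<eta> R m \<T>0 uG \<delta> \<Phi> \<Psi> Cmark p p'.
      aisfem P \<alpha> L ustar \<eta> lamsym lamalg R Ccea Cstab Crel qred qsym qalg \<theta> m \<T>0 uG \<delta> \<Phi> \<Psi> Cmark \<Longrightarrow>
      p \<in> QQ P \<eta> lamsym lamalg R \<Longrightarrow> p' \<in> QQ P \<eta> lamsym lamalg R \<Longrightarrow>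
      pos (QQ P \<eta> lamsym lamalg R) p' < pos (QQ P \<eta> lamsym lamalg R) p \<Longrightarrow>
      quasi_error P \<eta> ustar R p
        \<le> Clin * qlin ^ (pos (QQ P \<eta> lamsym lamalg R) p - pos (QQ P \<eta> lamsym lamalg R) p') *
          quasi_error P \<eta> ustar R p'"
      have "S lamalg Clin qlin" unfolding S_def by (intro conjI * allI impI lin)
      then show ?thesis by blast
    qed
  qed
  then obtain Clin qlin where lin: "\<And>lamalg. 0 < lamalg \<and> lamalg \<le> lam' \<Longrightarrow> S lamalg (Clin lamalg) (qlin lamalg)"
    by metis
  show ?thesis
  proof (rule exI [of _ Clin], rule exI [of _ qlin], rule exI [of _ "\<lambda>_. 0"], intro allI impI, elim conjE)
    fix P \<alpha> L m \<T>0 ustar uG \<eta> \<delta> \<Phi> \<Psi> Cmark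
    assume hyps: "problem_data P" "energy_constants P \<alpha> L" "L / \<alpha> = Ccea" "exact_solution P ustar"
      "initial_mesh (dm P) (omega P) \<T>0" "galerkin_solutions P m \<T>0 uG"
      "stability P m \<T>0 \<eta> Cstab" "reduction P m \<T>0 \<eta> qred" "reliability P \<T>0 \<eta> ustar uG Crel"
      "zarantonello_map P m \<T>0 \<delta> \<Phi>" "zarantonello_contraction P m \<T>0 \<Phi> qsym"
      "algebraic_solver P m \<T>0 \<Psi> qalg"
    show "\<exists>lam'>0. lam' \<le> lamstar \<and>
      (\<forall>lamalg. 0 < lamalg \<and> lamalg \<le> lam' \<longrightarrow>
        0 < Clin lamalg \<and> 0 < qlin lamalg \<and> qlin lamalg < 1 \<and>
        (\<forall>R. aisfem_run P \<T>0 \<eta> \<delta> \<Phi> \<Psi> \<theta> Cmark lamsym lamalg R \<longrightarrow>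
          (let Q = QQ P \<eta> lamsym lamalg R; \<Delta> = quasi_error P \<eta> ustar R in
            enat 0 \<le> ell_sup Q \<and>
            (\<forall>l k j l' k' j'.
              (l, k, j) \<in> Q \<and> (l', k', j') \<in> Q \<and>
              pos Q (l', k', j') < pos Q (l, k, j) \<and> 0 \<le> l' \<longrightarrow>
              \<Delta> (l, k, j)
                \<le> Clin lamalg * qlin lamalg ^ (pos Q (l, k, j) - pos Q (l', k', j')) *
                  \<Delta> (l', k', j')))))"
    proof (intro exI [of _ lam'] conjI lam' allI impI)
      fix lamalg assume lam: "0 < lamalg \<and> lamalg \<le> lam'"
      then show "0 < Clin lamalg" "0 < qlin lamalg" "qlin lamalg < 1" using lin [of lamalg] unfolding S_def by blast+
      fix R assume run: "aisfem_run P \<T>0 \<eta> \<delta> \<Phi> \<Psi> \<theta> Cmark lamsym lamalg R"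
      have "aisfem_small Ccea Cstab Crel qred qsym qalg \<theta> lamsym lamalg" using small lam by blast
      then have "aisfem P \<alpha> L ustar \<eta> lamsym lamalg R Ccea Cstab Crel qred qsym qalg \<theta> m \<T>0 uG \<delta> \<Phi> \<Psi> Cmark"
        using hyps run by (intro aisfem.intro elliptic_problem.intro aisfem_axioms.intro)
      then have *: "quasi_error P \<eta> ustar R p
          \<le> Clin lamalg * qlin lamalg ^ (pos (QQ P \<eta> lamsym lamalg R) p - pos (QQ P \<eta> lamsym lamalg R) p') *
            quasi_error P \<eta> ustar R p'"
        if "p \<in> QQ P \<eta> lamsym lamalg R" "p' \<in> QQ P \<eta> lamsym lamalg R"
          "pos (QQ P \<eta> lamsym lamalg R) p' < pos (QQ P \<eta> lamsym lamalg R) p" for p p'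
        using lin [OF lam] that unfolding S_def by blast
      show "let Q = QQ P \<eta> lamsym lamalg R; \<Delta> = quasi_error P \<eta> ustar R in
            enat 0 \<le> ell_sup Q \<and>
            (\<forall>l k j l' k' j'.
              (l, k, j) \<in> Q \<and> (l', k', j') \<in> Q \<and>
              pos Q (l', k', j') < pos Q (l, k, j) \<and> 0 \<le> l' \<longrightarrow>
              \<Delta> (l, k, j)
                \<le> Clin lamalg * qlin lamalg ^ (pos Q (l, k, j) - pos Q (l', k', j')) *
                  \<Delta> (l', k', j'))"
        unfolding Let_def zero_enat_def [symmetric]
        by (intro conjI allI impI zero_le; elim conjE; rule *)
    qed
  qed
qed

end
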